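(* Let $\Lambda$ be a finite dimensional Auslander algebra over an algebraically closed field $k$, and let $I$ be an indecomposable injective $\Lambda$-module. Then $I$ is projective if and only if the projective dimension of its socle satisfies $\mathrm{pd}_{\Lambda}\,\mathrm{soc}\,I\leq 1$. That is, $$\mathcal{C}(\Lambda)=\{\, I\in \mathrm{mod}\text{-}\Lambda \mid I \text{ is injective and } \mathrm{pd}_{\Lambda}\,\mathrm{soc}\,I\leq 1\,\}.$$
   Context: Standing conventions: $k$ is an algebraically closed field; all algebras are basic finite dimensional $k$-algebras; modules are finitely generated right modules, and $\mathrm{mod}\text{-}\Lambda$ is the category of finitely generated right $\Lambda$-modules. $\mathrm{pd}_\Lambda M$ denotes the projective dimension of $M$ and $\mathrm{soc}\,M$ its socle. A finite dimensional algebra $\Lambda$ is an Auslander algebra if its global dimension is at most two and its dominant dimension is at least two, that is, in the minimal injective resolution $0\to\Lambda\to I_0\to I_1\to I_2\to 0$ of $\Lambda$ (as a right $\Lambda$-module), both $I_0$ and $I_1$ are projective $\Lambda$-modules (terms of the resolution may be zero). $\mathcal{C}(\Lambda)$ is the full subcategory of $\mathrm{mod}\text{-}\Lambda$ whose objects are all the $\Lambda$-modules that are both projective and injective; the displayed equality is an equality of full subcategories (i.e. of classes of objects). *)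

theory Defs
  imports "HOL-Algebra.Algebra" "HOL-Library.Extended_Nat"
begin

section \<open>Finite dimensional algebras and right modules\<close>

text \<open>
  The library locale \<open>algebra\<close> is restricted to commutative algebras, and its \<open>module\<close> to
  modules over commutative rings.  An algebra over \<open>K\<close> is still given by a \<open>module\<close> record, with
  \<open>mult\<close> the product of the algebra and \<open>smult\<close> the scalar action of \<open>K\<close>.
\<close>

locale fin_dim_algebra = module K \<Lambda> + K: field K + \<Lambda>: ring \<Lambda>
  for K :: "'k ring" and \<Lambda> :: "('k, 'a) module" (structure) +
  assumes smult_mult_left: "\<lbrakk>c \<in> carrier K; x \<in> carrier \<Lambda>; y \<in> carrier \<Lambda>\<rbrakk> \<Longrightarrow>
      (c \<odot> x) \<otimes> y = c \<odot> (x \<otimes> y)"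
    and smult_mult_right: "\<lbrakk>c \<in> carrier K; x \<in> carrier \<Lambda>; y \<in> carrier \<Lambda>\<rbrakk> \<Longrightarrow>
      x \<otimes> (c \<odot> y) = c \<odot> (x \<otimes> y)"
    and fin_dim: "\<exists>B. finite B \<and> B \<subseteq> carrier \<Lambda> \<and>
      (\<forall>x \<in> carrier \<Lambda>. \<exists>c \<in> B \<rightarrow> carrier K. x = (\<Oplus>b\<in>B. c b \<odot> b))"

text \<open>
  As in the library's \<open>module\<close> record, the fields \<open>mult\<close> and \<open>one\<close> inherited from \<open>ring\<close> play no
  role for a module.
\<close>

record ('a, 'm) rmodule = "'m ring" +
  ract :: "'m \<Rightarrow> 'a \<Rightarrow> 'm" (infixl \<open>\<triangleleft>\<index>\<close> 70)

locale right_module = R: ring R + M?: abelian_group M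
  for R :: "('a, 'r) ring_scheme" (structure) and M :: "('a, 'm) rmodule" (structure) +
  assumes ract_closed: "\<lbrakk>x \<in> carrier M; a \<in> carrier R\<rbrakk> \<Longrightarrow> x \<triangleleft>\<^bsub>M\<^esub> a \<in> carrier M"
    and ract_l_distr: "\<lbrakk>x \<in> carrier M; y \<in> carrier M; a \<in> carrier R\<rbrakk> \<Longrightarrow>
      (x \<oplus>\<^bsub>M\<^esub> y) \<triangleleft>\<^bsub>M\<^esub> a = x \<triangleleft>\<^bsub>M\<^esub> a \<oplus>\<^bsub>M\<^esub> y \<triangleleft>\<^bsub>M\<^esub> a"
    and ract_r_distr: "\<lbrakk>x \<in> carrier M; a \<in> carrier R; b \<in> carrier R\<rbrakk> \<Longrightarrow>
      x \<triangleleft>\<^bsub>M\<^esub> (a \<oplus>\<^bsub>R\<^esub> b) = x \<triangleleft>\<^bsub>M\<^esub> a \<oplus>\<^bsub>M\<^esub> x \<triangleleft>\<^bsub>M\<^esub> b"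
    and ract_assoc: "\<lbrakk>x \<in> carrier M; a \<in> carrier R; b \<in> carrier R\<rbrakk> \<Longrightarrow>
      x \<triangleleft>\<^bsub>M\<^esub> (a \<otimes>\<^bsub>R\<^esub> b) = (x \<triangleleft>\<^bsub>M\<^esub> a) \<triangleleft>\<^bsub>M\<^esub> b"
    and ract_one: "x \<in> carrier M \<Longrightarrow> x \<triangleleft>\<^bsub>M\<^esub> \<one>\<^bsub>R\<^esub> = x"

text \<open>
  The objects of mod-\<open>\<Lambda>\<close> whose elements are of type \<open>'m\<close>.  No separate scalar action of the field
  is needed: it is \<open>x \<triangleleft> (c \<odot> \<one>)\<close>.
\<close>

definition mods :: "('k, 'a) module \<Rightarrow> ('a, 'm) rmodule set" where
  "mods \<Lambda> = {M. right_module \<Lambda> M \<and>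
     (\<exists>S. finite S \<and> S \<subseteq> carrier M \<and>
       (\<forall>m \<in> carrier M. \<exists>c \<in> S \<rightarrow> carrier \<Lambda>. m = (\<Oplus>\<^bsub>M\<^esub>x\<in>S. x \<triangleleft>\<^bsub>M\<^esub> c x)))}"

definition reg_module :: "('k, 'a) module \<Rightarrow> ('a, 'a) rmodule" where
  "reg_module \<Lambda> = \<lparr>carrier = carrier \<Lambda>, monoid.mult = monoid.mult \<Lambda>, one = \<one>\<^bsub>\<Lambda>\<^esub>,
     ring.zero = \<zero>\<^bsub>\<Lambda>\<^esub>, ring.add = ring.add \<Lambda>, ract = monoid.mult \<Lambda>\<rparr>"

definition rhom :: "('k, 'a) module \<Rightarrow> ('a, 'm) rmodule \<Rightarrow> ('a, 'n) rmodule \<Rightarrow> ('m \<Rightarrow> 'n) set" where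
  "rhom \<Lambda> M N = {f \<in> carrier M \<rightarrow> carrier N.
     (\<forall>x \<in> carrier M. \<forall>y \<in> carrier M. f (x \<oplus>\<^bsub>M\<^esub> y) = f x \<oplus>\<^bsub>N\<^esub> f y) \<and>
     (\<forall>x \<in> carrier M. \<forall>a \<in> carrier \<Lambda>. f (x \<triangleleft>\<^bsub>M\<^esub> a) = f x \<triangleleft>\<^bsub>N\<^esub> a)}"

definition rmod_iso :: "('k, 'a) module \<Rightarrow> ('a, 'm) rmodule \<Rightarrow> ('a, 'n) rmodule \<Rightarrow> bool" where
  "rmod_iso \<Lambda> M N \<longleftrightarrow> (\<exists>f \<in> rhom \<Lambda> M N. bij_betw f (carrier M) (carrier N))"

definition rsubmodule :: "('k, 'a) module \<Rightarrow> 'm set \<Rightarrow> ('a, 'm) rmodule \<Rightarrow> bool" where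
  "rsubmodule \<Lambda> N M \<longleftrightarrow> subgroup N (add_monoid M) \<and>
     (\<forall>x \<in> N. \<forall>a \<in> carrier \<Lambda>. x \<triangleleft>\<^bsub>M\<^esub> a \<in> N)"

definition simple_rsubmodule :: "('k, 'a) module \<Rightarrow> 'm set \<Rightarrow> ('a, 'm) rmodule \<Rightarrow> bool" where
  "simple_rsubmodule \<Lambda> S M \<longleftrightarrow> rsubmodule \<Lambda> S M \<and> S \<noteq> {\<zero>\<^bsub>M\<^esub>} \<and>
     (\<forall>N. rsubmodule \<Lambda> N M \<and> N \<subseteq> S \<longrightarrow> N = {\<zero>\<^bsub>M\<^esub>} \<or> N = S)"

text \<open>
  The sum of all simple submodules, written as the least submodule containing each of them.
\<close>

definition soc :: "('k, 'a) module \<Rightarrow> ('a, 'm) rmodule \<Rightarrow> ('a, 'm) rmodule" where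
  "soc \<Lambda> M = M\<lparr>carrier :=
     \<Inter> {N. rsubmodule \<Lambda> N M \<and> (\<forall>S. simple_rsubmodule \<Lambda> S M \<longrightarrow> S \<subseteq> N)}\<rparr>"

definition indecomposable :: "('k, 'a) module \<Rightarrow> ('a, 'm) rmodule \<Rightarrow> bool" where
  "indecomposable \<Lambda> M \<longleftrightarrow> carrier M \<noteq> {\<zero>\<^bsub>M\<^esub>} \<and>
     (\<forall>A B. rsubmodule \<Lambda> A M \<and> rsubmodule \<Lambda> B M \<and>
        A <+>\<^bsub>M\<^esub> B = carrier M \<and> A \<inter> B = {\<zero>\<^bsub>M\<^esub>} \<longrightarrow>
        A = {\<zero>\<^bsub>M\<^esub>} \<or> B = {\<zero>\<^bsub>M\<^esub>})"

text \<open>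
  A submodule is essential if it meets every nonzero submodule nontrivially.
\<close>

definition essential_rsubmodule :: "('k, 'a) module \<Rightarrow> 'm set \<Rightarrow> ('a, 'm) rmodule \<Rightarrow> bool" where
  "essential_rsubmodule \<Lambda> E M \<longleftrightarrow> rsubmodule \<Lambda> E M \<and>
     (\<forall>N. rsubmodule \<Lambda> N M \<and> N \<noteq> {\<zero>\<^bsub>M\<^esub>} \<longrightarrow> E \<inter> N \<noteq> {\<zero>\<^bsub>M\<^esub>})"

section \<open>Basic algebras\<close>

definition idempotent_of :: "('k, 'a) module \<Rightarrow> 'a \<Rightarrow> bool" where
  "idempotent_of \<Lambda> e \<longleftrightarrow> e \<in> carrier \<Lambda> \<and> e \<otimes>\<^bsub>\<Lambda>\<^esub> e = e"

definition primitive_idempotent :: "('k, 'a) module \<Rightarrow> 'a \<Rightarrow> bool" where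
  "primitive_idempotent \<Lambda> e \<longleftrightarrow> idempotent_of \<Lambda> e \<and> e \<noteq> \<zero>\<^bsub>\<Lambda>\<^esub> \<and>
     (\<forall>f g. idempotent_of \<Lambda> f \<and> idempotent_of \<Lambda> g \<and> f \<otimes>\<^bsub>\<Lambda>\<^esub> g = \<zero>\<^bsub>\<Lambda>\<^esub> \<and> g \<otimes>\<^bsub>\<Lambda>\<^esub> f = \<zero>\<^bsub>\<Lambda>\<^esub> \<and>
        e = f \<oplus>\<^bsub>\<Lambda>\<^esub> g \<longrightarrow> f = \<zero>\<^bsub>\<Lambda>\<^esub> \<or> g = \<zero>\<^bsub>\<Lambda>\<^esub>)"

definition idem_module :: "('k, 'a) module \<Rightarrow> 'a \<Rightarrow> ('a, 'a) rmodule" where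
  "idem_module \<Lambda> e = (reg_module \<Lambda>)\<lparr>carrier := (\<lambda>x. e \<otimes>\<^bsub>\<Lambda>\<^esub> x) ` carrier \<Lambda>\<rparr>"

definition basic_algebra :: "('k, 'a) module \<Rightarrow> bool" where
  "basic_algebra \<Lambda> \<longleftrightarrow> (\<exists>E. finite E \<and> (\<forall>e \<in> E. primitive_idempotent \<Lambda> e) \<and>
     (\<forall>e \<in> E. \<forall>f \<in> E. e \<noteq> f \<longrightarrow> e \<otimes>\<^bsub>\<Lambda>\<^esub> f = \<zero>\<^bsub>\<Lambda>\<^esub>) \<and>
     (\<Oplus>\<^bsub>\<Lambda>\<^esub>e\<in>E. e) = \<one>\<^bsub>\<Lambda>\<^esub> \<and>
     (\<forall>e \<in> E. \<forall>f \<in> E. e \<noteq> f \<longrightarrow> \<not> rmod_iso \<Lambda> (idem_module \<Lambda> e) (idem_module \<Lambda> f)))"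

section \<open>Finitely generated modules up to isomorphism\<close>

text \<open>
  Definitions that quantify over all of mod-\<open>\<Lambda>\<close> (test objects of lifting properties, terms of
  resolutions, the supremum in the global dimension) need a fixed type of elements, and use
  \<open>nat \<Rightarrow> 'k\<close>.  The lemma \<open>mods_universe\<close> says that every finitely generated module, over any type
  of elements, has an isomorphic copy there.
\<close>

type_synonym ('k, 'a) umodule = "('a, nat \<Rightarrow> 'k) rmodule"

definition rmod_image :: "('m \<Rightarrow> 'n) \<Rightarrow> ('a, 'm) rmodule \<Rightarrow> ('a, 'n) rmodule" where
  "rmod_image \<phi> M = (let \<psi> = inv_into (carrier M) \<phi> in
     \<lparr>carrier = \<phi> ` carrier M, monoid.mult = undefined, one = undefined, ring.zero = \<phi> \<zero>\<^bsub>M\<^esub>,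
      ring.add = (\<lambda>x y. \<phi> (\<psi> x \<oplus>\<^bsub>M\<^esub> \<psi> y)), ract = (\<lambda>x a. \<phi> (\<psi> x \<triangleleft>\<^bsub>M\<^esub> a))\<rparr>)"

lemma fin_gen_inj:
  fixes \<Lambda> :: "('k, 'a) module" and M :: "('a, 'm) rmodule"
  assumes "fin_dim_algebra K \<Lambda>" and "M \<in> mods \<Lambda>"
  shows "\<exists>\<phi> :: 'm \<Rightarrow> nat \<Rightarrow> 'k. inj_on \<phi> (carrier M)"
proof -
  interpret L: fin_dim_algebra K \<Lambda> by fact
  interpret M: right_module \<Lambda> M using assms(2) by (simp add: mods_def)
  obtain S where S: "finite S" "S \<subseteq> carrier M"
    "\<forall>m \<in> carrier M. \<exists>c \<in> S \<rightarrow> carrier \<Lambda>. m = (\<Oplus>\<^bsub>M\<^esub>x\<in>S. x \<triangleleft>\<^bsub>M\<^esub> c x)"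
    using assms(2) by (auto simp: mods_def)
  then obtain c where c: "\<And>m. m \<in> carrier M \<Longrightarrow> c m \<in> S \<rightarrow> carrier \<Lambda>"
    "\<And>m. m \<in> carrier M \<Longrightarrow> m = (\<Oplus>\<^bsub>M\<^esub>x\<in>S. x \<triangleleft>\<^bsub>M\<^esub> c m x)" by metis
  obtain B where B: "finite B" "B \<subseteq> carrier \<Lambda>"
    "\<forall>x \<in> carrier \<Lambda>. \<exists>d \<in> B \<rightarrow> carrier K. x = (\<Oplus>\<^bsub>\<Lambda>\<^esub>b\<in>B. d b \<odot>\<^bsub>\<Lambda>\<^esub> b)"
    using L.fin_dim by blast
  then obtain d where d: "\<And>a. a \<in> carrier \<Lambda> \<Longrightarrow> d a \<in> B \<rightarrow> carrier K"
    "\<And>a. a \<in> carrier \<Lambda> \<Longrightarrow> a = (\<Oplus>\<^bsub>\<Lambda>\<^esub>b\<in>B. d a b \<odot>\<^bsub>\<Lambda>\<^esub> b)" by metis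
  have "finite (S \<times> B)" using S B by simp
  then obtain e :: "'m \<times> 'a \<Rightarrow> nat" where e: "inj_on e (S \<times> B)"
    using finite_imp_inj_to_nat_seg by blast
  define \<phi> where "\<phi> m n = (case inv_into (S \<times> B) e n of (x, b) \<Rightarrow> d (c m x) b)" for m n
  have "inj_on \<phi> (carrier M)"
  proof (rule inj_onI)
    fix m m' assume m: "m \<in> carrier M" "m' \<in> carrier M" and eq: "\<phi> m = \<phi> m'"
    have dd: "d (c m x) b = d (c m' x) b" if "x \<in> S" "b \<in> B" for x b
      using fun_cong[OF eq, of "e (x, b)"] that e by (simp add: \<phi>_def)
    have cc: "c m x = c m' x" if x: "x \<in> S" for x
    proof -
      have cx: "c m x \<in> carrier \<Lambda>" "c m' x \<in> carrier \<Lambda>" using c(1) m x by auto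
      have "(\<Oplus>\<^bsub>\<Lambda>\<^esub>b\<in>B. d (c m x) b \<odot>\<^bsub>\<Lambda>\<^esub> b) = (\<Oplus>\<^bsub>\<Lambda>\<^esub>b\<in>B. d (c m' x) b \<odot>\<^bsub>\<Lambda>\<^esub> b)"
      proof (rule L.M.finsum_cong'[OF refl])
        show "(\<lambda>b. d (c m' x) b \<odot>\<^bsub>\<Lambda>\<^esub> b) \<in> B \<rightarrow> carrier \<Lambda>"
          using d(1)[OF cx(2)] B(2) by (intro Pi_I L.smult_closed) auto
      qed (simp add: dd x)
      with d(2)[OF cx(1)] d(2)[OF cx(2)] show ?thesis by simp
    qed
    have "(\<Oplus>\<^bsub>M\<^esub>x\<in>S. x \<triangleleft>\<^bsub>M\<^esub> c m x) = (\<Oplus>\<^bsub>M\<^esub>x\<in>S. x \<triangleleft>\<^bsub>M\<^esub> c m' x)"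
    proof (rule M.finsum_cong'[OF refl])
      show "(\<lambda>x. x \<triangleleft>\<^bsub>M\<^esub> c m' x) \<in> S \<rightarrow> carrier M"
        using c(1)[OF m(2)] S(2) by (intro Pi_I M.ract_closed) auto
    qed (simp add: cc)
    with c(2)[OF m(1)] c(2)[OF m(2)] show "m = m'" by simp
  qed
  then show ?thesis by blast
qed

lemma rmod_image_props:
  fixes \<Lambda> :: "('k, 'a) module" and M :: "('a, 'm) rmodule" and \<phi> :: "'m \<Rightarrow> 'n"
  assumes M: "M \<in> mods \<Lambda>" and inj: "inj_on \<phi> (carrier M)"
  shows "rmod_image \<phi> M \<in> mods \<Lambda>" and "rmod_iso \<Lambda> M (rmod_image \<phi> M)"
proof -
  interpret M: right_module \<Lambda> M using M by (simp add: mods_def)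
  let ?N = "rmod_image \<phi> M"
  have psi: "inv_into (carrier M) \<phi> (\<phi> x) = x" if "x \<in> carrier M" for x
    using inj that by simp
  have car: "carrier ?N = \<phi> ` carrier M" and zero: "\<zero>\<^bsub>?N\<^esub> = \<phi> \<zero>\<^bsub>M\<^esub>"
    by (simp_all add: rmod_image_def Let_def)
  have add: "\<phi> x \<oplus>\<^bsub>?N\<^esub> \<phi> y = \<phi> (x \<oplus>\<^bsub>M\<^esub> y)" if "x \<in> carrier M" "y \<in> carrier M" for x y
    using that by (simp add: rmod_image_def Let_def psi)
  have act: "\<phi> x \<triangleleft>\<^bsub>?N\<^esub> a = \<phi> (x \<triangleleft>\<^bsub>M\<^esub> a)" if "x \<in> carrier M" for x a
    using that by (simp add: rmod_image_def Let_def psi)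
  have ag: "abelian_group ?N"
  proof (rule abelian_groupI)
    fix x assume "x \<in> carrier ?N"
    then obtain u where u: "u \<in> carrier M" "x = \<phi> u" by (auto simp: car)
    show "\<exists>y \<in> carrier ?N. y \<oplus>\<^bsub>?N\<^esub> x = \<zero>\<^bsub>?N\<^esub>"
      by (rule bexI[of _ "\<phi> (\<ominus>\<^bsub>M\<^esub> u)"]) (simp_all add: car zero add u M.l_neg)
  qed (auto simp: car zero add M.a_ac)
  have rm: "right_module \<Lambda> ?N"
  proof (intro right_module.intro right_module_axioms.intro ag M.R.ring_axioms)
  qed (auto simp: car zero add act M.ract_closed M.ract_l_distr M.ract_r_distr M.ract_assoc M.ract_one)
  interpret N: right_module \<Lambda> ?N by (rule rm)
  have fs: "(\<Oplus>\<^bsub>?N\<^esub>y\<in>\<phi> ` S. y \<triangleleft>\<^bsub>?N\<^esub> h y) = \<phi> (\<Oplus>\<^bsub>M\<^esub>x\<in>S. x \<triangleleft>\<^bsub>M\<^esub> h (\<phi> x))"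
    if "finite S" "S \<subseteq> carrier M" "h \<in> \<phi> ` S \<rightarrow> carrier \<Lambda>" for S h
    using that
  proof (induction S rule: finite_induct)
    case empty then show ?case by (simp add: zero)
  next
    case (insert x S)
    have nin: "\<phi> x \<notin> \<phi> ` S" using insert.hyps insert.prems inj
      by (auto dest!: inj_onD)
    have x: "x \<in> carrier M" and hx: "h (\<phi> x) \<in> carrier \<Lambda>" and Sc: "S \<subseteq> carrier M"
      and hS: "h \<in> \<phi> ` S \<rightarrow> carrier \<Lambda>" using insert.prems by auto
    have f: "(\<lambda>x. x \<triangleleft>\<^bsub>M\<^esub> h (\<phi> x)) \<in> S \<rightarrow> carrier M"
      using Sc hS by (intro Pi_I M.ract_closed) auto
    have g: "(\<lambda>y. y \<triangleleft>\<^bsub>?N\<^esub> h y) \<in> \<phi> ` S \<rightarrow> carrier ?N"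
      using Sc hS by (intro Pi_I N.ract_closed) (auto simp: car)
    have gx: "\<phi> x \<triangleleft>\<^bsub>?N\<^esub> h (\<phi> x) \<in> carrier ?N"
      using x hx by (intro N.ract_closed) (auto simp: car)
    have "(\<Oplus>\<^bsub>?N\<^esub>y\<in>\<phi> ` insert x S. y \<triangleleft>\<^bsub>?N\<^esub> h y) =
        \<phi> x \<triangleleft>\<^bsub>?N\<^esub> h (\<phi> x) \<oplus>\<^bsub>?N\<^esub> (\<Oplus>\<^bsub>?N\<^esub>y\<in>\<phi> ` S. y \<triangleleft>\<^bsub>?N\<^esub> h y)"
      using insert.hyps nin g gx by simp
    also have "\<dots> = \<phi> (x \<triangleleft>\<^bsub>M\<^esub> h (\<phi> x)) \<oplus>\<^bsub>?N\<^esub> \<phi> (\<Oplus>\<^bsub>M\<^esub>x\<in>S. x \<triangleleft>\<^bsub>M\<^esub> h (\<phi> x))"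
      using insert.IH[OF Sc hS] by (simp add: act x)
    also have "\<dots> = \<phi> (x \<triangleleft>\<^bsub>M\<^esub> h (\<phi> x) \<oplus>\<^bsub>M\<^esub> (\<Oplus>\<^bsub>M\<^esub>x\<in>S. x \<triangleleft>\<^bsub>M\<^esub> h (\<phi> x)))"
      using f x hx by (intro add M.ract_closed M.finsum_closed) auto
    also have "\<dots> = \<phi> (\<Oplus>\<^bsub>M\<^esub>x\<in>insert x S. x \<triangleleft>\<^bsub>M\<^esub> h (\<phi> x))"
      using insert.hyps f x hx by (simp add: M.ract_closed)
    finally show ?case .
  qed
  obtain S where S: "finite S" "S \<subseteq> carrier M"
    "\<forall>m \<in> carrier M. \<exists>c \<in> S \<rightarrow> carrier \<Lambda>. m = (\<Oplus>\<^bsub>M\<^esub>x\<in>S. x \<triangleleft>\<^bsub>M\<^esub> c x)"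
    using M by (auto simp: mods_def)
  have "\<exists>c \<in> \<phi> ` S \<rightarrow> carrier \<Lambda>. n = (\<Oplus>\<^bsub>?N\<^esub>y\<in>\<phi> ` S. y \<triangleleft>\<^bsub>?N\<^esub> c y)" if "n \<in> carrier ?N" for n
  proof -
    from that obtain m where m: "m \<in> carrier M" "n = \<phi> m" by (auto simp: car)
    then obtain c where c: "c \<in> S \<rightarrow> carrier \<Lambda>" "m = (\<Oplus>\<^bsub>M\<^esub>x\<in>S. x \<triangleleft>\<^bsub>M\<^esub> c x)" using S(3) by blast
    define h where "h = c \<circ> inv_into (carrier M) \<phi>"
    have hc: "h (\<phi> x) = c x" if "x \<in> S" for x using that S(2) psi by (auto simp: h_def)
    then have h: "h \<in> \<phi> ` S \<rightarrow> carrier \<Lambda>" using c(1) by auto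
    have "(\<Oplus>\<^bsub>M\<^esub>x\<in>S. x \<triangleleft>\<^bsub>M\<^esub> h (\<phi> x)) = (\<Oplus>\<^bsub>M\<^esub>x\<in>S. x \<triangleleft>\<^bsub>M\<^esub> c x)"
    proof (rule M.finsum_cong'[OF refl])
      show "(\<lambda>x. x \<triangleleft>\<^bsub>M\<^esub> c x) \<in> S \<rightarrow> carrier M"
        using c(1) S(2) by (intro Pi_I M.ract_closed) auto
    qed (simp add: hc)
    then show ?thesis using fs[OF S(1,2) h] h m c by (intro bexI[of _ h]) auto
  qed
  moreover have "finite (\<phi> ` S)" "\<phi> ` S \<subseteq> carrier ?N" using S by (auto simp: car)
  ultimately show "?N \<in> mods \<Lambda>" unfolding mods_def using rm by blast
  have "\<phi> \<in> rhom \<Lambda> M ?N" by (auto simp: rhom_def car add act)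
  moreover have "bij_betw \<phi> (carrier M) (carrier ?N)" using inj by (simp add: bij_betw_def car)
  ultimately show "rmod_iso \<Lambda> M ?N" by (auto simp: rmod_iso_def)
qed

lemma mods_universe:
  fixes \<Lambda> :: "('k, 'a) module" and M :: "('a, 'm) rmodule"
  assumes "fin_dim_algebra K \<Lambda>" and "M \<in> mods \<Lambda>"
  shows "\<exists>N :: ('k, 'a) umodule. N \<in> mods \<Lambda> \<and> rmod_iso \<Lambda> M N"
  using fin_gen_inj[OF assms] rmod_image_props[OF assms(2)] by metis

section \<open>Projective and injective modules, homological dimensions\<close>

definition projective :: "('k, 'a) module \<Rightarrow> ('a, 'm) rmodule \<Rightarrow> bool" where
  "projective \<Lambda> P \<longleftrightarrow> P \<in> mods \<Lambda> \<and>
     (\<forall>U \<in> mods \<Lambda>. \<forall>V \<in> mods \<Lambda>. \<forall>g \<in> rhom \<Lambda> (U :: ('k, 'a) umodule) (V :: ('k, 'a) umodule).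
        g ` carrier U = carrier V \<longrightarrow>
        (\<forall>f \<in> rhom \<Lambda> P V. \<exists>h \<in> rhom \<Lambda> P U. \<forall>p \<in> carrier P. g (h p) = f p))"

definition injective :: "('k, 'a) module \<Rightarrow> ('a, 'm) rmodule \<Rightarrow> bool" where
  "injective \<Lambda> I \<longleftrightarrow> I \<in> mods \<Lambda> \<and>
     (\<forall>U \<in> mods \<Lambda>. \<forall>V \<in> mods \<Lambda>. \<forall>g \<in> rhom \<Lambda> (U :: ('k, 'a) umodule) (V :: ('k, 'a) umodule).
        inj_on g (carrier U) \<longrightarrow>
        (\<forall>f \<in> rhom \<Lambda> U I. \<exists>h \<in> rhom \<Lambda> V I. \<forall>x \<in> carrier U. h (g x) = f x))"

text \<open>
  An exact sequence \<open>\<dots> \<rightarrow> P 1 \<rightarrow> P 0 \<rightarrow> M \<rightarrow> 0\<close> with augmentation \<open>\<epsilon>\<close> and differentials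
  \<open>d i : P (i + 1) \<rightarrow> P i\<close>.
\<close>

definition projective_resolution ::
  "('k, 'a) module \<Rightarrow> ('a, 'm) rmodule \<Rightarrow> (nat \<Rightarrow> ('k, 'a) umodule) \<Rightarrow>
    (nat \<Rightarrow> (nat \<Rightarrow> 'k) \<Rightarrow> (nat \<Rightarrow> 'k)) \<Rightarrow> ((nat \<Rightarrow> 'k) \<Rightarrow> 'm) \<Rightarrow> bool" where
  "projective_resolution \<Lambda> M P d \<epsilon> \<longleftrightarrow>
     (\<forall>i. projective \<Lambda> (P i)) \<and> (\<forall>i. d i \<in> rhom \<Lambda> (P (Suc i)) (P i)) \<and> \<epsilon> \<in> rhom \<Lambda> (P 0) M \<and>
     \<epsilon> ` carrier (P 0) = carrier M \<and>
     d 0 ` carrier (P 1) = a_kernel (P 0) M \<epsilon> \<and>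
     (\<forall>i. d (Suc i) ` carrier (P (Suc (Suc i))) = a_kernel (P (Suc i)) (P i) (d i))"

text \<open>
  The least length of a projective resolution, \<open>\<infinity>\<close> if there is no finite one; the zero module gets
  the value \<open>0\<close>.
\<close>

definition proj_dim :: "('k, 'a) module \<Rightarrow> ('a, 'm) rmodule \<Rightarrow> enat" where
  "proj_dim \<Lambda> M = Inf {enat n | n P d \<epsilon>.
     projective_resolution \<Lambda> M P d \<epsilon> \<and> (\<forall>i > n. carrier (P i) = {\<zero>\<^bsub>P i\<^esub>})}"

definition gl_dim :: "('k, 'a) module \<Rightarrow> enat" where
  "gl_dim \<Lambda> = (SUP M \<in> (mods \<Lambda> :: ('k, 'a) umodule set). proj_dim \<Lambda> M)"

text \<open>
  An exact sequence \<open>0 \<rightarrow> M \<rightarrow> I 0 \<rightarrow> I 1 \<rightarrow> \<dots>\<close> with coaugmentation \<open>\<eta>\<close> and differentials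
  \<open>d i : I i \<rightarrow> I (i + 1)\<close>, in which each \<open>I i\<close> is an injective envelope of the image of the
  preceding map.
\<close>

definition minimal_injective_resolution ::
  "('k, 'a) module \<Rightarrow> ('a, 'm) rmodule \<Rightarrow> (nat \<Rightarrow> ('k, 'a) umodule) \<Rightarrow>
    (nat \<Rightarrow> (nat \<Rightarrow> 'k) \<Rightarrow> (nat \<Rightarrow> 'k)) \<Rightarrow> ('m \<Rightarrow> (nat \<Rightarrow> 'k)) \<Rightarrow> bool" where
  "minimal_injective_resolution \<Lambda> M I d \<eta> \<longleftrightarrow>
     (\<forall>i. injective \<Lambda> (I i)) \<and> (\<forall>i. d i \<in> rhom \<Lambda> (I i) (I (Suc i))) \<and> \<eta> \<in> rhom \<Lambda> M (I 0) \<and>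
     inj_on \<eta> (carrier M) \<and>
     \<eta> ` carrier M = a_kernel (I 0) (I 1) (d 0) \<and>
     (\<forall>i. d i ` carrier (I i) = a_kernel (I (Suc i)) (I (Suc (Suc i))) (d (Suc i))) \<and>
     essential_rsubmodule \<Lambda> (\<eta> ` carrier M) (I 0) \<and>
     (\<forall>i. essential_rsubmodule \<Lambda> (d i ` carrier (I i)) (I (Suc i)))"

definition dom_dim :: "('k, 'a) module \<Rightarrow> enat" where
  "dom_dim \<Lambda> = Sup {enat n | n I d \<eta>.
     minimal_injective_resolution \<Lambda> (reg_module \<Lambda>) I d \<eta> \<and> (\<forall>i < n. projective \<Lambda> (I i))}"

definition auslander_algebra :: "('k, 'a) module \<Rightarrow> bool" where
  "auslander_algebra \<Lambda> \<longleftrightarrow> gl_dim \<Lambda> \<le> 2 \<and> dom_dim \<Lambda> \<ge> 2"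

definition proj_inj_modules :: "('k, 'a) module \<Rightarrow> ('a, 'm) rmodule set" where
  "proj_inj_modules \<Lambda> = {M \<in> mods \<Lambda>. projective \<Lambda> M \<and> injective \<Lambda> M}"

end

theory Submission
  imports Defs
begin

text \<open>
  For an injective module \<open>I\<close>, \<open>projective \<Lambda> I\<close> and \<open>proj_dim \<Lambda> (soc \<Lambda> I) \<le> 1\<close> are compared
  directly, for \<open>I\<close> as a whole.  Bounded global dimension gives one implication, dominant dimension
  the other, and the socle enters as an essential submodule of \<open>I\<close>.

  If \<open>I\<close> is projective, then every submodule \<open>S\<close> of \<open>I\<close> is a first syzygy of \<open>I / S\<close>.  As
  \<open>I / S\<close> has projective dimension at most two, \<open>S\<close> has projective dimension at most one
  (\<open>proj_dim_submodule_le_one\<close>).  Instead of the long exact sequence of Ext or Schanuel's lemma,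
  the proof compares the given resolution of \<open>I / S\<close> with an exact sequence
  \<open>0 \<rightarrow> N \<rightarrow> F \<rightarrow> I \<rightarrow> I / S \<rightarrow> 0\<close>: the comparison maps and their homotopy make \<open>N\<close> a direct summand
  of a projective module.

  Conversely, dominant dimension at least two puts \<open>\<Lambda>\<close>, and hence every projective module, into an
  exact sequence \<open>0 \<rightarrow> P \<rightarrow> J0 \<rightarrow> J1\<close> with projective-injective terms
  (\<open>proj_inj_copresented_projective\<close>).  From this, every module \<open>M\<close> with a resolution
  \<open>0 \<rightarrow> P1 \<rightarrow> P0 \<rightarrow> M \<rightarrow> 0\<close> embeds into a projective-injective module (\<open>proj_inj_embedding\<close>).  For
  \<open>M = soc \<Lambda> I\<close> the embedding extends to \<open>I\<close>, stays injective because the socle is essential, and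
  splits because \<open>I\<close> is injective; so \<open>I\<close> is a direct summand of a projective module
  (\<open>projective_of_soc\<close>).

  The finiteness of \<open>\<Lambda>\<close> over the field enters through the submodules of a finitely generated
  module: chains of them have bounded length (\<open>submodule_rank\<close>), so they are finitely generated and
  the nonzero ones contain simple submodules.
\<close>

section \<open>Homomorphisms and submodules\<close>

lemma rhom_closed: "f \<in> rhom \<Lambda> M N \<Longrightarrow> x \<in> carrier M \<Longrightarrow> f x \<in> carrier N"
  by (auto simp: rhom_def)

lemma rhom_add: "f \<in> rhom \<Lambda> M N \<Longrightarrow> x \<in> carrier M \<Longrightarrow> y \<in> carrier M \<Longrightarrow>
    f (x \<oplus>\<^bsub>M\<^esub> y) = f x \<oplus>\<^bsub>N\<^esub> f y"
  by (auto simp: rhom_def)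

lemma rhom_ract: "f \<in> rhom \<Lambda> M N \<Longrightarrow> x \<in> carrier M \<Longrightarrow> a \<in> carrier \<Lambda> \<Longrightarrow>
    f (x \<triangleleft>\<^bsub>M\<^esub> a) = f x \<triangleleft>\<^bsub>N\<^esub> a"
  by (auto simp: rhom_def)

lemma rhomI:
  assumes "\<And>x. x \<in> carrier M \<Longrightarrow> f x \<in> carrier N"
    and "\<And>x y. x \<in> carrier M \<Longrightarrow> y \<in> carrier M \<Longrightarrow> f (x \<oplus>\<^bsub>M\<^esub> y) = f x \<oplus>\<^bsub>N\<^esub> f y"
    and "\<And>x a. x \<in> carrier M \<Longrightarrow> a \<in> carrier \<Lambda> \<Longrightarrow> f (x \<triangleleft>\<^bsub>M\<^esub> a) = f x \<triangleleft>\<^bsub>N\<^esub> a"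
  shows "f \<in> rhom \<Lambda> M N"
  using assms by (auto simp: rhom_def)

lemma rhom_zero:
  assumes "right_module \<Lambda> M" "right_module \<Lambda> N" "f \<in> rhom \<Lambda> M N"
  shows "f \<zero>\<^bsub>M\<^esub> = \<zero>\<^bsub>N\<^esub>"
proof -
  interpret M: right_module \<Lambda> M by fact
  interpret N: right_module \<Lambda> N by fact
  have z: "f \<zero>\<^bsub>M\<^esub> \<in> carrier N" using assms(3) by (auto intro: rhom_closed)
  have "f \<zero>\<^bsub>M\<^esub> \<oplus>\<^bsub>N\<^esub> f \<zero>\<^bsub>M\<^esub> = f \<zero>\<^bsub>M\<^esub>"
    using rhom_add[OF assms(3), of "\<zero>\<^bsub>M\<^esub>" "\<zero>\<^bsub>M\<^esub>"] by simp
  then show ?thesis using z by simp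
qed

lemma rhom_neg:
  assumes "right_module \<Lambda> M" "right_module \<Lambda> N" "f \<in> rhom \<Lambda> M N" "x \<in> carrier M"
  shows "f (\<ominus>\<^bsub>M\<^esub> x) = \<ominus>\<^bsub>N\<^esub> f x"
proof -
  interpret M: right_module \<Lambda> M by fact
  interpret N: right_module \<Lambda> N by fact
  have "f (\<ominus>\<^bsub>M\<^esub> x) \<oplus>\<^bsub>N\<^esub> f x = \<zero>\<^bsub>N\<^esub>"
    using rhom_add[OF assms(3), of "\<ominus>\<^bsub>M\<^esub> x" x] rhom_zero[OF assms(1-3)] assms(4)
    by (simp add: M.l_neg)
  then show ?thesis
    using rhom_closed[OF assms(3)] assms(4) by (metis M.a_inv_closed N.minus_equality)
qed

lemma rhom_minus:
  assumes "right_module \<Lambda> M" "right_module \<Lambda> N" "f \<in> rhom \<Lambda> M N" "x \<in> carrier M" "y \<in> carrier M"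
  shows "f (x \<ominus>\<^bsub>M\<^esub> y) = f x \<ominus>\<^bsub>N\<^esub> f y"
proof -
  interpret M: right_module \<Lambda> M by fact
  show ?thesis using assms by (simp add: a_minus_def rhom_add rhom_neg)
qed

lemma rhom_id: "id \<in> rhom \<Lambda> M M"
  by (auto simp: rhom_def)

lemma rhom_comp: "f \<in> rhom \<Lambda> M N \<Longrightarrow> g \<in> rhom \<Lambda> N L \<Longrightarrow> g \<circ> f \<in> rhom \<Lambda> M L"
  by (auto simp: rhom_def Pi_iff)

lemma (in right_module) ract_zero: "a \<in> carrier R \<Longrightarrow> \<zero>\<^bsub>M\<^esub> \<triangleleft>\<^bsub>M\<^esub> a = \<zero>\<^bsub>M\<^esub>"
  using ract_l_distr[of "\<zero>\<^bsub>M\<^esub>" "\<zero>\<^bsub>M\<^esub>" a] ract_closed[of "\<zero>\<^bsub>M\<^esub>" a] by simp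

lemma (in right_module) zero_ract: "x \<in> carrier M \<Longrightarrow> x \<triangleleft>\<^bsub>M\<^esub> \<zero>\<^bsub>R\<^esub> = \<zero>\<^bsub>M\<^esub>"
  using ract_r_distr[of x "\<zero>\<^bsub>R\<^esub>" "\<zero>\<^bsub>R\<^esub>"] ract_closed[of x "\<zero>\<^bsub>R\<^esub>"] by simp

lemma (in right_module) ract_neg:
  assumes "x \<in> carrier M" "a \<in> carrier R"
  shows "(\<ominus>\<^bsub>M\<^esub> x) \<triangleleft>\<^bsub>M\<^esub> a = \<ominus>\<^bsub>M\<^esub> (x \<triangleleft>\<^bsub>M\<^esub> a)"
proof -
  have "(\<ominus>\<^bsub>M\<^esub> x) \<triangleleft>\<^bsub>M\<^esub> a \<oplus>\<^bsub>M\<^esub> x \<triangleleft>\<^bsub>M\<^esub> a = \<zero>\<^bsub>M\<^esub>"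
    using ract_l_distr[of "\<ominus>\<^bsub>M\<^esub> x" x a] assms by (simp add: M.l_neg ract_zero)
  then show ?thesis using assms by (metis M.a_inv_closed M.minus_equality ract_closed)
qed

lemma rhom_plus:
  assumes "right_module \<Lambda> N" "f \<in> rhom \<Lambda> M N" "g \<in> rhom \<Lambda> M N"
  shows "(\<lambda>x. f x \<oplus>\<^bsub>N\<^esub> g x) \<in> rhom \<Lambda> M N"
proof -
  interpret N: right_module \<Lambda> N by fact
  show ?thesis
    by (rule rhomI)
      (use assms(2,3) in \<open>simp_all add: rhom_closed rhom_add rhom_ract N.a_ac N.ract_l_distr\<close>)
qed

lemma rhom_diff:
  assumes "right_module \<Lambda> N" "f \<in> rhom \<Lambda> M N" "g \<in> rhom \<Lambda> M N"
  shows "(\<lambda>x. f x \<ominus>\<^bsub>N\<^esub> g x) \<in> rhom \<Lambda> M N"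
proof -
  interpret N: right_module \<Lambda> N by fact
  show ?thesis
    by (rule rhomI)
      (use assms(2,3) in \<open>simp_all add: a_minus_def rhom_closed rhom_add rhom_ract N.a_ac
        N.ract_l_distr N.ract_neg N.minus_add\<close>)
qed

lemma (in abelian_group) minus_eq_zero_iff:
  "x \<in> carrier G \<Longrightarrow> y \<in> carrier G \<Longrightarrow> x \<ominus> y = \<zero> \<longleftrightarrow> x = y"
  by (metis a_minus_def add.inv_closed l_neg minus_equality minus_minus r_neg)

lemma rhom_inj_onI:
  assumes "right_module \<Lambda> M" "right_module \<Lambda> N" "f \<in> rhom \<Lambda> M N"
    and "\<And>x. x \<in> carrier M \<Longrightarrow> f x = \<zero>\<^bsub>N\<^esub> \<Longrightarrow> x = \<zero>\<^bsub>M\<^esub>"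
  shows "inj_on f (carrier M)"
proof (rule inj_onI)
  interpret M: right_module \<Lambda> M by fact
  interpret N: right_module \<Lambda> N by fact
  fix x y assume "x \<in> carrier M" "y \<in> carrier M" "f x = f y"
  moreover from this have "f (x \<ominus>\<^bsub>M\<^esub> y) = \<zero>\<^bsub>N\<^esub>"
    using assms(1-3) by (simp add: rhom_minus rhom_closed N.minus_eq_zero_iff)
  ultimately show "x = y" using assms(4)[of "x \<ominus>\<^bsub>M\<^esub> y"] M.minus_eq_zero_iff by auto
qed

lemma rhom_inj_zero:
  assumes "right_module \<Lambda> M" "right_module \<Lambda> N" "f \<in> rhom \<Lambda> M N" "inj_on f (carrier M)"
    and "x \<in> carrier M" "f x = \<zero>\<^bsub>N\<^esub>"
  shows "x = \<zero>\<^bsub>M\<^esub>"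
proof -
  interpret M: right_module \<Lambda> M by fact
  show ?thesis using assms rhom_zero[OF assms(1-3)] by (metis M.zero_closed inj_onD)
qed

lemma rhom_factor_surj:
  assumes "right_module \<Lambda> M" "right_module \<Lambda> N" "right_module \<Lambda> L"
    and g: "g \<in> rhom \<Lambda> M N" "g ` carrier M = carrier N" and f: "f \<in> rhom \<Lambda> M L"
    and ker: "\<And>x. x \<in> carrier M \<Longrightarrow> g x = \<zero>\<^bsub>N\<^esub> \<Longrightarrow> f x = \<zero>\<^bsub>L\<^esub>"
  shows "\<exists>h \<in> rhom \<Lambda> N L. \<forall>x \<in> carrier M. h (g x) = f x"
proof -
  interpret M: right_module \<Lambda> M by fact
  interpret N: right_module \<Lambda> N by fact
  interpret L: right_module \<Lambda> L by fact
  have eq: "f x = f y" if "x \<in> carrier M" "y \<in> carrier M" "g x = g y" for x y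
  proof -
    have "g (x \<ominus>\<^bsub>M\<^esub> y) = \<zero>\<^bsub>N\<^esub>"
      using that g assms(1,2) by (simp add: rhom_minus rhom_closed N.minus_eq_zero_iff)
    then have "f (x \<ominus>\<^bsub>M\<^esub> y) = \<zero>\<^bsub>L\<^esub>" using ker that by simp
    then show ?thesis
      using that f assms(1,3) by (simp add: rhom_minus rhom_closed L.minus_eq_zero_iff)
  qed
  define h where "h = f \<circ> inv_into (carrier M) g"
  have hg: "h (g x) = f x" if "x \<in> carrier M" for x
    using that eq[of "inv_into (carrier M) g (g x)" x]
    by (simp add: h_def inv_into_into f_inv_into_f)
  have "h \<in> rhom \<Lambda> N L"
  proof (rule rhomI)
    fix y assume "y \<in> carrier N"
    then obtain x where x: "x \<in> carrier M" "y = g x" using g(2) by blast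
    then show "h y \<in> carrier L" using f by (simp add: hg rhom_closed)
    fix a assume a: "a \<in> carrier \<Lambda>"
    have "h (g (x \<triangleleft>\<^bsub>M\<^esub> a)) = f (x \<triangleleft>\<^bsub>M\<^esub> a)" using x a by (simp add: hg M.ract_closed)
    then show "h (y \<triangleleft>\<^bsub>N\<^esub> a) = h y \<triangleleft>\<^bsub>L\<^esub> a" using x a f g by (simp add: hg rhom_ract)
  next
    fix y y' assume "y \<in> carrier N" "y' \<in> carrier N"
    then obtain x x' where x: "x \<in> carrier M" "y = g x" "x' \<in> carrier M" "y' = g x'"
      using g(2) by blast
    have "h (g (x \<oplus>\<^bsub>M\<^esub> x')) = f (x \<oplus>\<^bsub>M\<^esub> x')" using x by (simp add: hg)
    then show "h (y \<oplus>\<^bsub>N\<^esub> y') = h y \<oplus>\<^bsub>L\<^esub> h y'" using x f g by (simp add: hg rhom_add)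
  qed
  with hg show ?thesis by blast
qed

lemma rhom_factor_inj:
  assumes "right_module \<Lambda> M" "right_module \<Lambda> N"
    and g: "g \<in> rhom \<Lambda> N L" "inj_on g (carrier N)" and f: "f \<in> rhom \<Lambda> M L"
    and im: "\<And>x. x \<in> carrier M \<Longrightarrow> f x \<in> g ` carrier N"
  shows "\<exists>h \<in> rhom \<Lambda> M N. \<forall>x \<in> carrier M. g (h x) = f x"
proof -
  interpret M: right_module \<Lambda> M by fact
  interpret N: right_module \<Lambda> N by fact
  define h where "h = inv_into (carrier N) g \<circ> f"
  have gh: "g (h x) = f x" and hc: "h x \<in> carrier N" if "x \<in> carrier M" for x
    using im[OF that] by (simp_all add: h_def inv_into_into f_inv_into_f)
  have inj: "u = v" if "u \<in> carrier N" "v \<in> carrier N" "g u = g v" for u v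
    using that g(2) by (auto dest: inj_onD)
  have "h \<in> rhom \<Lambda> M N"
    by (intro rhomI inj)
      (use f g in \<open>simp_all add: gh hc rhom_add rhom_ract M.ract_closed N.ract_closed\<close>)
  with gh show ?thesis by blast
qed

lemma rmod_iso_obtain:
  assumes "right_module \<Lambda> M" "right_module \<Lambda> N" "rmod_iso \<Lambda> M N"
  obtains f g where "f \<in> rhom \<Lambda> M N" "g \<in> rhom \<Lambda> N M"
    "\<And>x. x \<in> carrier M \<Longrightarrow> g (f x) = x" "\<And>y. y \<in> carrier N \<Longrightarrow> f (g y) = y"
proof -
  obtain f where f: "f \<in> rhom \<Lambda> M N" "bij_betw f (carrier M) (carrier N)"
    using assms(3) by (auto simp: rmod_iso_def)
  have b: "inj_on f (carrier M)" "f ` carrier M = carrier N"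
    using f(2) by (auto simp: bij_betw_def)
  have "\<exists>g \<in> rhom \<Lambda> N M. \<forall>y \<in> carrier N. f (g y) = id y"
    by (rule rhom_factor_inj[OF assms(2,1) f(1) b(1) rhom_id]) (simp add: b(2))
  then obtain g where g: "g \<in> rhom \<Lambda> N M" "\<And>y. y \<in> carrier N \<Longrightarrow> f (g y) = y" by auto
  have "g (f x) = x" if "x \<in> carrier M" for x
    using g(2)[of "f x"] rhom_closed[OF f(1) that] rhom_closed[OF g(1), of "f x"] b(1) that
    by (metis inj_onD)
  with f(1) g that show ?thesis by blast
qed

text \<open>
  Closure under negatives follows from closure under the action, as \<open>- x\<close> is the action of \<open>- 1\<close>
  on \<open>x\<close>.
\<close>

lemma rsubmodule_iff:
  assumes "right_module \<Lambda> M"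
  shows "rsubmodule \<Lambda> N M \<longleftrightarrow> N \<subseteq> carrier M \<and> \<zero>\<^bsub>M\<^esub> \<in> N \<and>
    (\<forall>x \<in> N. \<forall>y \<in> N. x \<oplus>\<^bsub>M\<^esub> y \<in> N) \<and> (\<forall>x \<in> N. \<forall>a \<in> carrier \<Lambda>. x \<triangleleft>\<^bsub>M\<^esub> a \<in> N)"
    (is "?L \<longleftrightarrow> ?R")
proof
  interpret M: right_module \<Lambda> M by fact
  show "?L \<Longrightarrow> ?R"
    unfolding rsubmodule_def using subgroup.subset subgroup.one_closed subgroup.m_closed by fastforce
  assume R: ?R
  have inv: "\<ominus>\<^bsub>M\<^esub> x \<in> N" if "x \<in> N" for x
  proof -
    have x: "x \<in> carrier M" using that R by auto
    have "x \<triangleleft>\<^bsub>M\<^esub> (\<ominus>\<^bsub>\<Lambda>\<^esub> \<one>\<^bsub>\<Lambda>\<^esub>) \<oplus>\<^bsub>M\<^esub> x = x \<triangleleft>\<^bsub>M\<^esub> (\<ominus>\<^bsub>\<Lambda>\<^esub> \<one>\<^bsub>\<Lambda>\<^esub> \<oplus>\<^bsub>\<Lambda>\<^esub> \<one>\<^bsub>\<Lambda>\<^esub>)"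
      using x by (subst M.ract_r_distr) (simp_all add: M.ract_one)
    also have "\<dots> = \<zero>\<^bsub>M\<^esub>" using x by (simp add: M.R.l_neg M.zero_ract)
    finally have "\<ominus>\<^bsub>M\<^esub> x = x \<triangleleft>\<^bsub>M\<^esub> (\<ominus>\<^bsub>\<Lambda>\<^esub> \<one>\<^bsub>\<Lambda>\<^esub>)"
      using x by (intro M.minus_equality) (simp_all add: M.ract_closed)
    then show ?thesis using R that by simp
  qed
  show ?L unfolding rsubmodule_def
  proof
    show "subgroup N (add_monoid M)"
      by (rule M.add.subgroupI) (use R inv in \<open>auto simp: a_inv_def\<close>)
  qed (use R in auto)
qed

lemma rsubmodule_neg:
  assumes "right_module \<Lambda> M" "rsubmodule \<Lambda> N M" "x \<in> N"
  shows "\<ominus>\<^bsub>M\<^esub> x \<in> N"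
  using assms(2,3) subgroup.m_inv_closed[of N "add_monoid M" x] by (simp add: rsubmodule_def a_inv_def)

lemma rsubmodule_minus:
  assumes "right_module \<Lambda> M" "rsubmodule \<Lambda> N M" "x \<in> N" "y \<in> N"
  shows "x \<ominus>\<^bsub>M\<^esub> y \<in> N"
  using assms rsubmodule_neg[OF assms(1,2,4)] by (simp add: a_minus_def rsubmodule_iff)

lemma rsubmodule_right_module:
  assumes "right_module \<Lambda> M" "rsubmodule \<Lambda> N M"
  shows "right_module \<Lambda> (M\<lparr>carrier := N\<rparr>)"
proof -
  interpret M: right_module \<Lambda> M by fact
  have N: "N \<subseteq> carrier M" "\<zero>\<^bsub>M\<^esub> \<in> N" "\<And>x y. x \<in> N \<Longrightarrow> y \<in> N \<Longrightarrow> x \<oplus>\<^bsub>M\<^esub> y \<in> N"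
    "\<And>x a. x \<in> N \<Longrightarrow> a \<in> carrier \<Lambda> \<Longrightarrow> x \<triangleleft>\<^bsub>M\<^esub> a \<in> N"
    using assms(2) by (auto simp: rsubmodule_iff[OF assms(1)])
  have "abelian_group (M\<lparr>carrier := N\<rparr>)"
  proof (rule abelian_groupI)
    fix x assume "x \<in> carrier (M\<lparr>carrier := N\<rparr>)"
    then have x: "x \<in> N" by simp
    then show "\<exists>y \<in> carrier (M\<lparr>carrier := N\<rparr>). y \<oplus>\<^bsub>M\<lparr>carrier := N\<rparr>\<^esub> x = \<zero>\<^bsub>M\<lparr>carrier := N\<rparr>\<^esub>"
      using N(1) rsubmodule_neg[OF assms] by (intro bexI[of _ "\<ominus>\<^bsub>M\<^esub> x"]) (auto simp: M.l_neg)
  qed (use N in \<open>auto simp: subset_iff M.a_ac\<close>)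
  then show ?thesis
    by (intro right_module.intro right_module_axioms.intro M.R.ring_axioms)
      (use N in \<open>auto simp: subset_iff M.ract_l_distr M.ract_r_distr M.ract_assoc M.ract_one\<close>)
qed

lemma rhom_image_rsubmodule:
  assumes "right_module \<Lambda> M" "right_module \<Lambda> N" "f \<in> rhom \<Lambda> M N"
  shows "rsubmodule \<Lambda> (f ` carrier M) N"
  unfolding rsubmodule_iff[OF assms(2)]
proof (intro conjI ballI)
  interpret M: right_module \<Lambda> M by fact
  show "\<zero>\<^bsub>N\<^esub> \<in> f ` carrier M" using rhom_zero[OF assms] by (metis M.zero_closed imageI)
  fix x assume "x \<in> f ` carrier M"
  then obtain u where u: "u \<in> carrier M" "x = f u" by blast
  show "x \<triangleleft>\<^bsub>N\<^esub> a \<in> f ` carrier M" if "a \<in> carrier \<Lambda>" for a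
    using u that rhom_ract[OF assms(3), symmetric] by (auto simp: M.ract_closed)
  fix y assume "y \<in> f ` carrier M"
  then obtain v where v: "v \<in> carrier M" "y = f v" by blast
  show "x \<oplus>\<^bsub>N\<^esub> y \<in> f ` carrier M" using u v rhom_add[OF assms(3), symmetric] by auto
qed (use assms(3) in \<open>auto simp: rhom_closed\<close>)

lemma rhom_vimage_rsubmodule:
  assumes "right_module \<Lambda> M" "right_module \<Lambda> N" "f \<in> rhom \<Lambda> M N" "rsubmodule \<Lambda> L N"
  shows "rsubmodule \<Lambda> {x \<in> carrier M. f x \<in> L} M"
proof -
  interpret M: right_module \<Lambda> M by fact
  show ?thesis using assms(4) unfolding rsubmodule_iff[OF assms(1)] rsubmodule_iff[OF assms(2)]
    by (auto simp: rhom_zero[OF assms(1-3)] rhom_add[OF assms(3)] rhom_ract[OF assms(3)] M.ract_closed)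
qed

lemma rsubmodule_zero: "right_module \<Lambda> M \<Longrightarrow> rsubmodule \<Lambda> {\<zero>\<^bsub>M\<^esub>} M"
proof -
  assume M: "right_module \<Lambda> M"
  interpret M: right_module \<Lambda> M by fact
  show ?thesis by (simp add: rsubmodule_iff[OF M] M.ract_zero)
qed

lemma rsubmodule_carrier: "right_module \<Lambda> M \<Longrightarrow> rsubmodule \<Lambda> (carrier M) M"
proof -
  assume M: "right_module \<Lambda> M"
  interpret M: right_module \<Lambda> M by fact
  show ?thesis by (simp add: rsubmodule_iff[OF M] M.ract_closed)
qed

lemma rhom_ker_rsubmodule:
  assumes "right_module \<Lambda> M" "right_module \<Lambda> N" "f \<in> rhom \<Lambda> M N"
  shows "rsubmodule \<Lambda> {x \<in> carrier M. f x = \<zero>\<^bsub>N\<^esub>} M"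
  using rhom_vimage_rsubmodule[OF assms rsubmodule_zero[OF assms(2)]] by simp

lemma rsubmodule_trans:
  assumes "right_module \<Lambda> M" "rsubmodule \<Lambda> N M"
  shows "rsubmodule \<Lambda> L (M\<lparr>carrier := N\<rparr>) \<longleftrightarrow> rsubmodule \<Lambda> L M \<and> L \<subseteq> N"
  unfolding rsubmodule_iff[OF assms(1)] rsubmodule_iff[OF rsubmodule_right_module[OF assms]]
  using assms(2) by (auto simp: rsubmodule_iff[OF assms(1)] subset_iff)

lemma rhom_restrict: "f \<in> rhom \<Lambda> M N \<Longrightarrow> L \<subseteq> carrier M \<Longrightarrow> f \<in> rhom \<Lambda> (M\<lparr>carrier := L\<rparr>) N"
  by (auto simp: rhom_def subset_iff)

lemma rhom_corestrict: "f \<in> rhom \<Lambda> M N \<Longrightarrow> f ` carrier M \<subseteq> L \<Longrightarrow> f \<in> rhom \<Lambda> M (N\<lparr>carrier := L\<rparr>)"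
  by (auto simp: rhom_def)

section \<open>Finite generation\<close>

lemma modsD: "M \<in> mods \<Lambda> \<Longrightarrow> right_module \<Lambda> M"
  by (simp add: mods_def)

lemma rsubmodule_finsum:
  assumes M: "right_module \<Lambda> M" and N: "rsubmodule \<Lambda> N M"
    and "finite S" "\<And>x. x \<in> S \<Longrightarrow> f x \<in> N"
  shows "(\<Oplus>\<^bsub>M\<^esub>x\<in>S. f x) \<in> N"
  using assms(3,4)
proof (induction S rule: finite_induct)
  interpret M: right_module \<Lambda> M by fact
  case empty then show ?case using N by (simp add: rsubmodule_iff[OF M])
next
  interpret M: right_module \<Lambda> M by fact
  case (insert x S)
  then have "f \<in> S \<rightarrow> carrier M" "f x \<in> carrier M" using N by (auto simp: rsubmodule_iff[OF M])
  then show ?case using insert N by (simp add: rsubmodule_iff[OF M])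
qed

text \<open>
  Generation phrased through submodules: images and products of finitely generated modules can then
  be treated by pulling submodules back along homomorphisms, without manipulating linear
  combinations.
\<close>

lemma mods_iff_generated:
  "M \<in> mods \<Lambda> \<longleftrightarrow> right_module \<Lambda> M \<and>
    (\<exists>S. finite S \<and> S \<subseteq> carrier M \<and> (\<forall>N. rsubmodule \<Lambda> N M \<longrightarrow> S \<subseteq> N \<longrightarrow> carrier M \<subseteq> N))"
  (is "?L \<longleftrightarrow> ?R")
proof
  assume L: ?L
  then interpret M: right_module \<Lambda> M by (simp add: mods_def)
  obtain S where S: "finite S" "S \<subseteq> carrier M"
    "\<forall>m \<in> carrier M. \<exists>c \<in> S \<rightarrow> carrier \<Lambda>. m = (\<Oplus>\<^bsub>M\<^esub>x\<in>S. x \<triangleleft>\<^bsub>M\<^esub> c x)"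
    using L by (auto simp: mods_def)
  have "carrier M \<subseteq> N" if N: "rsubmodule \<Lambda> N M" "S \<subseteq> N" for N
  proof
    fix m assume "m \<in> carrier M"
    then obtain c where c: "c \<in> S \<rightarrow> carrier \<Lambda>" "m = (\<Oplus>\<^bsub>M\<^esub>x\<in>S. x \<triangleleft>\<^bsub>M\<^esub> c x)" using S(3) by blast
    have "x \<triangleleft>\<^bsub>M\<^esub> c x \<in> N" if "x \<in> S" for x
      using that c(1) N by (auto simp: rsubmodule_iff[OF M.right_module_axioms] Pi_iff subset_iff)
    then show "m \<in> N" unfolding c(2) by (rule rsubmodule_finsum[OF modsD[OF L] N(1) S(1)])
  qed
  with S modsD[OF L] show ?R by blast
next
  assume R: ?R
  then interpret M: right_module \<Lambda> M by simp
  obtain S where S: "finite S" "S \<subseteq> carrier M"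
    "\<And>N. rsubmodule \<Lambda> N M \<Longrightarrow> S \<subseteq> N \<Longrightarrow> carrier M \<subseteq> N" using R by blast
  define T where "T = {\<Oplus>\<^bsub>M\<^esub>x\<in>S. x \<triangleleft>\<^bsub>M\<^esub> c x | c. c \<in> S \<rightarrow> carrier \<Lambda>}"
  have cl: "(\<lambda>x. x \<triangleleft>\<^bsub>M\<^esub> c x) \<in> S \<rightarrow> carrier M" if "c \<in> S \<rightarrow> carrier \<Lambda>" for c
    using that S(2) by (auto intro!: M.ract_closed)
  have act: "(\<Oplus>\<^bsub>M\<^esub>x\<in>S. f x) \<triangleleft>\<^bsub>M\<^esub> a = (\<Oplus>\<^bsub>M\<^esub>x\<in>S. f x \<triangleleft>\<^bsub>M\<^esub> a)"
    if "f \<in> S \<rightarrow> carrier M" "a \<in> carrier \<Lambda>" for f a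
    using S(1) that
  proof (induction S rule: finite_induct)
    case empty then show ?case by (simp add: M.ract_zero)
  next
    case (insert x F)
    then have "f \<in> F \<rightarrow> carrier M" "f x \<in> carrier M" "(\<lambda>x. f x \<triangleleft>\<^bsub>M\<^esub> a) \<in> F \<rightarrow> carrier M"
      by (auto intro!: M.ract_closed)
    then show ?case using insert by (simp add: M.ract_l_distr M.ract_closed)
  qed
  have "rsubmodule \<Lambda> T M"
    unfolding rsubmodule_iff[OF M.right_module_axioms]
  proof (intro conjI ballI)
    show "T \<subseteq> carrier M" by (auto simp: T_def intro!: M.finsum_closed cl)
    have "(\<Oplus>\<^bsub>M\<^esub>x\<in>S. x \<triangleleft>\<^bsub>M\<^esub> \<zero>\<^bsub>\<Lambda>\<^esub>) = (\<Oplus>\<^bsub>M\<^esub>x\<in>S. \<zero>\<^bsub>M\<^esub>)"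
      by (rule M.finsum_cong'[OF refl]) (use S(2) in \<open>auto simp: M.zero_ract\<close>)
    then show "\<zero>\<^bsub>M\<^esub> \<in> T" unfolding T_def by (auto intro!: exI[of _ "\<lambda>_. \<zero>\<^bsub>\<Lambda>\<^esub>"])
    fix x assume "x \<in> T"
    then obtain c where c: "c \<in> S \<rightarrow> carrier \<Lambda>" "x = (\<Oplus>\<^bsub>M\<^esub>x\<in>S. x \<triangleleft>\<^bsub>M\<^esub> c x)"
      by (auto simp: T_def)
    show "x \<triangleleft>\<^bsub>M\<^esub> a \<in> T" if a: "a \<in> carrier \<Lambda>" for a
    proof -
      have "x \<triangleleft>\<^bsub>M\<^esub> a = (\<Oplus>\<^bsub>M\<^esub>x\<in>S. (x \<triangleleft>\<^bsub>M\<^esub> c x) \<triangleleft>\<^bsub>M\<^esub> a)" using c a cl by (simp add: act)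
      also have "\<dots> = (\<Oplus>\<^bsub>M\<^esub>x\<in>S. x \<triangleleft>\<^bsub>M\<^esub> (c x \<otimes>\<^bsub>\<Lambda>\<^esub> a))"
        by (rule M.finsum_cong'[OF refl])
          (use c(1) a S(2) in \<open>auto simp: Pi_iff subset_iff M.ract_assoc intro!: M.ract_closed\<close>)
      finally show ?thesis using c(1) a
        by (auto simp: T_def intro!: exI[of _ "\<lambda>x. c x \<otimes>\<^bsub>\<Lambda>\<^esub> a"])
    qed
    fix y assume "y \<in> T"
    then obtain d where d: "d \<in> S \<rightarrow> carrier \<Lambda>" "y = (\<Oplus>\<^bsub>M\<^esub>x\<in>S. x \<triangleleft>\<^bsub>M\<^esub> d x)"
      by (auto simp: T_def)
    have "x \<oplus>\<^bsub>M\<^esub> y = (\<Oplus>\<^bsub>M\<^esub>x\<in>S. x \<triangleleft>\<^bsub>M\<^esub> c x \<oplus>\<^bsub>M\<^esub> x \<triangleleft>\<^bsub>M\<^esub> d x)"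
      unfolding c(2) d(2) using cl[OF c(1)] cl[OF d(1)] by (rule M.finsum_addf[symmetric])
    also have "\<dots> = (\<Oplus>\<^bsub>M\<^esub>x\<in>S. x \<triangleleft>\<^bsub>M\<^esub> (c x \<oplus>\<^bsub>\<Lambda>\<^esub> d x))"
      by (rule M.finsum_cong'[OF refl])
        (use c(1) d(1) S(2) in \<open>auto simp: Pi_iff subset_iff M.ract_r_distr intro!: M.ract_closed\<close>)
    finally show "x \<oplus>\<^bsub>M\<^esub> y \<in> T" using c(1) d(1)
      by (auto simp: T_def intro!: exI[of _ "\<lambda>x. c x \<oplus>\<^bsub>\<Lambda>\<^esub> d x"])
  qed
  moreover have "S \<subseteq> T"
  proof
    fix x assume x: "x \<in> S"
    then have xM: "x \<in> carrier M" using S(2) by auto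
    have "(\<Oplus>\<^bsub>M\<^esub>y\<in>S. y \<triangleleft>\<^bsub>M\<^esub> (if x = y then \<one>\<^bsub>\<Lambda>\<^esub> else \<zero>\<^bsub>\<Lambda>\<^esub>)) =
        (\<Oplus>\<^bsub>M\<^esub>y\<in>S. if x = y then y else \<zero>\<^bsub>M\<^esub>)"
      by (rule M.finsum_cong'[OF refl]) (use S(2) in \<open>auto simp: M.zero_ract M.ract_one\<close>)
    also have "\<dots> = x" using x S(1,2) by (intro M.finsum_singleton) auto
    finally show "x \<in> T" unfolding T_def
      by (auto intro!: exI[of _ "\<lambda>y. if x = y then \<one>\<^bsub>\<Lambda>\<^esub> else \<zero>\<^bsub>\<Lambda>\<^esub>"])
  qed
  ultimately have "carrier M \<subseteq> T" by (rule S(3))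
  then show ?L unfolding mods_def T_def using M.right_module_axioms S(1,2) by blast
qed

lemma mods_surj_image:
  assumes "M \<in> mods \<Lambda>" "right_module \<Lambda> N" "f \<in> rhom \<Lambda> M N" "f ` carrier M = carrier N"
  shows "N \<in> mods \<Lambda>"
proof -
  obtain S where S: "finite S" "S \<subseteq> carrier M"
    "\<And>L. rsubmodule \<Lambda> L M \<Longrightarrow> S \<subseteq> L \<Longrightarrow> carrier M \<subseteq> L"
    using assms(1) unfolding mods_iff_generated by blast
  have "carrier N \<subseteq> L" if "rsubmodule \<Lambda> L N" "f ` S \<subseteq> L" for L
  proof -
    have "carrier M \<subseteq> {x \<in> carrier M. f x \<in> L}"
      using S(2) that by (intro S(3) rhom_vimage_rsubmodule[OF modsD[OF assms(1)] assms(2,3)]) auto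
    then have "f ` carrier M \<subseteq> L" by blast
    then show ?thesis by (simp add: assms(4))
  qed
  moreover have "f ` S \<subseteq> carrier N" using S(2) assms(4) by auto
  ultimately show ?thesis unfolding mods_iff_generated using assms(2) S(1) by blast
qed

section \<open>Submodules of finitely generated modules\<close>

text \<open>
  The \<open>K\<close>-span of a list, built up one vector at a time, so that the tails of the list give a flag
  of \<open>K\<close>-subspaces.
\<close>

primrec flag_span :: "'k ring \<Rightarrow> ('k, 'a) module \<Rightarrow> ('a, 'm) rmodule \<Rightarrow> 'm list \<Rightarrow> 'm set" where
  "flag_span K \<Lambda> M [] = {\<zero>\<^bsub>M\<^esub>}"
| "flag_span K \<Lambda> M (b # bs) =
    {v \<oplus>\<^bsub>M\<^esub> b \<triangleleft>\<^bsub>M\<^esub> (c \<odot>\<^bsub>\<Lambda>\<^esub> \<one>\<^bsub>\<Lambda>\<^esub>) | v c. v \<in> flag_span K \<Lambda> M bs \<and> c \<in> carrier K}"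

text \<open>
  The number of steps of the flag in which \<open>W\<close> has a leading term, that is, the number of pivots of
  an echelon form of \<open>W\<close>.  It plays the part of the dimension of \<open>W\<close>.
\<close>

primrec flag_rank :: "'k ring \<Rightarrow> ('k, 'a) module \<Rightarrow> ('a, 'm) rmodule \<Rightarrow> 'm list \<Rightarrow> 'm set \<Rightarrow> nat" where
  "flag_rank K \<Lambda> M [] W = 0"
| "flag_rank K \<Lambda> M (b # bs) W =
    flag_rank K \<Lambda> M bs W + (if \<exists>w \<in> W. \<exists>v \<in> flag_span K \<Lambda> M bs. w = v \<oplus>\<^bsub>M\<^esub> b then 1 else 0)"

context fin_dim_algebra
begin

context
  fixes M :: "('a, 'm) rmodule"
  assumes M: "right_module \<Lambda> M"
begin

interpretation M: right_module \<Lambda> M by (rule M)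

abbreviation (input) scal where "scal x c \<equiv> x \<triangleleft>\<^bsub>M\<^esub> (c \<odot> \<one>)"
abbreviation (input) mspan where "mspan \<equiv> flag_span K \<Lambda> M"
abbreviation (input) mrank where "mrank \<equiv> flag_rank K \<Lambda> M"

lemma scal_mult: "\<lbrakk>x \<in> carrier M; c \<in> carrier K; d \<in> carrier K\<rbrakk> \<Longrightarrow> scal (scal x c) d = scal x (c \<otimes>\<^bsub>K\<^esub> d)"
  using M.ract_assoc[of x "c \<odot> \<one>" "d \<odot> \<one>"] smult_mult_left[of c \<one> "d \<odot> \<one>"] smult_assoc1[of c d \<one>]
  by simp

lemma scal_add: "\<lbrakk>x \<in> carrier M; c \<in> carrier K; d \<in> carrier K\<rbrakk> \<Longrightarrow>
    scal x c \<oplus>\<^bsub>M\<^esub> scal x d = scal x (c \<oplus>\<^bsub>K\<^esub> d)"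
  by (simp add: smult_l_distr M.ract_r_distr)

lemma scal_closed: "\<lbrakk>x \<in> carrier M; c \<in> carrier K\<rbrakk> \<Longrightarrow> scal x c \<in> carrier M"
  by (simp add: M.ract_closed)

lemma scal_zero: "x \<in> carrier M \<Longrightarrow> scal x \<zero>\<^bsub>K\<^esub> = \<zero>\<^bsub>M\<^esub>"
  by (simp add: M.zero_ract)

lemma flag_span_closed: "set bs \<subseteq> carrier M \<Longrightarrow> mspan bs \<subseteq> carrier M"
  by (induction bs) (auto simp: scal_closed subset_iff)

lemma flag_span_zero: "set bs \<subseteq> carrier M \<Longrightarrow> \<zero>\<^bsub>M\<^esub> \<in> mspan bs"
  by (induction bs) (auto intro!: exI[of _ "\<zero>\<^bsub>M\<^esub>"] exI[of _ "\<zero>\<^bsub>K\<^esub>"] simp: scal_zero simp del: smult_l_null)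

lemma flag_span_add:
  assumes "set bs \<subseteq> carrier M" "x \<in> mspan bs" "y \<in> mspan bs"
  shows "x \<oplus>\<^bsub>M\<^esub> y \<in> mspan bs"
  using assms
proof (induction bs arbitrary: x y)
  case (Cons b bs)
  obtain v c where x: "v \<in> mspan bs" "c \<in> carrier K" "x = v \<oplus>\<^bsub>M\<^esub> scal b c" using Cons.prems by auto
  obtain w d where y: "w \<in> mspan bs" "d \<in> carrier K" "y = w \<oplus>\<^bsub>M\<^esub> scal b d" using Cons.prems by auto
  have cl: "v \<in> carrier M" "w \<in> carrier M" "b \<in> carrier M"
    using x y flag_span_closed[of bs] Cons.prems by auto
  have "x \<oplus>\<^bsub>M\<^esub> y = (v \<oplus>\<^bsub>M\<^esub> w) \<oplus>\<^bsub>M\<^esub> (scal b c \<oplus>\<^bsub>M\<^esub> scal b d)"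
    using x y cl scal_closed by (simp add: M.a_ac)
  also have "scal b c \<oplus>\<^bsub>M\<^esub> scal b d = scal b (c \<oplus>\<^bsub>K\<^esub> d)" using x y cl by (simp only: scal_add)
  finally show ?case using x y Cons by (auto intro!: exI[of _ "v \<oplus>\<^bsub>M\<^esub> w"] exI[of _ "c \<oplus>\<^bsub>K\<^esub> d"])
qed simp

lemma flag_span_scal:
  assumes "set bs \<subseteq> carrier M" "x \<in> mspan bs" "d \<in> carrier K"
  shows "scal x d \<in> mspan bs"
  using assms
proof (induction bs arbitrary: x)
  case (Cons b bs)
  obtain v c where x: "v \<in> mspan bs" "c \<in> carrier K" "x = v \<oplus>\<^bsub>M\<^esub> scal b c" using Cons.prems by auto
  have cl: "v \<in> carrier M" "b \<in> carrier M"
    using x flag_span_closed[of bs] Cons.prems by auto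
  have "scal x d = scal v d \<oplus>\<^bsub>M\<^esub> scal (scal b c) d"
    using x cl Cons.prems scal_closed by (simp add: M.ract_l_distr)
  also have "scal (scal b c) d = scal b (c \<otimes>\<^bsub>K\<^esub> d)" using x cl Cons.prems by (simp only: scal_mult)
  finally show ?case using x Cons by (auto intro!: exI[of _ "scal v d"] exI[of _ "c \<otimes>\<^bsub>K\<^esub> d"])
qed (simp add: M.ract_zero)

lemma flag_span_base:
  assumes "set bs \<subseteq> carrier M" "b \<in> set bs"
  shows "b \<in> mspan bs"
  using assms
proof (induction bs)
  case (Cons a bs)
  then consider "b = a" | "b \<in> mspan bs" by auto
  then show ?case
  proof cases
    case 1
    then show ?thesis using Cons.prems flag_span_zero[of bs]
      by (auto intro!: exI[of _ "\<zero>\<^bsub>M\<^esub>"] exI[of _ "\<one>\<^bsub>K\<^esub>"] simp: M.ract_one)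
  next
    case 2
    moreover have "b \<in> carrier M" using Cons.prems by auto
    ultimately show ?thesis using Cons.prems
      by (auto intro!: exI[of _ b] exI[of _ "\<zero>\<^bsub>K\<^esub>"] simp: scal_zero simp del: smult_l_null)
  qed
qed simp

lemma flag_rank_le_length: "mrank bs W \<le> length bs"
  by (induction bs) auto

lemma flag_rank_mono: "W \<subseteq> W' \<Longrightarrow> mrank bs W \<le> mrank bs W'"
  by (induction bs) (auto simp: subset_iff add_mono)

text \<open>
  The elimination argument: a nonzero leading coefficient of an element of the larger submodule can
  be cancelled by an element of the smaller one with the same pivot, which leaves an element further
  down the flag.
\<close>

lemma flag_rank_eq:
  assumes W: "rsubmodule \<Lambda> W M" and W': "rsubmodule \<Lambda> W' M" and sub: "W \<subseteq> W'"
    and bs: "set bs \<subseteq> carrier M" and eq: "mrank bs W = mrank bs W'"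
  shows "W' \<inter> mspan bs \<subseteq> W"
  using bs eq
proof (induction bs)
  case Nil
  then show ?case using W by (auto simp: rsubmodule_iff[OF M])
next
  case (Cons b bs)
  have bsM: "set bs \<subseteq> carrier M" and b: "b \<in> carrier M" using Cons.prems by auto
  have le: "mrank bs W \<le> mrank bs W'" by (rule flag_rank_mono[OF sub])
  have imp: "\<exists>w \<in> W'. \<exists>v \<in> mspan bs. w = v \<oplus>\<^bsub>M\<^esub> b" if "\<exists>w \<in> W. \<exists>v \<in> mspan bs. w = v \<oplus>\<^bsub>M\<^esub> b"
    using that sub by blast
  have req: "mrank bs W = mrank bs W'" using Cons.prems(2) le imp by (auto split: if_splits)
  have lead: "\<exists>w \<in> W. \<exists>v \<in> mspan bs. w = v \<oplus>\<^bsub>M\<^esub> b" if "\<exists>w \<in> W'. \<exists>v \<in> mspan bs. w = v \<oplus>\<^bsub>M\<^esub> b"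
    using Cons.prems(2) req that by (auto split: if_splits)
  have IH: "W' \<inter> mspan bs \<subseteq> W" using Cons.IH[OF bsM req] .
  have WM: "W \<subseteq> carrier M" "W' \<subseteq> carrier M" "\<And>x y. x \<in> W \<Longrightarrow> y \<in> W \<Longrightarrow> x \<oplus>\<^bsub>M\<^esub> y \<in> W"
    "\<And>x c. x \<in> W \<Longrightarrow> c \<in> carrier K \<Longrightarrow> scal x c \<in> W"
    "\<And>x c. x \<in> W' \<Longrightarrow> c \<in> carrier K \<Longrightarrow> scal x c \<in> W'"
    using W W' by (auto simp: rsubmodule_iff[OF M])
  show ?case
  proof
    fix w' assume "w' \<in> W' \<inter> mspan (b # bs)"
    then obtain v c where w': "w' \<in> W'" "v \<in> mspan bs" "c \<in> carrier K" "w' = v \<oplus>\<^bsub>M\<^esub> scal b c" by auto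
    have v: "v \<in> carrier M" using w'(2) flag_span_closed[OF bsM] by blast
    show "w' \<in> W"
    proof (cases "c = \<zero>\<^bsub>K\<^esub>")
      case True
      then have "w' = v" using w'(4) v b by (simp add: scal_zero del: smult_l_null)
      then show ?thesis using IH w'(1,2) by auto
    next
      case False
      then have ci: "inv\<^bsub>K\<^esub> c \<in> carrier K" "c \<otimes>\<^bsub>K\<^esub> inv\<^bsub>K\<^esub> c = \<one>\<^bsub>K\<^esub>"
        using w'(3) by (auto simp: K.field_Units)
      have "scal w' (inv\<^bsub>K\<^esub> c) = scal v (inv\<^bsub>K\<^esub> c) \<oplus>\<^bsub>M\<^esub> scal (scal b c) (inv\<^bsub>K\<^esub> c)"
        unfolding w'(4) using v b w'(3) ci(1) scal_closed by (simp add: M.ract_l_distr)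
      also have "scal (scal b c) (inv\<^bsub>K\<^esub> c) = b"
        using b w'(3) ci by (simp add: scal_mult M.ract_one)
      finally have "\<exists>w \<in> W'. \<exists>v \<in> mspan bs. w = v \<oplus>\<^bsub>M\<^esub> b"
        using WM(5)[OF w'(1) ci(1)] flag_span_scal[OF bsM w'(2) ci(1)] by metis
      then obtain w u where w: "w \<in> W" "u \<in> mspan bs" "w = u \<oplus>\<^bsub>M\<^esub> b" using lead by blast
      have u: "u \<in> carrier M" using w(2) flag_span_closed[OF bsM] by blast
      \<comment> \<open>subtract the multiple \<open>w c\<close> of the pivot element to cancel the leading term of \<open>w'\<close>\<close>
      define c' where "c' = \<ominus>\<^bsub>K\<^esub> c"
      have c': "c' \<in> carrier K" "c \<oplus>\<^bsub>K\<^esub> c' = \<zero>\<^bsub>K\<^esub>" using w'(3) by (auto simp: c'_def R.r_neg)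
      have sw: "scal w c' \<in> W" "scal w c \<in> W" using WM(4) w(1) c' w'(3) by auto
      have wM: "w \<in> carrier M" "w' \<in> carrier M" using w(1) w'(1) WM by auto
      have "w' \<oplus>\<^bsub>M\<^esub> scal w c' = v \<oplus>\<^bsub>M\<^esub> scal b c \<oplus>\<^bsub>M\<^esub> (scal u c' \<oplus>\<^bsub>M\<^esub> scal b c')"
        unfolding w'(4) w(3) using u b c' by (simp add: M.ract_l_distr)
      also have "\<dots> = v \<oplus>\<^bsub>M\<^esub> scal u c' \<oplus>\<^bsub>M\<^esub> (scal b c \<oplus>\<^bsub>M\<^esub> scal b c')"
        using v b u c'(1) w'(3) scal_closed by (simp add: M.a_ac)
      also have "scal b c \<oplus>\<^bsub>M\<^esub> scal b c' = \<zero>\<^bsub>M\<^esub>"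
        using b c' w'(3) by (simp add: scal_add scal_zero del: smult_l_null)
      finally have e: "w' \<oplus>\<^bsub>M\<^esub> scal w c' = v \<oplus>\<^bsub>M\<^esub> scal u c'"
        using v u c'(1) scal_closed by simp
      have "v \<oplus>\<^bsub>M\<^esub> scal u c' \<in> mspan bs"
        using flag_span_add[OF bsM w'(2)] flag_span_scal[OF bsM w(2) c'(1)] by simp
      moreover have "w' \<oplus>\<^bsub>M\<^esub> scal w c' \<in> W'"
        using w'(1) sw(1) sub W' by (auto simp: rsubmodule_iff[OF M])
      ultimately have "w' \<oplus>\<^bsub>M\<^esub> scal w c' \<in> W" using IH e by auto
      then have "(w' \<oplus>\<^bsub>M\<^esub> scal w c') \<oplus>\<^bsub>M\<^esub> scal w c \<in> W" using sw(2) WM(3) by blast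
      also have "(w' \<oplus>\<^bsub>M\<^esub> scal w c') \<oplus>\<^bsub>M\<^esub> scal w c = w' \<oplus>\<^bsub>M\<^esub> (scal w c \<oplus>\<^bsub>M\<^esub> scal w c')"
        using wM c'(1) w'(3) scal_closed by (simp add: M.a_ac)
      also have "\<dots> = w'" using wM c' w'(3) by (simp add: scal_add scal_zero del: smult_l_null)
      finally show ?thesis .
    qed
  qed
qed

end

text \<open>
  The products of generators of \<open>M\<close> with a spanning set of \<open>\<Lambda>\<close> span \<open>M\<close> over \<open>K\<close>.
\<close>

lemma mods_flag:
  assumes "M \<in> mods \<Lambda>"
  shows "\<exists>bs. set bs \<subseteq> carrier M \<and> flag_span K \<Lambda> M bs = carrier M"
proof -
  have M: "right_module \<Lambda> M" by (rule modsD[OF assms])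
  interpret M: right_module \<Lambda> M by (rule M)
  obtain S where S: "finite S" "S \<subseteq> carrier M"
    "\<And>N. rsubmodule \<Lambda> N M \<Longrightarrow> S \<subseteq> N \<Longrightarrow> carrier M \<subseteq> N"
    using assms unfolding mods_iff_generated by blast
  obtain B where B: "finite B" "B \<subseteq> carrier \<Lambda>"
    "\<And>x. x \<in> carrier \<Lambda> \<Longrightarrow> \<exists>d \<in> B \<rightarrow> carrier K. x = (\<Oplus>b\<in>B. d b \<odot> b)"
    using fin_dim by blast
  obtain bs where bs: "set bs = (\<lambda>(s, b). s \<triangleleft>\<^bsub>M\<^esub> b) ` (S \<times> B)"
    using S(1) B(1) by (metis finite_list finite_cartesian_product finite_imageI)
  have bsM: "set bs \<subseteq> carrier M" using S(2) B(2) by (auto simp: bs intro!: M.ract_closed)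
  let ?F = "flag_span K \<Lambda> M bs"
  have lin: "s \<triangleleft>\<^bsub>M\<^esub> (\<Oplus>b\<in>B'. d b \<odot> b) \<in> ?F" if B': "B' \<subseteq> B" "d \<in> B \<rightarrow> carrier K" and s: "s \<in> carrier M"
    and base: "\<And>b. b \<in> B \<Longrightarrow> s \<triangleleft>\<^bsub>M\<^esub> b \<in> ?F" for B' d s
    using finite_subset[OF B'(1) B(1)] B'(1)
  proof (induction B' rule: finite_induct)
    case empty
    then show ?case using s flag_span_zero[OF M bsM] by (simp add: M.zero_ract)
  next
    case (insert b B')
    have b: "b \<in> carrier \<Lambda>" "d b \<in> carrier K" and bB: "b \<in> B" using insert.prems B(2) B'(2) by auto
    have f: "(\<lambda>b. d b \<odot> b) \<in> B' \<rightarrow> carrier \<Lambda>" using insert.prems B(2) B'(2) by auto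
    have "b \<otimes> (d b \<odot> \<one>) = d b \<odot> b" using smult_mult_right[of "d b" b \<one>] b by simp
    then have "s \<triangleleft>\<^bsub>M\<^esub> (d b \<odot> b) = (s \<triangleleft>\<^bsub>M\<^esub> b) \<triangleleft>\<^bsub>M\<^esub> (d b \<odot> \<one>)"
      using M.ract_assoc[OF s b(1), of "d b \<odot> \<one>"] b by simp
    then have "s \<triangleleft>\<^bsub>M\<^esub> (d b \<odot> b) \<in> ?F" using flag_span_scal[OF M bsM base[OF bB] b(2)] by simp
    moreover have "s \<triangleleft>\<^bsub>M\<^esub> (\<Oplus>b\<in>insert b B'. d b \<odot> b) =
        s \<triangleleft>\<^bsub>M\<^esub> (d b \<odot> b) \<oplus>\<^bsub>M\<^esub> s \<triangleleft>\<^bsub>M\<^esub> (\<Oplus>b\<in>B'. d b \<odot> b)"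
      using insert.hyps f b s by (simp add: M.ract_r_distr)
    ultimately show ?case using insert flag_span_add[OF M bsM] by simp
  qed
  have all: "s \<triangleleft>\<^bsub>M\<^esub> a \<in> ?F" if s: "s \<in> carrier M" and base: "\<And>b. b \<in> B \<Longrightarrow> s \<triangleleft>\<^bsub>M\<^esub> b \<in> ?F"
    and a: "a \<in> carrier \<Lambda>" for s a
    using lin[OF subset_refl _ s base] B(3)[OF a] by blast
  \<comment> \<open>the largest submodule inside the span contains \<open>S\<close>, so it is all of \<open>M\<close>\<close>
  define N where "N = {x \<in> carrier M. \<forall>a \<in> carrier \<Lambda>. x \<triangleleft>\<^bsub>M\<^esub> a \<in> ?F}"
  have "rsubmodule \<Lambda> N M" unfolding N_def rsubmodule_iff[OF M]
    using flag_span_zero[OF M bsM] flag_span_add[OF M bsM]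
    by (auto simp: M.ract_zero M.ract_l_distr M.ract_closed simp flip: M.ract_assoc)
  moreover have "S \<subseteq> N"
  proof
    fix s assume s: "s \<in> S"
    then have sM: "s \<in> carrier M" using S(2) by auto
    have "s \<triangleleft>\<^bsub>M\<^esub> b \<in> ?F" if "b \<in> B" for b
      using s that by (intro flag_span_base[OF M bsM]) (auto simp: bs)
    then show "s \<in> N" using all[OF sM] sM by (auto simp: N_def)
  qed
  ultimately have "carrier M \<subseteq> N" by (rule S(3))
  then have "m \<triangleleft>\<^bsub>M\<^esub> \<one> \<in> ?F" if "m \<in> carrier M" for m
    using that by (auto simp: N_def)
  then have "carrier M \<subseteq> ?F" by (auto simp: M.ract_one)
  then show ?thesis using bsM flag_span_closed[OF M bsM] by blast
qed

text \<open>
  A bounded and strictly monotone rank on submodules gives both chain conditions.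
\<close>

lemma submodule_rank:
  assumes "M \<in> mods \<Lambda>"
  shows "\<exists>rk n. (\<forall>W. rk W \<le> (n :: nat)) \<and>
    (\<forall>W W'. rsubmodule \<Lambda> W M \<longrightarrow> rsubmodule \<Lambda> W' M \<longrightarrow> W \<subset> W' \<longrightarrow> rk W < rk W')"
proof -
  have M: "right_module \<Lambda> M" by (rule modsD[OF assms])
  obtain bs where bs: "set bs \<subseteq> carrier M" "flag_span K \<Lambda> M bs = carrier M"
    using mods_flag[OF assms] by blast
  have "flag_rank K \<Lambda> M bs W < flag_rank K \<Lambda> M bs W'"
    if W: "rsubmodule \<Lambda> W M" "rsubmodule \<Lambda> W' M" "W \<subset> W'" for W W'
  proof -
    have "flag_rank K \<Lambda> M bs W \<noteq> flag_rank K \<Lambda> M bs W'"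
    proof
      assume "flag_rank K \<Lambda> M bs W = flag_rank K \<Lambda> M bs W'"
      then have "W' \<inter> carrier M \<subseteq> W" using flag_rank_eq[OF M W(1,2) _ bs(1)] W(3) bs(2) by auto
      then show False using W by (auto simp: rsubmodule_iff[OF M])
    qed
    moreover have "flag_rank K \<Lambda> M bs W \<le> flag_rank K \<Lambda> M bs W'"
      using W(3) by (intro flag_rank_mono[OF M]) auto
    ultimately show ?thesis by simp
  qed
  then show ?thesis using flag_rank_le_length[OF M] by blast
qed

text \<open>
  The noetherian property: among the submodules generated by finite subsets of \<open>N\<close>, one of maximal
  rank cannot be enlarged by a further element of \<open>N\<close>.
\<close>

lemma rsubmodule_mods:
  fixes M :: "('a, 'm) rmodule"
  assumes "M \<in> mods \<Lambda>" and N: "rsubmodule \<Lambda> N M"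
  shows "M\<lparr>carrier := N\<rparr> \<in> mods \<Lambda>"
proof -
  have M: "right_module \<Lambda> M" by (rule modsD[OF assms(1)])
  interpret M: right_module \<Lambda> M by (rule M)
  obtain rk :: "'m set \<Rightarrow> nat" and n where "\<forall>W. rk W \<le> n"
    "\<forall>W W'. rsubmodule \<Lambda> W M \<longrightarrow> rsubmodule \<Lambda> W' M \<longrightarrow> W \<subset> W' \<longrightarrow> rk W < rk W'"
    using submodule_rank[OF assms(1)] by blast
  note rk = this[rule_format]
  define gen where "gen S = \<Inter>{W. rsubmodule \<Lambda> W M \<and> S \<subseteq> W}" for S
  have gen_sub: "rsubmodule \<Lambda> (gen S) M" if "S \<subseteq> carrier M" for S
    using that rsubmodule_carrier[OF M] unfolding gen_def rsubmodule_iff[OF M] by auto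
  have gen_min: "gen S \<subseteq> W" if "rsubmodule \<Lambda> W M" "S \<subseteq> W" for S W
    using that by (auto simp: gen_def)
  have gen_sup: "S \<subseteq> gen S" for S by (auto simp: gen_def)
  have NM: "N \<subseteq> carrier M" using N by (auto simp: rsubmodule_iff[OF M])
  define Q where "Q k \<longleftrightarrow> (\<exists>S. finite S \<and> S \<subseteq> N \<and> rk (gen S) = k)" for k
  have "Q (rk (gen {}))" by (auto simp: Q_def)
  moreover have Qn: "j \<le> n" if "Q j" for j using that rk(1) by (auto simp: Q_def)
  ultimately have "Q (Greatest Q)" and kmax: "\<And>j. Q j \<Longrightarrow> j \<le> Greatest Q"
    using Greatest_le_nat[of Q _ n] GreatestI_nat[of Q _ n] by blast+
  then obtain k where "Q k" and kmax: "\<And>j. Q j \<Longrightarrow> j \<le> k" by blast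
  then obtain S where S: "finite S" "S \<subseteq> N" "rk (gen S) = k" by (auto simp: Q_def)
  have "N \<subseteq> gen S"
  proof
    fix x assume x: "x \<in> N"
    have "Q (rk (gen (insert x S)))" unfolding Q_def using S x by (intro exI[of _ "insert x S"]) auto
    then have "\<not> rk (gen S) < rk (gen (insert x S))" using kmax S(3) by (simp add: leD)
    moreover have "rsubmodule \<Lambda> (gen S) M" "rsubmodule \<Lambda> (gen (insert x S)) M"
      using S(2) x NM by (auto intro!: gen_sub)
    moreover have "gen S \<subseteq> gen (insert x S)"
      by (rule gen_min) (use calculation gen_sup[of "insert x S"] in auto)
    ultimately have "gen S = gen (insert x S)" using rk(2) by blast
    then show "x \<in> gen S" using gen_sup[of "insert x S"] by blast
  qed
  then have "N \<subseteq> W" if "rsubmodule \<Lambda> W (M\<lparr>carrier := N\<rparr>)" "S \<subseteq> W" for W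
    using gen_min[of W S] that by (auto simp: rsubmodule_trans[OF M N])
  then show ?thesis unfolding mods_iff_generated
    using S(1,2) rsubmodule_right_module[OF M N] by (auto intro!: exI[of _ S])
qed

text \<open>
  The artinian property: a nonzero submodule of least rank is simple.
\<close>

lemma exists_simple_rsubmodule:
  fixes M :: "('a, 'm) rmodule"
  assumes "M \<in> mods \<Lambda>" and N: "rsubmodule \<Lambda> N M" "N \<noteq> {\<zero>\<^bsub>M\<^esub>}"
  shows "\<exists>S. simple_rsubmodule \<Lambda> S M \<and> S \<subseteq> N"
proof -
  have M: "right_module \<Lambda> M" by (rule modsD[OF assms(1)])
  obtain rk :: "'m set \<Rightarrow> nat" and n where "\<forall>W. rk W \<le> n"
    "\<forall>W W'. rsubmodule \<Lambda> W M \<longrightarrow> rsubmodule \<Lambda> W' M \<longrightarrow> W \<subset> W' \<longrightarrow> rk W < rk W'"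
    using submodule_rank[OF assms(1)] by blast
  note rk = this[rule_format]
  define Q where "Q S \<longleftrightarrow> rsubmodule \<Lambda> S M \<and> S \<noteq> {\<zero>\<^bsub>M\<^esub>} \<and> S \<subseteq> N" for S
  have "Q N" using N by (simp add: Q_def)
  then obtain S where S: "Q S" "\<And>T. Q T \<Longrightarrow> rk S \<le> rk T"
    using ex_has_least_nat[of Q N rk] by blast
  have "simple_rsubmodule \<Lambda> S M"
    unfolding simple_rsubmodule_def
  proof (intro conjI allI impI)
    fix T assume T: "rsubmodule \<Lambda> T M \<and> T \<subseteq> S"
    show "T = {\<zero>\<^bsub>M\<^esub>} \<or> T = S"
    proof (rule ccontr)
      assume "\<not> (T = {\<zero>\<^bsub>M\<^esub>} \<or> T = S)"
      then have "Q T" "T \<subset> S" using T S(1) by (auto simp: Q_def)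
      then show False using S rk(2)[of T S] T by (auto simp: Q_def leD)
    qed
  qed (use S(1) in \<open>auto simp: Q_def\<close>)
  then show ?thesis using S(1) by (auto simp: Q_def)
qed

lemma soc_rsubmodule:
  assumes "right_module \<Lambda> M"
  shows "rsubmodule \<Lambda> (carrier (soc \<Lambda> M)) M"
proof -
  define F where "F = {N. rsubmodule \<Lambda> N M \<and> (\<forall>S. simple_rsubmodule \<Lambda> S M \<longrightarrow> S \<subseteq> N)}"
  have "S \<subseteq> carrier M" if "simple_rsubmodule \<Lambda> S M" for S
    using that by (auto simp: simple_rsubmodule_def rsubmodule_iff[OF assms])
  then have "carrier M \<in> F" using rsubmodule_carrier[OF assms] by (auto simp: F_def)
  moreover have "rsubmodule \<Lambda> N M" if "N \<in> F" for N using that by (simp add: F_def)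
  ultimately have "rsubmodule \<Lambda> (\<Inter>F) M" unfolding rsubmodule_iff[OF assms] by blast
  then show ?thesis by (simp add: soc_def F_def)
qed

text \<open>
  Every nonzero submodule contains a simple one, and the socle contains all of these.
\<close>

lemma soc_essential:
  assumes "M \<in> mods \<Lambda>"
  shows "essential_rsubmodule \<Lambda> (carrier (soc \<Lambda> M)) M"
  unfolding essential_rsubmodule_def
proof (intro conjI allI impI)
  have M: "right_module \<Lambda> M" by (rule modsD[OF assms(1)])
  show "rsubmodule \<Lambda> (carrier (soc \<Lambda> M)) M" by (rule soc_rsubmodule[OF M])
  fix N assume "rsubmodule \<Lambda> N M \<and> N \<noteq> {\<zero>\<^bsub>M\<^esub>}"
  then obtain S where S: "simple_rsubmodule \<Lambda> S M" "S \<subseteq> N"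
    using exists_simple_rsubmodule[OF assms] by blast
  then have "S \<subseteq> carrier (soc \<Lambda> M)" by (auto simp: soc_def)
  moreover have "S \<noteq> {\<zero>\<^bsub>M\<^esub>}" "\<zero>\<^bsub>M\<^esub> \<in> S" using S(1) by (auto simp: simple_rsubmodule_def rsubmodule_iff[OF M])
  ultimately show "carrier (soc \<Lambda> M) \<inter> N \<noteq> {\<zero>\<^bsub>M\<^esub>}" using S(2) by blast
qed

lemma soc_eq: "soc \<Lambda> M = M\<lparr>carrier := carrier (soc \<Lambda> M)\<rparr>"
  by (simp add: soc_def)

lemma soc_mods: "M \<in> mods \<Lambda> \<Longrightarrow> soc \<Lambda> M \<in> mods \<Lambda>"
  by (subst soc_eq) (intro rsubmodule_mods soc_rsubmodule modsD)

end

section \<open>Quotients and products\<close>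

lemma right_module_surj_image:
  assumes "right_module \<Lambda> M" and im: "f ` carrier M = carrier N" "\<zero>\<^bsub>N\<^esub> = f \<zero>\<^bsub>M\<^esub>"
    and add: "\<And>x y. x \<in> carrier M \<Longrightarrow> y \<in> carrier M \<Longrightarrow> f x \<oplus>\<^bsub>N\<^esub> f y = f (x \<oplus>\<^bsub>M\<^esub> y)"
    and act: "\<And>x a. x \<in> carrier M \<Longrightarrow> a \<in> carrier \<Lambda> \<Longrightarrow> f x \<triangleleft>\<^bsub>N\<^esub> a = f (x \<triangleleft>\<^bsub>M\<^esub> a)"
  shows "right_module \<Lambda> N"
proof -
  interpret M: right_module \<Lambda> M by fact
  have car: "carrier N = f ` carrier M" by (simp add: im)
  have ag: "abelian_group N"
  proof (rule abelian_groupI)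
    fix x assume "x \<in> carrier N"
    then obtain u where u: "u \<in> carrier M" "x = f u" by (auto simp: car)
    show "\<exists>y \<in> carrier N. y \<oplus>\<^bsub>N\<^esub> x = \<zero>\<^bsub>N\<^esub>"
      by (rule bexI[of _ "f (\<ominus>\<^bsub>M\<^esub> u)"]) (simp_all add: car im(2) add u M.l_neg)
  qed (auto simp: car im(2) add M.a_ac)
  show ?thesis
    by (intro right_module.intro right_module_axioms.intro ag M.R.ring_axioms)
      (auto simp: car im(2) add act M.ract_closed M.ract_l_distr M.ract_r_distr M.ract_assoc M.ract_one)
qed

text \<open>
  The quotient is realised on chosen representatives of the cosets, not on the cosets, so that it
  has the same type of elements as \<open>M\<close>.
\<close>

lemma exists_quotient_module:
  fixes M :: "('a, 'm) rmodule"
  assumes M: "right_module \<Lambda> M" and N: "rsubmodule \<Lambda> N M"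
  shows "\<exists>(Q :: ('a, 'm) rmodule) p. right_module \<Lambda> Q \<and> p \<in> rhom \<Lambda> M Q \<and> p ` carrier M = carrier Q \<and>
    (\<forall>x \<in> carrier M. p x = \<zero>\<^bsub>Q\<^esub> \<longleftrightarrow> x \<in> N)"
proof -
  interpret M: right_module \<Lambda> M by (rule M)
  have N': "N \<subseteq> carrier M" "\<zero>\<^bsub>M\<^esub> \<in> N" "\<And>x y. x \<in> N \<Longrightarrow> y \<in> N \<Longrightarrow> x \<oplus>\<^bsub>M\<^esub> y \<in> N"
    "\<And>x a. x \<in> N \<Longrightarrow> a \<in> carrier \<Lambda> \<Longrightarrow> x \<triangleleft>\<^bsub>M\<^esub> a \<in> N"
    using N by (auto simp: rsubmodule_iff[OF M])
  define p where "p x = (SOME y. y \<in> carrier M \<and> (\<exists>n \<in> N. y = x \<oplus>\<^bsub>M\<^esub> n))" for x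
  have p: "p x \<in> carrier M" "\<exists>n \<in> N. p x = x \<oplus>\<^bsub>M\<^esub> n" if "x \<in> carrier M" for x
  proof -
    have "\<exists>y. y \<in> carrier M \<and> (\<exists>n \<in> N. y = x \<oplus>\<^bsub>M\<^esub> n)"
      using that N'(2) by (intro exI[of _ x]) (auto intro!: bexI[of _ "\<zero>\<^bsub>M\<^esub>"])
    from someI_ex[OF this] show "p x \<in> carrier M" "\<exists>n \<in> N. p x = x \<oplus>\<^bsub>M\<^esub> n"
      by (auto simp: p_def)
  qed
  have shift: "p (x \<oplus>\<^bsub>M\<^esub> n) = p x" if x: "x \<in> carrier M" and n: "n \<in> N" for x n
  proof -
    have nM: "n \<in> carrier M" using n N'(1) by blast
    have neg: "\<ominus>\<^bsub>M\<^esub> n \<in> N" using rsubmodule_neg[OF M N n] .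
    have "(\<exists>k \<in> N. y = (x \<oplus>\<^bsub>M\<^esub> n) \<oplus>\<^bsub>M\<^esub> k) \<longleftrightarrow> (\<exists>k \<in> N. y = x \<oplus>\<^bsub>M\<^esub> k)" for y
    proof
      assume "\<exists>k \<in> N. y = (x \<oplus>\<^bsub>M\<^esub> n) \<oplus>\<^bsub>M\<^esub> k"
      then obtain k where k: "k \<in> N" "y = (x \<oplus>\<^bsub>M\<^esub> n) \<oplus>\<^bsub>M\<^esub> k" by blast
      then have "y = x \<oplus>\<^bsub>M\<^esub> (n \<oplus>\<^bsub>M\<^esub> k)" using x nM N'(1) by (auto simp: M.a_assoc)
      then show "\<exists>k \<in> N. y = x \<oplus>\<^bsub>M\<^esub> k" using N'(3)[OF n k(1)] by blast
    next
      assume "\<exists>k \<in> N. y = x \<oplus>\<^bsub>M\<^esub> k"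
      then obtain k where k: "k \<in> N" "y = x \<oplus>\<^bsub>M\<^esub> k" by blast
      then have kM: "k \<in> carrier M" using N'(1) by blast
      have "(x \<oplus>\<^bsub>M\<^esub> n) \<oplus>\<^bsub>M\<^esub> (\<ominus>\<^bsub>M\<^esub> n \<oplus>\<^bsub>M\<^esub> k) = x \<oplus>\<^bsub>M\<^esub> ((n \<oplus>\<^bsub>M\<^esub> \<ominus>\<^bsub>M\<^esub> n) \<oplus>\<^bsub>M\<^esub> k)"
        using x nM kM by (simp only: M.a_assoc M.a_closed M.a_inv_closed)
      also have "\<dots> = y" using x nM kM k(2) by (simp add: M.r_neg)
      finally show "\<exists>k \<in> N. y = (x \<oplus>\<^bsub>M\<^esub> n) \<oplus>\<^bsub>M\<^esub> k" using N'(3)[OF neg k(1)] by metis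
    qed
    then show ?thesis by (simp add: p_def)
  qed
  define Q where "Q = M\<lparr>carrier := p ` carrier M, zero := p \<zero>\<^bsub>M\<^esub>,
    add := (\<lambda>x y. p (x \<oplus>\<^bsub>M\<^esub> y)), ract := (\<lambda>x a. p (x \<triangleleft>\<^bsub>M\<^esub> a))\<rparr>"
  have add: "p x \<oplus>\<^bsub>Q\<^esub> p y = p (x \<oplus>\<^bsub>M\<^esub> y)" if xy: "x \<in> carrier M" "y \<in> carrier M" for x y
  proof -
    obtain n k where nk: "n \<in> N" "p x = x \<oplus>\<^bsub>M\<^esub> n" "k \<in> N" "p y = y \<oplus>\<^bsub>M\<^esub> k" using p(2) xy by blast
    have nkM: "n \<in> carrier M" "k \<in> carrier M" using nk N'(1) by auto
    have "p x \<oplus>\<^bsub>M\<^esub> p y = (x \<oplus>\<^bsub>M\<^esub> y) \<oplus>\<^bsub>M\<^esub> (n \<oplus>\<^bsub>M\<^esub> k)"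
      unfolding nk(2,4) using xy nkM by (simp add: M.a_ac)
    then show ?thesis using shift[of "x \<oplus>\<^bsub>M\<^esub> y" "n \<oplus>\<^bsub>M\<^esub> k"] xy N'(3)[OF nk(1,3)] by (simp add: Q_def)
  qed
  have act: "p x \<triangleleft>\<^bsub>Q\<^esub> a = p (x \<triangleleft>\<^bsub>M\<^esub> a)" if xa: "x \<in> carrier M" "a \<in> carrier \<Lambda>" for x a
  proof -
    obtain n where n: "n \<in> N" "p x = x \<oplus>\<^bsub>M\<^esub> n" using p(2) xa by blast
    have "p x \<triangleleft>\<^bsub>M\<^esub> a = x \<triangleleft>\<^bsub>M\<^esub> a \<oplus>\<^bsub>M\<^esub> n \<triangleleft>\<^bsub>M\<^esub> a"
      unfolding n(2) using xa n(1) N'(1) by (auto simp: M.ract_l_distr)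
    then show ?thesis using shift[of "x \<triangleleft>\<^bsub>M\<^esub> a" "n \<triangleleft>\<^bsub>M\<^esub> a"] xa N'(4)[OF n(1) xa(2)]
      by (simp add: Q_def M.ract_closed)
  qed
  have Q: "right_module \<Lambda> Q"
    by (rule right_module_surj_image[OF M _ _ add act]) (simp_all add: Q_def)
  have "p \<in> rhom \<Lambda> M Q" by (rule rhomI) (simp_all add: add act, simp add: Q_def)
  moreover have "p x = \<zero>\<^bsub>Q\<^esub> \<longleftrightarrow> x \<in> N" if x: "x \<in> carrier M" for x
  proof
    assume "x \<in> N"
    then show "p x = \<zero>\<^bsub>Q\<^esub>" using shift[of "\<zero>\<^bsub>M\<^esub>" x] x by (simp add: Q_def)
  next
    assume "p x = \<zero>\<^bsub>Q\<^esub>"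
    then have px: "p x = p \<zero>\<^bsub>M\<^esub>" by (simp add: Q_def)
    obtain n k where nk: "n \<in> N" "p x = x \<oplus>\<^bsub>M\<^esub> n" "k \<in> N" "p \<zero>\<^bsub>M\<^esub> = \<zero>\<^bsub>M\<^esub> \<oplus>\<^bsub>M\<^esub> k"
      using p(2) x by blast
    have nkM: "n \<in> carrier M" "k \<in> carrier M" using nk N'(1) by auto
    then have "x \<oplus>\<^bsub>M\<^esub> n = k" using px nk by simp
    then have "k \<ominus>\<^bsub>M\<^esub> n = x" using x nkM by (auto simp: a_minus_def M.a_assoc M.r_neg)
    then show "x \<in> N" using rsubmodule_minus[OF M N nk(3,1)] by simp
  qed
  ultimately show ?thesis using Q by (intro exI[of _ Q] exI[of _ p]) (auto simp: Q_def)
qed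

definition prod_module :: "('a, 'm) rmodule \<Rightarrow> ('a, 'n) rmodule \<Rightarrow> ('a, 'm \<times> 'n) rmodule" where
  "prod_module M N = \<lparr>carrier = carrier M \<times> carrier N, monoid.mult = undefined, one = undefined,
     ring.zero = (\<zero>\<^bsub>M\<^esub>, \<zero>\<^bsub>N\<^esub>),
     ring.add = (\<lambda>x y. (fst x \<oplus>\<^bsub>M\<^esub> fst y, snd x \<oplus>\<^bsub>N\<^esub> snd y)),
     ract = (\<lambda>x a. (fst x \<triangleleft>\<^bsub>M\<^esub> a, snd x \<triangleleft>\<^bsub>N\<^esub> a))\<rparr>"

lemma prod_module_simps [simp]:
  "carrier (prod_module M N) = carrier M \<times> carrier N"
  "\<zero>\<^bsub>prod_module M N\<^esub> = (\<zero>\<^bsub>M\<^esub>, \<zero>\<^bsub>N\<^esub>)"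
  "(x, y) \<oplus>\<^bsub>prod_module M N\<^esub> (x', y') = (x \<oplus>\<^bsub>M\<^esub> x', y \<oplus>\<^bsub>N\<^esub> y')"
  "(x, y) \<triangleleft>\<^bsub>prod_module M N\<^esub> a = (x \<triangleleft>\<^bsub>M\<^esub> a, y \<triangleleft>\<^bsub>N\<^esub> a)"
  by (simp_all add: prod_module_def)

lemma prod_right_module:
  assumes "right_module \<Lambda> M" "right_module \<Lambda> N"
  shows "right_module \<Lambda> (prod_module M N)"
proof -
  interpret M: right_module \<Lambda> M by fact
  interpret N: right_module \<Lambda> N by fact
  have ag: "abelian_group (prod_module M N)"
  proof (rule abelian_groupI)
    fix x assume "x \<in> carrier (prod_module M N)"
    then obtain u v where u: "u \<in> carrier M" "v \<in> carrier N" "x = (u, v)" by auto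
    show "\<exists>y \<in> carrier (prod_module M N). y \<oplus>\<^bsub>prod_module M N\<^esub> x = \<zero>\<^bsub>prod_module M N\<^esub>"
      by (rule bexI[of _ "(\<ominus>\<^bsub>M\<^esub> u, \<ominus>\<^bsub>N\<^esub> v)"]) (simp_all add: u M.l_neg N.l_neg)
  qed (auto simp: M.a_ac N.a_ac)
  show ?thesis
    by (intro right_module.intro right_module_axioms.intro ag M.R.ring_axioms)
      (auto simp: M.ract_closed M.ract_l_distr M.ract_r_distr M.ract_assoc M.ract_one
        N.ract_closed N.ract_l_distr N.ract_r_distr N.ract_assoc N.ract_one)
qed

lemma rhom_pair: "f \<in> rhom \<Lambda> L M \<Longrightarrow> g \<in> rhom \<Lambda> L N \<Longrightarrow> (\<lambda>x. (f x, g x)) \<in> rhom \<Lambda> L (prod_module M N)"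
  by (rule rhomI) (simp_all add: rhom_closed rhom_add rhom_ract)

lemma rhom_fst: "fst \<in> rhom \<Lambda> (prod_module M N) M"
  and rhom_snd: "snd \<in> rhom \<Lambda> (prod_module M N) N"
  by (auto intro!: rhomI)

lemma rhom_inl: "right_module \<Lambda> N \<Longrightarrow> (\<lambda>x. (x, \<zero>\<^bsub>N\<^esub>)) \<in> rhom \<Lambda> M (prod_module M N)"
  by (rule rhomI) (auto simp: right_module.ract_zero right_module.axioms
      abelian_group.axioms abelian_monoid.zero_closed abelian_monoid.l_zero)

lemma rhom_inr: "right_module \<Lambda> M \<Longrightarrow> (\<lambda>y. (\<zero>\<^bsub>M\<^esub>, y)) \<in> rhom \<Lambda> N (prod_module M N)"
  by (rule rhomI) (auto simp: right_module.ract_zero right_module.axioms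
      abelian_group.axioms abelian_monoid.zero_closed abelian_monoid.l_zero)

lemma prod_mods:
  assumes "M \<in> mods \<Lambda>" "N \<in> mods \<Lambda>"
  shows "prod_module M N \<in> mods \<Lambda>"
proof -
  have M: "right_module \<Lambda> M" and N: "right_module \<Lambda> N" using assms by (auto intro: modsD)
  have MN: "right_module \<Lambda> (prod_module M N)" by (rule prod_right_module[OF M N])
  interpret M: right_module \<Lambda> M by (rule M)
  interpret N: right_module \<Lambda> N by (rule N)
  obtain S where S: "finite S" "S \<subseteq> carrier M"
    "\<And>L. rsubmodule \<Lambda> L M \<Longrightarrow> S \<subseteq> L \<Longrightarrow> carrier M \<subseteq> L"
    using assms(1) unfolding mods_iff_generated by blast
  obtain T where T: "finite T" "T \<subseteq> carrier N"
    "\<And>L. rsubmodule \<Lambda> L N \<Longrightarrow> T \<subseteq> L \<Longrightarrow> carrier N \<subseteq> L"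
    using assms(2) unfolding mods_iff_generated by blast
  define G where "G = (\<lambda>x. (x, \<zero>\<^bsub>N\<^esub>)) ` S \<union> (\<lambda>y. (\<zero>\<^bsub>M\<^esub>, y)) ` T"
  have "carrier (prod_module M N) \<subseteq> L" if L: "rsubmodule \<Lambda> L (prod_module M N)" "G \<subseteq> L" for L
  proof
    fix z assume "z \<in> carrier (prod_module M N)"
    then obtain x y where z: "x \<in> carrier M" "y \<in> carrier N" "z = (x, y)" by auto
    have "carrier M \<subseteq> {x \<in> carrier M. (x, \<zero>\<^bsub>N\<^esub>) \<in> L}"
      using L(2) S(2) by (intro S(3) rhom_vimage_rsubmodule[OF M MN rhom_inl[OF N] L(1)]) (auto simp: G_def)
    moreover have "carrier N \<subseteq> {y \<in> carrier N. (\<zero>\<^bsub>M\<^esub>, y) \<in> L}"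
      using L(2) T(2) by (intro T(3) rhom_vimage_rsubmodule[OF N MN rhom_inr[OF M] L(1)]) (auto simp: G_def)
    ultimately have "(x, \<zero>\<^bsub>N\<^esub>) \<in> L" "(\<zero>\<^bsub>M\<^esub>, y) \<in> L" using z by auto
    then have "(x, \<zero>\<^bsub>N\<^esub>) \<oplus>\<^bsub>prod_module M N\<^esub> (\<zero>\<^bsub>M\<^esub>, y) \<in> L"
      using L(1) unfolding rsubmodule_iff[OF MN] by blast
    then show "z \<in> L" using z by simp
  qed
  moreover have "finite G" "G \<subseteq> carrier (prod_module M N)" using S T by (auto simp: G_def)
  ultimately show ?thesis unfolding mods_iff_generated using MN by blast
qed

section \<open>Projective and injective modules\<close>

lemma projective_mods: "projective \<Lambda> P \<Longrightarrow> P \<in> mods \<Lambda>"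
  by (simp add: projective_def)

lemma injective_mods: "injective \<Lambda> I \<Longrightarrow> I \<in> mods \<Lambda>"
  by (simp add: injective_def)

lemma projectiveI:
  fixes \<Lambda> :: "('k, 'a) module"
  assumes "P \<in> mods \<Lambda>"
    and "\<And>(U :: ('k, 'a) umodule) (V :: ('k, 'a) umodule) g f.
      \<lbrakk>U \<in> mods \<Lambda>; V \<in> mods \<Lambda>; g \<in> rhom \<Lambda> U V; g ` carrier U = carrier V; f \<in> rhom \<Lambda> P V\<rbrakk> \<Longrightarrow>
      \<exists>h \<in> rhom \<Lambda> P U. \<forall>p \<in> carrier P. g (h p) = f p"
  shows "projective \<Lambda> P"
  using assms by (auto simp: projective_def)

lemma injectiveI:
  fixes \<Lambda> :: "('k, 'a) module"
  assumes "I \<in> mods \<Lambda>"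
    and "\<And>(U :: ('k, 'a) umodule) (V :: ('k, 'a) umodule) g f.
      \<lbrakk>U \<in> mods \<Lambda>; V \<in> mods \<Lambda>; g \<in> rhom \<Lambda> U V; inj_on g (carrier U); f \<in> rhom \<Lambda> U I\<rbrakk> \<Longrightarrow>
      \<exists>h \<in> rhom \<Lambda> V I. \<forall>x \<in> carrier U. h (g x) = f x"
  shows "injective \<Lambda> I"
  using assms by (auto simp: injective_def)

lemma projectiveD:
  fixes \<Lambda> :: "('k, 'a) module" and U V :: "('k, 'a) umodule"
  assumes "projective \<Lambda> P" "U \<in> mods \<Lambda>" "V \<in> mods \<Lambda>" "g \<in> rhom \<Lambda> U V"
    "g ` carrier U = carrier V" "f \<in> rhom \<Lambda> P V"
  shows "\<exists>h \<in> rhom \<Lambda> P U. \<forall>p \<in> carrier P. g (h p) = f p"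
  using assms unfolding projective_def by blast

lemma injectiveD:
  fixes \<Lambda> :: "('k, 'a) module" and U V :: "('k, 'a) umodule"
  assumes "injective \<Lambda> I" "U \<in> mods \<Lambda>" "V \<in> mods \<Lambda>" "g \<in> rhom \<Lambda> U V"
    "inj_on g (carrier U)" "f \<in> rhom \<Lambda> U I"
  shows "\<exists>h \<in> rhom \<Lambda> V I. \<forall>x \<in> carrier U. h (g x) = f x"
  using assms unfolding injective_def by blast

text \<open>
  The defining properties of projective and injective modules test only against modules with
  elements in \<open>nat \<Rightarrow> 'k\<close>.  Passing to copies there removes this restriction
  (\<open>projective_lift\<close> and \<open>injective_extend\<close>).
\<close>

lemma universe_copy:
  fixes \<Lambda> :: "('k, 'a) module" and M :: "('a, 'm) rmodule"
  assumes "fin_dim_algebra K \<Lambda>" "M \<in> mods \<Lambda>"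
  obtains N :: "('k, 'a) umodule" and f g where "N \<in> mods \<Lambda>" "f \<in> rhom \<Lambda> M N" "g \<in> rhom \<Lambda> N M"
    "\<And>x. x \<in> carrier M \<Longrightarrow> g (f x) = x" "\<And>y. y \<in> carrier N \<Longrightarrow> f (g y) = y"
proof -
  obtain N :: "('k, 'a) umodule" where N: "N \<in> mods \<Lambda>" "rmod_iso \<Lambda> M N"
    using mods_universe[OF assms] by blast
  show ?thesis
    by (rule rmod_iso_obtain[OF modsD[OF assms(2)] modsD[OF N(1)] N(2)]) (rule that[OF N(1)])
qed

lemma projective_lift:
  fixes \<Lambda> :: "('k, 'a) module"
  assumes A: "fin_dim_algebra K \<Lambda>" and P: "projective \<Lambda> P" and UV: "U \<in> mods \<Lambda>" "V \<in> mods \<Lambda>"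
    and g: "g \<in> rhom \<Lambda> U V" "g ` carrier U = carrier V" and f: "f \<in> rhom \<Lambda> P V"
  shows "\<exists>h \<in> rhom \<Lambda> P U. \<forall>p \<in> carrier P. g (h p) = f p"
proof -
  obtain U' :: "('k, 'a) umodule" and u u' where U': "U' \<in> mods \<Lambda>" "u \<in> rhom \<Lambda> U U'" "u' \<in> rhom \<Lambda> U' U"
    "\<And>x. x \<in> carrier U \<Longrightarrow> u' (u x) = x" "\<And>y. y \<in> carrier U' \<Longrightarrow> u (u' y) = y"
    by (rule universe_copy[OF A UV(1)]) (rule that)
  obtain V' :: "('k, 'a) umodule" and v v' where V': "V' \<in> mods \<Lambda>" "v \<in> rhom \<Lambda> V V'" "v' \<in> rhom \<Lambda> V' V"
    "\<And>x. x \<in> carrier V \<Longrightarrow> v' (v x) = x" "\<And>y. y \<in> carrier V' \<Longrightarrow> v (v' y) = y"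
    by (rule universe_copy[OF A UV(2)]) (rule that)
  define g' where "g' = v \<circ> g \<circ> u'"
  have g': "g' \<in> rhom \<Lambda> U' V'"
    unfolding g'_def using U' V' g by (intro rhom_comp)
  have "g' ` carrier U' = carrier V'"
  proof
    show "g' ` carrier U' \<subseteq> carrier V'" using g' by (auto simp: rhom_closed)
    show "carrier V' \<subseteq> g' ` carrier U'"
    proof
      fix y assume y: "y \<in> carrier V'"
      then have "v' y \<in> carrier V" using V' by (simp add: rhom_closed)
      then obtain x where x: "x \<in> carrier U" "g x = v' y" using g(2) by (metis imageE)
      have "g' (u x) = y" using x y U' V' by (simp add: g'_def)
      then show "y \<in> g' ` carrier U'" using x U' by (metis imageI rhom_closed)
    qed
  qed
  moreover have "v \<circ> f \<in> rhom \<Lambda> P V'" using f V' by (intro rhom_comp)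
  ultimately obtain h where h: "h \<in> rhom \<Lambda> P U'" "\<forall>p \<in> carrier P. g' (h p) = (v \<circ> f) p"
    using projectiveD[OF P U'(1) V'(1) g'] by blast
  have "g (u' (h p)) = f p" if p: "p \<in> carrier P" for p
  proof -
    have "v (g (u' (h p))) = v (f p)" using h(2) p by (simp add: g'_def)
    moreover have "g (u' (h p)) \<in> carrier V" "f p \<in> carrier V"
      using p h(1) U'(3) g(1) f by (simp_all add: rhom_closed)
    ultimately show ?thesis using V'(4) by metis
  qed
  moreover have "u' \<circ> h \<in> rhom \<Lambda> P U" using h U' by (intro rhom_comp)
  ultimately show ?thesis by (intro bexI[of _ "u' \<circ> h"]) auto
qed

lemma injective_extend:
  fixes \<Lambda> :: "('k, 'a) module"
  assumes A: "fin_dim_algebra K \<Lambda>" and I: "injective \<Lambda> I" and UV: "U \<in> mods \<Lambda>" "V \<in> mods \<Lambda>"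
    and g: "g \<in> rhom \<Lambda> U V" "inj_on g (carrier U)" and f: "f \<in> rhom \<Lambda> U I"
  shows "\<exists>h \<in> rhom \<Lambda> V I. \<forall>x \<in> carrier U. h (g x) = f x"
proof -
  obtain U' :: "('k, 'a) umodule" and u u' where U': "U' \<in> mods \<Lambda>" "u \<in> rhom \<Lambda> U U'" "u' \<in> rhom \<Lambda> U' U"
    "\<And>x. x \<in> carrier U \<Longrightarrow> u' (u x) = x" "\<And>y. y \<in> carrier U' \<Longrightarrow> u (u' y) = y"
    by (rule universe_copy[OF A UV(1)]) (rule that)
  obtain V' :: "('k, 'a) umodule" and v v' where V': "V' \<in> mods \<Lambda>" "v \<in> rhom \<Lambda> V V'" "v' \<in> rhom \<Lambda> V' V"
    "\<And>x. x \<in> carrier V \<Longrightarrow> v' (v x) = x" "\<And>y. y \<in> carrier V' \<Longrightarrow> v (v' y) = y"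
    by (rule universe_copy[OF A UV(2)]) (rule that)
  define g' where "g' = v \<circ> g \<circ> u'"
  have g': "g' \<in> rhom \<Lambda> U' V'"
    unfolding g'_def using U' V' g by (intro rhom_comp)
  have "inj_on g' (carrier U')"
  proof (rule inj_onI)
    fix x y assume xy: "x \<in> carrier U'" "y \<in> carrier U'" "g' x = g' y"
    have c: "u' x \<in> carrier U" "u' y \<in> carrier U" using xy U' by (simp_all add: rhom_closed)
    then have "g (u' x) = g (u' y)"
      using xy(3) V'(4) rhom_closed[OF g(1)] unfolding g'_def comp_def by metis
    then have "u' x = u' y" using c g(2) by (auto dest: inj_onD)
    then show "x = y" using U'(5) xy by metis
  qed
  moreover have "f \<circ> u' \<in> rhom \<Lambda> U' I" using f U' by (intro rhom_comp)
  ultimately obtain h where h: "h \<in> rhom \<Lambda> V' I" "\<forall>x \<in> carrier U'. h (g' x) = (f \<circ> u') x"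
    using injectiveD[OF I U'(1) V'(1) g'] by blast
  have "h (v (g x)) = f x" if x: "x \<in> carrier U" for x
    using h(2)[rule_format, of "u x"] x U' by (simp add: g'_def rhom_closed)
  moreover have "h \<circ> v \<in> rhom \<Lambda> V I" using h V' by (intro rhom_comp)
  ultimately show ?thesis by (intro bexI[of _ "h \<circ> v"]) auto
qed

lemma projective_retract:
  fixes \<Lambda> :: "('k, 'a) module"
  assumes P: "projective \<Lambda> P" and N: "N \<in> mods \<Lambda>"
    and ir: "i \<in> rhom \<Lambda> N P" "r \<in> rhom \<Lambda> P N" "\<And>x. x \<in> carrier N \<Longrightarrow> r (i x) = x"
  shows "projective \<Lambda> N"
proof (rule projectiveI[OF N])
  fix U V :: "('k, 'a) umodule" and g f assume *: "U \<in> mods \<Lambda>" "V \<in> mods \<Lambda>" "g \<in> rhom \<Lambda> U V" "g ` carrier U = carrier V" "f \<in> rhom \<Lambda> N V"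
  have "f \<circ> r \<in> rhom \<Lambda> P V" using ir * by (intro rhom_comp)
  then obtain h where h: "h \<in> rhom \<Lambda> P U" "\<forall>p \<in> carrier P. g (h p) = (f \<circ> r) p"
    using projectiveD[OF P *(1-4)] by blast
  have "h \<circ> i \<in> rhom \<Lambda> N U" using ir h by (intro rhom_comp)
  then show "\<exists>h \<in> rhom \<Lambda> N U. \<forall>p \<in> carrier N. g (h p) = f p"
    using h(2) ir rhom_closed[OF ir(1)] by (intro bexI[of _ "h \<circ> i"]) auto
qed

lemma injective_retract:
  fixes \<Lambda> :: "('k, 'a) module"
  assumes I: "injective \<Lambda> I" and N: "N \<in> mods \<Lambda>"
    and ir: "i \<in> rhom \<Lambda> N I" "r \<in> rhom \<Lambda> I N" "\<And>x. x \<in> carrier N \<Longrightarrow> r (i x) = x"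
  shows "injective \<Lambda> N"
proof (rule injectiveI[OF N])
  fix U V :: "('k, 'a) umodule" and g f assume *: "U \<in> mods \<Lambda>" "V \<in> mods \<Lambda>" "g \<in> rhom \<Lambda> U V" "inj_on g (carrier U)" "f \<in> rhom \<Lambda> U N"
  have "i \<circ> f \<in> rhom \<Lambda> U I" using ir * by (intro rhom_comp)
  then obtain h where h: "h \<in> rhom \<Lambda> V I" "\<forall>p \<in> carrier U. h (g p) = (i \<circ> f) p"
    using injectiveD[OF I *(1-4)] by blast
  have "r \<circ> h \<in> rhom \<Lambda> V N" using ir h by (intro rhom_comp)
  then show "\<exists>h \<in> rhom \<Lambda> V N. \<forall>p \<in> carrier U. h (g p) = f p"
    using h(2) ir rhom_closed[OF *(5)] by (intro bexI[of _ "r \<circ> h"]) auto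
qed

lemma projective_prod:
  fixes \<Lambda> :: "('k, 'a) module"
  assumes P: "projective \<Lambda> P" and Q: "projective \<Lambda> Q"
  shows "projective \<Lambda> (prod_module P Q)"
proof (rule projectiveI)
  have PM: "right_module \<Lambda> P" and QM: "right_module \<Lambda> Q" using P Q by (auto intro: modsD projective_mods)
  interpret P: right_module \<Lambda> P by (rule PM)
  interpret Q: right_module \<Lambda> Q by (rule QM)
  show "prod_module P Q \<in> mods \<Lambda>" using P Q by (intro prod_mods projective_mods)
  fix U V :: "('k, 'a) umodule" and g f assume *: "U \<in> mods \<Lambda>" "V \<in> mods \<Lambda>" "g \<in> rhom \<Lambda> U V" "g ` carrier U = carrier V"
    "f \<in> rhom \<Lambda> (prod_module P Q) V"
  have "f \<circ> (\<lambda>x. (x, \<zero>\<^bsub>Q\<^esub>)) \<in> rhom \<Lambda> P V" using * rhom_inl[OF QM] by (intro rhom_comp)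
  then obtain h where h: "h \<in> rhom \<Lambda> P U" "\<And>p. p \<in> carrier P \<Longrightarrow> g (h p) = f (p, \<zero>\<^bsub>Q\<^esub>)"
    using projectiveD[OF P *(1-4)] by fastforce
  have "f \<circ> (\<lambda>y. (\<zero>\<^bsub>P\<^esub>, y)) \<in> rhom \<Lambda> Q V" using * rhom_inr[OF PM] by (intro rhom_comp)
  then obtain k where k: "k \<in> rhom \<Lambda> Q U" "\<And>p. p \<in> carrier Q \<Longrightarrow> g (k p) = f (\<zero>\<^bsub>P\<^esub>, p)"
    using projectiveD[OF Q *(1-4)] by fastforce
  have "(\<lambda>z. (h \<circ> fst) z \<oplus>\<^bsub>U\<^esub> (k \<circ> snd) z) \<in> rhom \<Lambda> (prod_module P Q) U"
    by (rule rhom_plus[OF modsD[OF *(1)] rhom_comp[OF rhom_fst h(1)] rhom_comp[OF rhom_snd k(1)]])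
  moreover have "g (h x \<oplus>\<^bsub>U\<^esub> k y) = f (x, y)" if "x \<in> carrier P" "y \<in> carrier Q" for x y
    using that h k rhom_add[OF *(5), of "(x, \<zero>\<^bsub>Q\<^esub>)" "(\<zero>\<^bsub>P\<^esub>, y)"] *(3)
    by (simp add: rhom_add rhom_closed)
  ultimately show "\<exists>h \<in> rhom \<Lambda> (prod_module P Q) U. \<forall>p \<in> carrier (prod_module P Q). g (h p) = f p"
    by (intro bexI) auto
qed

lemma injective_prod:
  fixes \<Lambda> :: "('k, 'a) module"
  assumes I: "injective \<Lambda> I" and J: "injective \<Lambda> J"
  shows "injective \<Lambda> (prod_module I J)"
proof (rule injectiveI)
  show "prod_module I J \<in> mods \<Lambda>" using I J by (intro prod_mods injective_mods)
  fix U V :: "('k, 'a) umodule" and g f assume *: "U \<in> mods \<Lambda>" "V \<in> mods \<Lambda>" "g \<in> rhom \<Lambda> U V" "inj_on g (carrier U)"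
    "f \<in> rhom \<Lambda> U (prod_module I J)"
  have "fst \<circ> f \<in> rhom \<Lambda> U I" "snd \<circ> f \<in> rhom \<Lambda> U J"
    using * by (auto intro: rhom_comp rhom_fst rhom_snd)
  then obtain h k where hk: "h \<in> rhom \<Lambda> V I" "\<forall>p \<in> carrier U. h (g p) = (fst \<circ> f) p"
      "k \<in> rhom \<Lambda> V J" "\<forall>p \<in> carrier U. k (g p) = (snd \<circ> f) p"
    using injectiveD[OF I *(1-4)] injectiveD[OF J *(1-4)] by blast
  then show "\<exists>h \<in> rhom \<Lambda> V (prod_module I J). \<forall>p \<in> carrier U. h (g p) = f p"
    using rhom_pair[OF hk(1,3)] by (intro bexI) auto
qed

lemma proj_inj_iff: "E \<in> proj_inj_modules \<Lambda> \<longleftrightarrow> projective \<Lambda> E \<and> injective \<Lambda> E"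
  by (auto simp: proj_inj_modules_def projective_mods)

lemma proj_inj_prod:
  "E \<in> proj_inj_modules \<Lambda> \<Longrightarrow> E' \<in> proj_inj_modules \<Lambda> \<Longrightarrow> prod_module E E' \<in> proj_inj_modules \<Lambda>"
  by (simp add: proj_inj_iff projective_prod injective_prod)

lemma zero_mods:
  assumes "right_module \<Lambda> P" "carrier P = {\<zero>\<^bsub>P\<^esub>}"
  shows "P \<in> mods \<Lambda>"
  unfolding mods_iff_generated using assms by (auto simp: rsubmodule_iff[OF assms(1)] intro!: exI[of _ "{}"])

lemma rhom_const_zero:
  assumes "right_module \<Lambda> U"
  shows "(\<lambda>_. \<zero>\<^bsub>U\<^esub>) \<in> rhom \<Lambda> P U"
proof -
  interpret U: right_module \<Lambda> U by fact
  show ?thesis by (rule rhomI) (simp_all add: U.ract_zero)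
qed

lemma zero_projective:
  fixes \<Lambda> :: "('k, 'a) module"
  assumes "right_module \<Lambda> P" "carrier P = {\<zero>\<^bsub>P\<^esub>}"
  shows "projective \<Lambda> P"
proof (rule projectiveI[OF zero_mods[OF assms]])
  fix U V :: "('k, 'a) umodule" and g f assume *: "U \<in> mods \<Lambda>" "V \<in> mods \<Lambda>" "g \<in> rhom \<Lambda> U V" "g ` carrier U = carrier V" "f \<in> rhom \<Lambda> P V"
  then show "\<exists>h \<in> rhom \<Lambda> P U. \<forall>p \<in> carrier P. g (h p) = f p"
    using rhom_zero[OF modsD modsD *(3)] rhom_zero[OF assms(1) modsD *(5)]
    by (intro bexI[of _ "\<lambda>_. \<zero>\<^bsub>U\<^esub>"] rhom_const_zero) (auto simp: assms(2) intro: modsD)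
qed

lemma zero_injective:
  fixes \<Lambda> :: "('k, 'a) module"
  assumes "right_module \<Lambda> I" "carrier I = {\<zero>\<^bsub>I\<^esub>}"
  shows "injective \<Lambda> I"
proof (rule injectiveI[OF zero_mods[OF assms]])
  fix U V :: "('k, 'a) umodule" and g f assume *: "U \<in> mods \<Lambda>" "V \<in> mods \<Lambda>" "g \<in> rhom \<Lambda> U V" "f \<in> rhom \<Lambda> U I"
  then have "f x = \<zero>\<^bsub>I\<^esub>" if "x \<in> carrier U" for x using rhom_closed[OF *(4) that] assms(2) by simp
  then show "\<exists>h \<in> rhom \<Lambda> V I. \<forall>p \<in> carrier U. h (g p) = f p"
    by (intro bexI[of _ "\<lambda>_. \<zero>\<^bsub>I\<^esub>"] rhom_const_zero assms) auto
qed

context fin_dim_algebra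
begin

lemma reg_module_simps [simp]:
  "carrier (reg_module \<Lambda>) = carrier \<Lambda>" "\<zero>\<^bsub>reg_module \<Lambda>\<^esub> = \<zero>" "x \<oplus>\<^bsub>reg_module \<Lambda>\<^esub> y = x \<oplus> y"
  "x \<triangleleft>\<^bsub>reg_module \<Lambda>\<^esub> a = x \<otimes> a"
  by (simp_all add: reg_module_def)

lemma reg_right_module: "right_module \<Lambda> (reg_module \<Lambda>)"
proof -
  have "abelian_group (reg_module \<Lambda>)"
    by (rule abelian_groupI) (auto simp: M.a_ac intro: M.l_neg bexI[of _ "\<ominus> x" for x])
  then show ?thesis
    by (intro right_module.intro right_module_axioms.intro \<Lambda>.ring_axioms)
      (auto simp: \<Lambda>.l_distr \<Lambda>.r_distr \<Lambda>.m_assoc)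
qed

lemma reg_mods: "reg_module \<Lambda> \<in> mods \<Lambda>"
proof -
  have "carrier \<Lambda> \<subseteq> N" if N: "rsubmodule \<Lambda> N (reg_module \<Lambda>)" "\<one> \<in> N" for N
  proof
    fix a assume a: "a \<in> carrier \<Lambda>"
    then have "\<one> \<triangleleft>\<^bsub>reg_module \<Lambda>\<^esub> a \<in> N" using N by (auto simp: rsubmodule_iff[OF reg_right_module])
    then show "a \<in> N" using a by simp
  qed
  then show ?thesis unfolding mods_iff_generated using reg_right_module
    by (auto intro!: exI[of _ "{\<one>}"])
qed

lemma reg_rhom:
  assumes "right_module \<Lambda> M" "m \<in> carrier M"
  shows "(\<lambda>a. m \<triangleleft>\<^bsub>M\<^esub> a) \<in> rhom \<Lambda> (reg_module \<Lambda>) M"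
proof -
  interpret M: right_module \<Lambda> M by fact
  show ?thesis using assms(2)
    by (intro rhomI) (simp_all add: M.ract_closed M.ract_r_distr M.ract_assoc)
qed

lemma reg_projective: "projective \<Lambda> (reg_module \<Lambda>)"
proof (rule projectiveI[OF reg_mods])
  fix U V :: "('k, 'a) umodule" and g f assume *: "U \<in> mods \<Lambda>" "V \<in> mods \<Lambda>" "g \<in> rhom \<Lambda> U V" "g ` carrier U = carrier V"
    "f \<in> rhom \<Lambda> (reg_module \<Lambda>) V"
  then have "f \<one> \<in> carrier V" by (simp add: rhom_closed)
  then obtain u where u: "u \<in> carrier U" "g u = f \<one>" using *(4) by (metis imageE)
  have "g (u \<triangleleft>\<^bsub>U\<^esub> a) = f a" if "a \<in> carrier \<Lambda>" for a
    using that u *(3) rhom_ract[OF *(5), of \<one> a] by (simp add: rhom_ract)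
  then show "\<exists>h \<in> rhom \<Lambda> (reg_module \<Lambda>) U. \<forall>p \<in> carrier (reg_module \<Lambda>). g (h p) = f p"
    using reg_rhom[OF modsD[OF *(1)] u(1)] by (intro bexI) auto
qed

end

section \<open>Projective dimension\<close>

lemma a_kernel_iff: "x \<in> a_kernel M N f \<longleftrightarrow> x \<in> carrier M \<and> f x = \<zero>\<^bsub>N\<^esub>"
  by (simp add: a_kernel_def')

lemma proj_dim_le_iff:
  "proj_dim \<Lambda> M \<le> enat n \<longleftrightarrow>
    (\<exists>P d \<epsilon>. projective_resolution \<Lambda> M P d \<epsilon> \<and> (\<forall>i > n. carrier (P i) = {\<zero>\<^bsub>P i\<^esub>}))"
  (is "_ \<longleftrightarrow> ?R")
proof
  define A where "A = {enat n | n P d \<epsilon>.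
     projective_resolution \<Lambda> M P d \<epsilon> \<and> (\<forall>i > n. carrier (P i) = {\<zero>\<^bsub>P i\<^esub>})}"
  have A: "proj_dim \<Lambda> M = Inf A" by (simp add: proj_dim_def A_def)
  assume "proj_dim \<Lambda> M \<le> enat n"
  then have "Inf A \<le> enat n" by (simp add: A)
  then have ne: "A \<noteq> {}" by (auto simp: Inf_enat_def)
  then have "Inf A \<in> A" using LeastI_ex[of "\<lambda>x. x \<in> A"] by (auto simp: Inf_enat_def)
  then obtain m P d \<epsilon> where m: "Inf A = enat m" "projective_resolution \<Lambda> M P d \<epsilon>"
    "\<forall>i > m. carrier (P i) = {\<zero>\<^bsub>P i\<^esub>}" unfolding A_def by blast
  then have "m \<le> n" using \<open>Inf A \<le> enat n\<close> by simp
  then show ?R using m by (meson order.strict_trans1)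
next
  assume ?R
  then show "proj_dim \<Lambda> M \<le> enat n" unfolding proj_dim_def by (intro Inf_lower) blast
qed

lemma exact_of_proj_dim_le_one:
  fixes \<Lambda> :: "('k, 'a) module" and M :: "('a, 'm) rmodule"
  assumes "proj_dim \<Lambda> M \<le> 1"
  obtains P0 P1 :: "('k, 'a) umodule" and d e where "projective \<Lambda> P0" "projective \<Lambda> P1"
    "d \<in> rhom \<Lambda> P1 P0" "inj_on d (carrier P1)" "e \<in> rhom \<Lambda> P0 M" "e ` carrier P0 = carrier M"
    "\<And>x. x \<in> carrier P0 \<Longrightarrow> e x = \<zero>\<^bsub>M\<^esub> \<longleftrightarrow> x \<in> d ` carrier P1"
proof -
  have "proj_dim \<Lambda> M \<le> enat 1" using assms by (simp add: one_enat_def)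
  then obtain P d \<epsilon> where res: "projective_resolution \<Lambda> M P d \<epsilon>"
    and z: "\<And>i. i > 1 \<Longrightarrow> carrier (P i) = {\<zero>\<^bsub>P i\<^esub>}" unfolding proj_dim_le_iff by blast
  have pr: "projective \<Lambda> (P i)" and dr: "d i \<in> rhom \<Lambda> (P (Suc i)) (P i)" for i
    using res by (auto simp: projective_resolution_def)
  have rm: "right_module \<Lambda> (P i)" for i using pr by (intro modsD projective_mods)
  have e: "\<epsilon> \<in> rhom \<Lambda> (P 0) M" "\<epsilon> ` carrier (P 0) = carrier M"
    and k0: "d 0 ` carrier (P 1) = a_kernel (P 0) M \<epsilon>"
    and k1: "d 1 ` carrier (P 2) = a_kernel (P 1) (P 0) (d 0)"
    using res unfolding projective_resolution_def by (auto simp: numeral_2_eq_2)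
  have d0: "d 0 \<in> rhom \<Lambda> (P 1) (P 0)" and d1: "d 1 \<in> rhom \<Lambda> (P 2) (P 1)"
    using dr[of 0] dr[of 1] by (simp_all add: numeral_2_eq_2)
  have "inj_on (d 0) (carrier (P 1))"
  proof (rule rhom_inj_onI[OF rm rm d0])
    fix x assume "x \<in> carrier (P 1)" "d 0 x = \<zero>\<^bsub>P 0\<^esub>"
    then have "x \<in> d 1 ` carrier (P 2)" unfolding k1 by (simp add: a_kernel_iff)
    then show "x = \<zero>\<^bsub>P 1\<^esub>" using z[of 2] rhom_zero[OF rm rm d1] by simp
  qed
  moreover have "\<epsilon> x = \<zero>\<^bsub>M\<^esub> \<longleftrightarrow> x \<in> d 0 ` carrier (P 1)" if "x \<in> carrier (P 0)" for x
    unfolding k0 using that by (simp add: a_kernel_iff)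
  ultimately show ?thesis using that pr d0 e by blast
qed

text \<open>
  The resolution is \<open>\<dots> \<rightarrow> 0 \<rightarrow> N \<rightarrow> P \<rightarrow> M\<close> with all differentials given by inclusions.
\<close>

lemma proj_dim_le_one_of_kernel:
  fixes \<Lambda> :: "('k, 'a) module" and M :: "('a, 'm) rmodule" and P :: "('k, 'a) umodule"
  assumes P: "projective \<Lambda> P" and e: "e \<in> rhom \<Lambda> P M" "e ` carrier P = carrier M"
    and N: "N = {x \<in> carrier P. e x = \<zero>\<^bsub>M\<^esub>}" "rsubmodule \<Lambda> N P" "projective \<Lambda> (P\<lparr>carrier := N\<rparr>)"
  shows "proj_dim \<Lambda> M \<le> 1"
proof -
  have PM: "right_module \<Lambda> P" using P by (intro modsD projective_mods)
  define Z where "Z = P\<lparr>carrier := {\<zero>\<^bsub>P\<^esub>}\<rparr>"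
  have Z: "projective \<Lambda> Z"
    unfolding Z_def by (intro zero_projective rsubmodule_right_module PM rsubmodule_zero) simp
  define Q where "Q i = (if i = 0 then P else if i = 1 then P\<lparr>carrier := N\<rparr> else Z)" for i :: nat
  have NP: "N \<subseteq> carrier P" "\<zero>\<^bsub>P\<^esub> \<in> N" using N(2) by (auto simp: rsubmodule_iff[OF PM])
  have zP: "\<zero>\<^bsub>P\<^esub> \<in> carrier P" using NP by auto
  have "projective_resolution \<Lambda> M Q (\<lambda>_. id) e"
    unfolding projective_resolution_def
  proof (intro conjI allI)
    show "projective \<Lambda> (Q i)" for i using P N(3) Z by (simp add: Q_def)
    show "id \<in> rhom \<Lambda> (Q (Suc i)) (Q i)" for i
      using NP by (auto simp: Q_def Z_def rhom_def)
    show "id ` carrier (Q 1) = a_kernel (Q 0) M e" by (auto simp: Q_def N(1) a_kernel_iff)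
    show "id ` carrier (Q (Suc (Suc i))) = a_kernel (Q (Suc i)) (Q i) id" for i
      using NP zP by (auto simp: Q_def a_kernel_iff Z_def)
  qed (use e in \<open>simp_all add: Q_def\<close>)
  moreover have "\<forall>i > 1. carrier (Q i) = {\<zero>\<^bsub>Q i\<^esub>}" by (simp add: Q_def Z_def)
  ultimately have "proj_dim \<Lambda> M \<le> enat 1" unfolding proj_dim_le_iff by blast
  then show ?thesis by (simp add: one_enat_def)
qed

context fin_dim_algebra
begin

text \<open>
  The lifting property in the form in which comparison maps between resolutions are built: lifting
  along a map onto its image.
\<close>

lemma projective_lift_image:
  assumes P: "projective \<Lambda> P" and UV: "U \<in> mods \<Lambda>" "right_module \<Lambda> V" and g: "g \<in> rhom \<Lambda> U V"
    and f: "f \<in> rhom \<Lambda> P V" "\<And>x. x \<in> carrier P \<Longrightarrow> f x \<in> g ` carrier U"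
  shows "\<exists>h \<in> rhom \<Lambda> P U. \<forall>p \<in> carrier P. g (h p) = f p"
proof -
  have sub: "rsubmodule \<Lambda> (g ` carrier U) V" using rhom_image_rsubmodule[OF modsD[OF UV(1)] UV(2) g] .
  have g': "g \<in> rhom \<Lambda> U (V\<lparr>carrier := g ` carrier U\<rparr>)" using g by (intro rhom_corestrict) auto
  have f': "f \<in> rhom \<Lambda> P (V\<lparr>carrier := g ` carrier U\<rparr>)" using f by (intro rhom_corestrict) auto
  have "V\<lparr>carrier := g ` carrier U\<rparr> \<in> mods \<Lambda>"
    using UV(1) rsubmodule_right_module[OF UV(2) sub] g' by (rule mods_surj_image) simp
  then show ?thesis using projective_lift[OF fin_dim_algebra_axioms P UV(1) _ g' _ f'] by simp
qed

text \<open>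
  The maps make \<open>N\<close> a direct summand of \<open>P \<oplus> Q\<close>; this is the form in which a homotopy formula is used.
\<close>

lemma projective_of_two_projectives:
  assumes P: "projective \<Lambda> P" and Q: "projective \<Lambda> Q" and N: "N \<in> mods \<Lambda>"
    and a: "a \<in> rhom \<Lambda> N P" "a' \<in> rhom \<Lambda> N Q" and b: "b \<in> rhom \<Lambda> P N" "b' \<in> rhom \<Lambda> Q N"
    and id: "\<And>x. x \<in> carrier N \<Longrightarrow> b (a x) \<oplus>\<^bsub>N\<^esub> b' (a' x) = x"
  shows "projective \<Lambda> N"
proof (rule projective_retract[OF projective_prod[OF P Q] N rhom_pair[OF a]])
  show "(\<lambda>z. (b \<circ> fst) z \<oplus>\<^bsub>N\<^esub> (b' \<circ> snd) z) \<in> rhom \<Lambda> (prod_module P Q) N"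
    by (rule rhom_plus[OF modsD[OF N] rhom_comp[OF rhom_fst b(1)] rhom_comp[OF rhom_snd b(2)]])
qed (simp add: id)

section \<open>Dominant dimension\<close>

text \<open>
  Exactness of \<open>0 \<rightarrow> M \<rightarrow> J0 \<rightarrow> J1\<close> with projective-injective \<open>J0\<close> and \<open>J1\<close>: the module version of
  having dominant dimension at least two, without minimality, so that it passes to direct sums and
  summands.
\<close>

definition proj_inj_copresented :: "('a, 'm) rmodule \<Rightarrow> bool" where
  "proj_inj_copresented M \<longleftrightarrow> (\<exists>J0 \<in> proj_inj_modules \<Lambda>. \<exists>J1 \<in> proj_inj_modules \<Lambda>.
     \<exists>a \<in> rhom \<Lambda> M (J0 :: ('k, 'a) umodule). \<exists>b \<in> rhom \<Lambda> J0 (J1 :: ('k, 'a) umodule).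
       inj_on a (carrier M) \<and> (\<forall>y \<in> carrier J0. b y = \<zero>\<^bsub>J1\<^esub> \<longleftrightarrow> y \<in> a ` carrier M))"

lemma proj_inj_mods: "E \<in> proj_inj_modules \<Lambda> \<Longrightarrow> E \<in> mods \<Lambda>"
  by (simp add: proj_inj_modules_def)

lemma proj_inj_copy:
  fixes E :: "('a, 'm) rmodule"
  assumes "E \<in> proj_inj_modules \<Lambda>"
  obtains N :: "('k, 'a) umodule" and f g where "N \<in> proj_inj_modules \<Lambda>" "f \<in> rhom \<Lambda> E N" "g \<in> rhom \<Lambda> N E"
    "\<And>x. x \<in> carrier E \<Longrightarrow> g (f x) = x" "\<And>y. y \<in> carrier N \<Longrightarrow> f (g y) = y"
proof -
  obtain N :: "('k, 'a) umodule" and f g where N: "N \<in> mods \<Lambda>" "f \<in> rhom \<Lambda> E N" "g \<in> rhom \<Lambda> N E"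
    "\<And>x. x \<in> carrier E \<Longrightarrow> g (f x) = x" "\<And>y. y \<in> carrier N \<Longrightarrow> f (g y) = y"
    by (rule universe_copy[OF fin_dim_algebra_axioms proj_inj_mods[OF assms]]) (rule that)
  have "projective \<Lambda> N" by (rule projective_retract[OF _ N(1,3,2,5)]) (use assms proj_inj_iff in blast)
  moreover have "injective \<Lambda> N" by (rule injective_retract[OF _ N(1,3,2,5)]) (use assms proj_inj_iff in blast)
  ultimately have "N \<in> proj_inj_modules \<Lambda>" by (simp add: proj_inj_iff)
  with N that show ?thesis by blast
qed

lemma proj_inj_copresentedI:
  fixes M :: "('a, 'm) rmodule" and J0 :: "('a, 'n) rmodule" and J1 :: "('a, 'p) rmodule"
  assumes J: "J0 \<in> proj_inj_modules \<Lambda>" "J1 \<in> proj_inj_modules \<Lambda>"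
    and a: "a \<in> rhom \<Lambda> M J0" "inj_on a (carrier M)" and b: "b \<in> rhom \<Lambda> J0 J1"
    and ex: "\<And>y. y \<in> carrier J0 \<Longrightarrow> b y = \<zero>\<^bsub>J1\<^esub> \<longleftrightarrow> y \<in> a ` carrier M"
  shows "proj_inj_copresented M"
proof -
  obtain N0 :: "('k, 'a) umodule" and f f' where N0: "N0 \<in> proj_inj_modules \<Lambda>" "f \<in> rhom \<Lambda> J0 N0"
    "f' \<in> rhom \<Lambda> N0 J0" "\<And>x. x \<in> carrier J0 \<Longrightarrow> f' (f x) = x" "\<And>y. y \<in> carrier N0 \<Longrightarrow> f (f' y) = y"
    by (rule proj_inj_copy[OF J(1)]) (rule that)
  obtain N1 :: "('k, 'a) umodule" and g g' where N1: "N1 \<in> proj_inj_modules \<Lambda>" "g \<in> rhom \<Lambda> J1 N1"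
    "g' \<in> rhom \<Lambda> N1 J1" "\<And>x. x \<in> carrier J1 \<Longrightarrow> g' (g x) = x" "\<And>y. y \<in> carrier N1 \<Longrightarrow> g (g' y) = y"
    by (rule proj_inj_copy[OF J(2)]) (rule that)
  have rm: "right_module \<Lambda> J1" "right_module \<Lambda> N1" using J N1 by (auto intro: modsD proj_inj_mods)
  have fa: "f \<circ> a \<in> rhom \<Lambda> M N0" using a N0 by (intro rhom_comp)
  have gb: "g \<circ> b \<circ> f' \<in> rhom \<Lambda> N0 N1" using b N0 N1 by (intro rhom_comp)
  have "inj_on (f \<circ> a) (carrier M)"
  proof (rule comp_inj_on[OF a(2)])
    have "inj_on f (carrier J0)" by (rule inj_on_inverseI[of _ f']) (rule N0(4))
    then show "inj_on f (a ` carrier M)" by (rule inj_on_subset) (use a(1) rhom_closed in auto)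
  qed
  moreover have "(g \<circ> b \<circ> f') y = \<zero>\<^bsub>N1\<^esub> \<longleftrightarrow> y \<in> (f \<circ> a) ` carrier M" if y: "y \<in> carrier N0" for y
  proof -
    have y': "f' y \<in> carrier J0" using y N0 by (simp add: rhom_closed)
    have bc: "b (f' y) \<in> carrier J1" using y' b by (simp add: rhom_closed)
    have "(g \<circ> b \<circ> f') y = \<zero>\<^bsub>N1\<^esub> \<longleftrightarrow> b (f' y) = \<zero>\<^bsub>J1\<^esub>"
      using N1(4)[OF bc] rhom_zero[OF rm N1(2)] rhom_zero[OF rm(2,1) N1(3)] by (metis comp_def)
    also have "\<dots> \<longleftrightarrow> f' y \<in> a ` carrier M" by (rule ex[OF y'])
    also have "\<dots> \<longleftrightarrow> y \<in> (f \<circ> a) ` carrier M"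
    proof
      assume "f' y \<in> a ` carrier M"
      then have "f (f' y) \<in> f ` a ` carrier M" by (rule imageI)
      then show "y \<in> (f \<circ> a) ` carrier M" using N0(5)[OF y] by (simp add: image_comp)
    next
      assume "y \<in> (f \<circ> a) ` carrier M"
      then obtain m where m: "m \<in> carrier M" "y = f (a m)" by auto
      then show "f' y \<in> a ` carrier M" using N0(4) rhom_closed[OF a(1)] by simp
    qed
    finally show ?thesis .
  qed
  ultimately show ?thesis unfolding proj_inj_copresented_def using N0(1) N1(1) fa gb by blast
qed

lemma proj_inj_copresentedE:
  fixes M :: "('a, 'm) rmodule"
  assumes "proj_inj_copresented M"
  obtains J0 J1 :: "('k, 'a) umodule" and a b where "J0 \<in> proj_inj_modules \<Lambda>" "J1 \<in> proj_inj_modules \<Lambda>"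
    "a \<in> rhom \<Lambda> M J0" "inj_on a (carrier M)" "b \<in> rhom \<Lambda> J0 J1"
    "\<And>y. y \<in> carrier J0 \<Longrightarrow> b y = \<zero>\<^bsub>J1\<^esub> \<longleftrightarrow> y \<in> a ` carrier M"
  using assms unfolding proj_inj_copresented_def by blast

lemma proj_inj_copresented_zero:
  assumes "right_module \<Lambda> M" "carrier M = {\<zero>\<^bsub>M\<^esub>}"
  shows "proj_inj_copresented M"
proof (rule proj_inj_copresentedI)
  show "M \<in> proj_inj_modules \<Lambda>" "M \<in> proj_inj_modules \<Lambda>"
    using zero_projective[OF assms] zero_injective[OF assms] by (simp_all add: proj_inj_iff)
qed (auto simp: assms(2) intro: rhom_id)

lemma proj_inj_copresented_prod:
  assumes "proj_inj_copresented M" "proj_inj_copresented N"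
  shows "proj_inj_copresented (prod_module M N)"
proof -
  obtain J0 J1 :: "('k, 'a) umodule" and a b where J: "J0 \<in> proj_inj_modules \<Lambda>" "J1 \<in> proj_inj_modules \<Lambda>"
    "a \<in> rhom \<Lambda> M J0" "inj_on a (carrier M)" "b \<in> rhom \<Lambda> J0 J1"
    "\<And>y. y \<in> carrier J0 \<Longrightarrow> b y = \<zero>\<^bsub>J1\<^esub> \<longleftrightarrow> y \<in> a ` carrier M"
    by (rule proj_inj_copresentedE[OF assms(1)]) (rule that)
  obtain L0 L1 :: "('k, 'a) umodule" and c d where L: "L0 \<in> proj_inj_modules \<Lambda>" "L1 \<in> proj_inj_modules \<Lambda>"
    "c \<in> rhom \<Lambda> N L0" "inj_on c (carrier N)" "d \<in> rhom \<Lambda> L0 L1"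
    "\<And>y. y \<in> carrier L0 \<Longrightarrow> d y = \<zero>\<^bsub>L1\<^esub> \<longleftrightarrow> y \<in> c ` carrier N"
    by (rule proj_inj_copresentedE[OF assms(2)]) (rule that)
  show ?thesis
  proof (rule proj_inj_copresentedI[OF proj_inj_prod[OF J(1) L(1)] proj_inj_prod[OF J(2) L(2)]])
    show "(\<lambda>z. ((a \<circ> fst) z, (c \<circ> snd) z)) \<in> rhom \<Lambda> (prod_module M N) (prod_module J0 L0)"
      by (rule rhom_pair[OF rhom_comp[OF rhom_fst J(3)] rhom_comp[OF rhom_snd L(3)]])
    show "(\<lambda>z. ((b \<circ> fst) z, (d \<circ> snd) z)) \<in> rhom \<Lambda> (prod_module J0 L0) (prod_module J1 L1)"
      by (rule rhom_pair[OF rhom_comp[OF rhom_fst J(5)] rhom_comp[OF rhom_snd L(5)]])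
    show "inj_on (\<lambda>z. ((a \<circ> fst) z, (c \<circ> snd) z)) (carrier (prod_module M N))"
      using J(4) L(4) by (auto simp: inj_on_def)
    fix y assume "y \<in> carrier (prod_module J0 L0)"
    then obtain u v where y: "u \<in> carrier J0" "v \<in> carrier L0" "y = (u, v)" by auto
    show "((b \<circ> fst) y, (d \<circ> snd) y) = \<zero>\<^bsub>prod_module J1 L1\<^esub> \<longleftrightarrow>
        y \<in> (\<lambda>z. ((a \<circ> fst) z, (c \<circ> snd) z)) ` carrier (prod_module M N)"
      using J(6)[OF y(1)] L(6)[OF y(2)] by (force simp: y(3))
  qed
qed

text \<open>
  Let \<open>N\<close> be the summand of \<open>M\<close> cut out by the idempotent \<open>i r\<close>.  The endomorphism \<open>1 - i r\<close> of \<open>M\<close>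
  extends along \<open>a : M \<rightarrow> J0\<close> to an endomorphism \<open>c\<close> of \<open>J0\<close>, and an element of the kernel of \<open>b\<close>,
  which is \<open>a M\<close>, lies in \<open>a (i N)\<close> exactly if \<open>c\<close> kills it.  So \<open>N\<close> is the kernel of
  \<open>(b, c) : J0 \<rightarrow> J1 \<oplus> J0\<close>.
\<close>

lemma proj_inj_copresented_retract:
  assumes "proj_inj_copresented M" and M: "M \<in> mods \<Lambda>" and N: "right_module \<Lambda> N"
    and i: "i \<in> rhom \<Lambda> N M" and r: "r \<in> rhom \<Lambda> M N" and ri: "\<And>x. x \<in> carrier N \<Longrightarrow> r (i x) = x"
  shows "proj_inj_copresented N"
proof -
  obtain J0 J1 :: "('k, 'a) umodule" and a b where J: "J0 \<in> proj_inj_modules \<Lambda>" "J1 \<in> proj_inj_modules \<Lambda>"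
    "a \<in> rhom \<Lambda> M J0" "inj_on a (carrier M)" "b \<in> rhom \<Lambda> J0 J1"
    "\<And>y. y \<in> carrier J0 \<Longrightarrow> b y = \<zero>\<^bsub>J1\<^esub> \<longleftrightarrow> y \<in> a ` carrier M"
    by (rule proj_inj_copresentedE[OF assms(1)]) (rule that)
  have Mr: "right_module \<Lambda> M" by (rule modsD[OF M])
  have J0: "J0 \<in> mods \<Lambda>" "injective \<Lambda> J0" "right_module \<Lambda> J0"
    using J(1) by (auto simp: proj_inj_iff intro: injective_mods modsD)
  interpret M: right_module \<Lambda> M by (rule Mr)
  interpret J0: right_module \<Lambda> J0 by (rule J0(3))
  have ir: "i \<circ> r \<in> rhom \<Lambda> M M" using r i by (rule rhom_comp)
  have e: "(\<lambda>x. id x \<ominus>\<^bsub>M\<^esub> (i \<circ> r) x) \<in> rhom \<Lambda> M M" by (rule rhom_diff[OF Mr rhom_id ir])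
  obtain c where c: "c \<in> rhom \<Lambda> J0 J0" "\<And>x. x \<in> carrier M \<Longrightarrow> c (a x) = a (x \<ominus>\<^bsub>M\<^esub> i (r x))"
    using injective_extend[OF fin_dim_algebra_axioms J0(2) M J0(1) J(3,4) rhom_comp[OF e J(3)]] by auto
  show ?thesis
  proof (rule proj_inj_copresentedI[OF J(1) proj_inj_prod[OF J(2,1)] rhom_comp[OF i J(3)] _ rhom_pair[OF J(5) c(1)]])
    have "inj_on i (carrier N)" by (rule inj_on_inverseI[of _ r]) (rule ri)
    moreover have "inj_on a (i ` carrier N)" using J(4) by (rule inj_on_subset) (use i rhom_closed in auto)
    ultimately show "inj_on (a \<circ> i) (carrier N)" by (rule comp_inj_on)
    fix y assume y: "y \<in> carrier J0"
    show "(b y, c y) = \<zero>\<^bsub>prod_module J1 J0\<^esub> \<longleftrightarrow> y \<in> (a \<circ> i) ` carrier N"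
    proof
      assume "(b y, c y) = \<zero>\<^bsub>prod_module J1 J0\<^esub>"
      then have by0: "b y = \<zero>\<^bsub>J1\<^esub>" and cy: "c y = \<zero>\<^bsub>J0\<^esub>" by auto
      then obtain z where z: "z \<in> carrier M" "y = a z" using J(6)[OF y] by blast
      have irz: "i (r z) \<in> carrier M" using z ir rhom_closed by fastforce
      have "a (z \<ominus>\<^bsub>M\<^esub> i (r z)) = \<zero>\<^bsub>J0\<^esub>" using c(2)[OF z(1)] cy z(2) by simp
      then have "z \<ominus>\<^bsub>M\<^esub> i (r z) = \<zero>\<^bsub>M\<^esub>" using z irz by (intro rhom_inj_zero[OF Mr J0(3) J(3,4)]) simp_all
      then have "z = i (r z)" using z irz M.minus_eq_zero_iff by blast
      then have "y = (a \<circ> i) (r z)" using z(2) by simp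
      then show "y \<in> (a \<circ> i) ` carrier N" using rhom_closed[OF r z(1)] by blast
    next
      assume "y \<in> (a \<circ> i) ` carrier N"
      then obtain n where n: "n \<in> carrier N" "y = a (i n)" by auto
      have iM: "i n \<in> carrier M" using i n by (simp add: rhom_closed)
      then have "b y = \<zero>\<^bsub>J1\<^esub>" using J(6)[OF y] n(2) by blast
      moreover have "c y = \<zero>\<^bsub>J0\<^esub>"
        using c(2)[OF iM] iM n ri rhom_zero[OF Mr J0(3) J(3)] M.minus_eq_zero_iff[OF iM iM] by simp
      ultimately show "(b y, c y) = \<zero>\<^bsub>prod_module J1 J0\<^esub>" by simp
    qed
  qed
qed

lemma proj_inj_copresented_reg_module:
  assumes "dom_dim \<Lambda> \<ge> 2"
  shows "proj_inj_copresented (reg_module \<Lambda>)"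
proof -
  define A where "A = {enat n | n I d \<eta>.
     minimal_injective_resolution \<Lambda> (reg_module \<Lambda>) I d \<eta> \<and> (\<forall>i < n. projective \<Lambda> (I i))}"
  have "\<exists>x \<in> A. 1 < x"
  proof (rule ccontr)
    assume "\<not> (\<exists>x \<in> A. 1 < x)"
    then have "Sup A \<le> 1" by (intro Sup_least) (auto simp: not_less)
    moreover have "2 \<le> Sup A" using assms unfolding dom_dim_def A_def .
    ultimately have "(2 :: enat) \<le> 1" by (rule order_trans[rotated])
    then show False by simp
  qed
  then obtain n I d \<eta> where n: "1 < enat n" and res: "minimal_injective_resolution \<Lambda> (reg_module \<Lambda>) I d \<eta>"
    and pr: "\<forall>i < n. projective \<Lambda> (I i)" unfolding A_def by blast
  have "1 < n" using n by (simp add: one_enat_def)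
  then have "I 0 \<in> proj_inj_modules \<Lambda>" "I 1 \<in> proj_inj_modules \<Lambda>"
    using pr res by (simp_all add: proj_inj_iff minimal_injective_resolution_def)
  moreover have "\<eta> \<in> rhom \<Lambda> (reg_module \<Lambda>) (I 0)" "inj_on \<eta> (carrier (reg_module \<Lambda>))"
    "d 0 \<in> rhom \<Lambda> (I 0) (I 1)"
    and im: "\<eta> ` carrier (reg_module \<Lambda>) = a_kernel (I 0) (I 1) (d 0)"
    using res unfolding minimal_injective_resolution_def by auto
  moreover have "d 0 y = \<zero>\<^bsub>I 1\<^esub> \<longleftrightarrow> y \<in> \<eta> ` carrier (reg_module \<Lambda>)" if "y \<in> carrier (I 0)" for y
    unfolding im using that by (simp add: a_kernel_iff)
  ultimately show ?thesis by (intro proj_inj_copresentedI)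
qed

text \<open>
  A finitely generated free module maps onto \<open>M\<close>.  It is built by adding one copy of \<open>\<Lambda>\<close> for each
  generator of \<open>M\<close>, and moved back to the type \<open>nat \<Rightarrow> 'k\<close> after each step.
\<close>

lemma exists_copresented_projective_onto:
  fixes M :: "('a, 'm) rmodule"
  assumes M: "M \<in> mods \<Lambda>" and dom: "proj_inj_copresented (reg_module \<Lambda>)"
  shows "\<exists>P :: ('k, 'a) umodule. projective \<Lambda> P \<and> proj_inj_copresented P \<and> (\<exists>g \<in> rhom \<Lambda> P M. g ` carrier P = carrier M)"
proof -
  have Mr: "right_module \<Lambda> M" by (rule modsD[OF M])
  interpret M: right_module \<Lambda> M by (rule Mr)
  obtain S where S: "finite S" "S \<subseteq> carrier M"
    "\<And>N. rsubmodule \<Lambda> N M \<Longrightarrow> S \<subseteq> N \<Longrightarrow> carrier M \<subseteq> N"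
    using M unfolding mods_iff_generated by blast
  have "\<exists>P :: ('k, 'a) umodule. projective \<Lambda> P \<and> proj_inj_copresented P \<and> (\<exists>g \<in> rhom \<Lambda> P M. S \<subseteq> g ` carrier P)"
    using S(1,2)
  proof (induction S rule: finite_induct)
    case empty
    define Z where "Z = (reg_module \<Lambda>)\<lparr>carrier := {\<zero>}\<rparr>"
    have "right_module \<Lambda> Z" unfolding Z_def
      using rsubmodule_right_module[OF reg_right_module rsubmodule_zero[OF reg_right_module]] by simp
    moreover have "carrier Z = {\<zero>\<^bsub>Z\<^esub>}" by (simp add: Z_def)
    ultimately have Z: "projective \<Lambda> Z" "proj_inj_copresented Z" by (rule zero_projective, rule proj_inj_copresented_zero)
    obtain P :: "('k, 'a) umodule" and f g where P: "P \<in> mods \<Lambda>" "f \<in> rhom \<Lambda> Z P" "g \<in> rhom \<Lambda> P Z"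
      "\<And>x. x \<in> carrier Z \<Longrightarrow> g (f x) = x" "\<And>y. y \<in> carrier P \<Longrightarrow> f (g y) = y"
      by (rule universe_copy[OF fin_dim_algebra_axioms projective_mods[OF Z(1)]]) (rule that)
    have "projective \<Lambda> P" by (rule projective_retract[OF Z(1) P(1,3,2,5)])
    moreover have "proj_inj_copresented P"
      by (rule proj_inj_copresented_retract[OF Z(2) projective_mods[OF Z(1)] modsD[OF P(1)] P(3,2,5)])
    ultimately show ?case using rhom_const_zero[OF Mr] by blast
  next
    case (insert s S)
    then obtain P g where P: "projective \<Lambda> (P :: ('k, 'a) umodule)" "proj_inj_copresented P" "g \<in> rhom \<Lambda> P M"
      "S \<subseteq> g ` carrier P" by auto
    have s: "s \<in> carrier M" using insert.prems by simp
    have Pr: "right_module \<Lambda> P" using P(1) by (intro modsD projective_mods)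
    interpret P: right_module \<Lambda> P by (rule Pr)
    define Q where "Q = prod_module P (reg_module \<Lambda>)"
    have Q: "projective \<Lambda> Q" "proj_inj_copresented Q"
      unfolding Q_def using P dom by (auto intro: projective_prod reg_projective proj_inj_copresented_prod)
    define q where "q z = (g \<circ> fst) z \<oplus>\<^bsub>M\<^esub> ((\<lambda>a. s \<triangleleft>\<^bsub>M\<^esub> a) \<circ> snd) z" for z
    have q: "q \<in> rhom \<Lambda> Q M" unfolding q_def Q_def
      by (rule rhom_plus[OF Mr rhom_comp[OF rhom_fst P(3)] rhom_comp[OF rhom_snd reg_rhom[OF Mr s]]])
    have im: "insert s S \<subseteq> q ` carrier Q"
    proof
      fix x assume "x \<in> insert s S"
      then consider "x = s" | "x \<in> S" by blast
      then show "x \<in> q ` carrier Q"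
      proof cases
        case 1
        then have "x = q (\<zero>\<^bsub>P\<^esub>, \<one>)" using s rhom_zero[OF Pr Mr P(3)] by (simp add: q_def M.ract_one)
        then show ?thesis by (simp add: Q_def)
      next
        case 2
        then obtain y where y: "y \<in> carrier P" "x = g y" using P(4) by blast
        then have "x = q (y, \<zero>)" using s rhom_closed[OF P(3)] by (simp add: q_def M.zero_ract)
        then show ?thesis using y by (simp add: Q_def)
      qed
    qed
    obtain P' :: "('k, 'a) umodule" and f f' where P': "P' \<in> mods \<Lambda>" "f \<in> rhom \<Lambda> Q P'" "f' \<in> rhom \<Lambda> P' Q"
      "\<And>x. x \<in> carrier Q \<Longrightarrow> f' (f x) = x" "\<And>y. y \<in> carrier P' \<Longrightarrow> f (f' y) = y"
      by (rule universe_copy[OF fin_dim_algebra_axioms projective_mods[OF Q(1)]]) (rule that)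
    have "projective \<Lambda> P'" by (rule projective_retract[OF Q(1) P'(1,3,2,5)])
    moreover have "proj_inj_copresented P'"
      by (rule proj_inj_copresented_retract[OF Q(2) projective_mods[OF Q(1)] modsD[OF P'(1)] P'(3,2,5)])
    moreover have "q \<circ> f' \<in> rhom \<Lambda> P' M" using P' q by (intro rhom_comp)
    moreover have "insert s S \<subseteq> (q \<circ> f') ` carrier P'"
    proof
      fix x assume "x \<in> insert s S"
      then obtain z where z: "z \<in> carrier Q" "x = q z" using im by blast
      then have "x = (q \<circ> f') (f z)" using P'(4) by simp
      then show "x \<in> (q \<circ> f') ` carrier P'" using rhom_closed[OF P'(2) z(1)] by blast
    qed
    ultimately show ?case by blast
  qed
  then obtain P g where P: "projective \<Lambda> (P :: ('k, 'a) umodule)" "proj_inj_copresented P" "g \<in> rhom \<Lambda> P M"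
    "S \<subseteq> g ` carrier P" by blast
  have "carrier M \<subseteq> g ` carrier P"
    using P(4) by (intro S(3) rhom_image_rsubmodule[OF modsD[OF projective_mods[OF P(1)]] Mr P(3)])
  then have "g ` carrier P = carrier M" using P(3) by (auto simp: rhom_closed)
  then show ?thesis using P by blast
qed

text \<open>
  A projective module is a direct summand of the free module that maps onto it.
\<close>

lemma proj_inj_copresented_projective:
  assumes P: "projective \<Lambda> P" and dom: "proj_inj_copresented (reg_module \<Lambda>)"
  shows "proj_inj_copresented P"
proof -
  obtain F :: "('k, 'a) umodule" and g where F: "projective \<Lambda> F" "proj_inj_copresented F" "g \<in> rhom \<Lambda> F P"
    "g ` carrier F = carrier P"
    using exists_copresented_projective_onto[OF projective_mods[OF P] dom] by blast
  obtain h where h: "h \<in> rhom \<Lambda> P F" "\<And>p. p \<in> carrier P \<Longrightarrow> g (h p) = p"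
    using projective_lift[OF fin_dim_algebra_axioms P projective_mods[OF F(1)] projective_mods[OF P] F(3,4) rhom_id]
    by auto
  show ?thesis
    by (rule proj_inj_copresented_retract[OF F(2) projective_mods[OF F(1)] modsD[OF projective_mods[OF P]] h(1) F(3)])
      (rule h(2))
qed

section \<open>Submodules of projective modules\<close>

text \<open>
  Let \<open>\<sigma> : F \<rightarrow> S\<close> be onto with \<open>F\<close> projective.  It is enough that \<open>N = ker \<sigma>\<close> is projective.  The
  sequence \<open>0 \<rightarrow> N \<rightarrow> F \<rightarrow> I \<rightarrow> I / S \<rightarrow> 0\<close> and the resolution \<open>0 \<rightarrow> P 2 \<rightarrow> P 1 \<rightarrow> P 0 \<rightarrow> I / S \<rightarrow> 0\<close> have
  projective middle terms, so there are maps \<open>\<alpha>\<close> and \<open>\<beta>\<close> between them in both directions, and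
  \<open>\<beta> \<alpha>\<close> is homotopic to the identity.  In the leftmost degree the homotopy formula reads
  \<open>n = \<beta>2 (\<alpha>2 n) + h1 n\<close> with \<open>h1 : F \<rightarrow> N\<close>, so the identity of \<open>N\<close> factors through the projective
  module \<open>P 2 \<oplus> F\<close>.
\<close>

lemma proj_dim_submodule_le_one:
  fixes I :: "('a, 'm) rmodule"
  assumes gl: "gl_dim \<Lambda> \<le> 2" and dom: "proj_inj_copresented (reg_module \<Lambda>)"
    and I: "projective \<Lambda> I" and S: "rsubmodule \<Lambda> S I"
  shows "proj_dim \<Lambda> (I\<lparr>carrier := S\<rparr>) \<le> 1"
proof -
  have Im: "I \<in> mods \<Lambda>" and Ir: "right_module \<Lambda> I" using I by (auto intro: projective_mods modsD)
  interpret I: right_module \<Lambda> I by (rule Ir)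
  have SI: "S \<subseteq> carrier I" using S by (simp add: rsubmodule_iff[OF Ir])
  obtain Q :: "('a, 'm) rmodule" and p where Q: "right_module \<Lambda> Q" "p \<in> rhom \<Lambda> I Q" "p ` carrier I = carrier Q"
    "\<And>x. x \<in> carrier I \<Longrightarrow> p x = \<zero>\<^bsub>Q\<^esub> \<longleftrightarrow> x \<in> S"
    using exists_quotient_module[OF Ir S] by blast
  have Qm: "Q \<in> mods \<Lambda>" by (rule mods_surj_image[OF Im Q(1-3)])
  \<comment> \<open>\<open>C\<close> is a copy of \<open>I / S\<close> among the modules over which the global dimension is taken\<close>
  obtain C :: "('k, 'a) umodule" and c c' where C: "C \<in> mods \<Lambda>" "c \<in> rhom \<Lambda> Q C" "c' \<in> rhom \<Lambda> C Q"
    "\<And>x. x \<in> carrier Q \<Longrightarrow> c' (c x) = x" "\<And>y. y \<in> carrier C \<Longrightarrow> c (c' y) = y"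
    by (rule universe_copy[OF fin_dim_algebra_axioms Qm]) (rule that)
  have Cr: "right_module \<Lambda> C" by (rule modsD[OF C(1)])
  interpret C: right_module \<Lambda> C by (rule Cr)
  define \<pi> where "\<pi> = c \<circ> p"
  have \<pi>: "\<pi> \<in> rhom \<Lambda> I C" unfolding \<pi>_def using Q(2) C(2) by (rule rhom_comp)
  have \<pi>im: "\<pi> ` carrier I = carrier C"
  proof
    show "\<pi> ` carrier I \<subseteq> carrier C" using \<pi> by (auto simp: rhom_closed)
    show "carrier C \<subseteq> \<pi> ` carrier I"
    proof
      fix y assume y: "y \<in> carrier C"
      then have "c' y \<in> p ` carrier I" using Q(3) C(3) by (simp add: rhom_closed)
      then obtain x where x: "x \<in> carrier I" "c' y = p x" by blast
      have "\<pi> x = y" using C(5)[OF y] x(2) by (simp add: \<pi>_def)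
      then show "y \<in> \<pi> ` carrier I" using x(1) by blast
    qed
  qed
  have \<pi>ker: "\<pi> x = \<zero>\<^bsub>C\<^esub> \<longleftrightarrow> x \<in> S" if "x \<in> carrier I" for x
    using Q(4)[OF that] C(4)[of "p x"] rhom_closed[OF Q(2) that] rhom_zero[OF Q(1) Cr C(2)]
      rhom_zero[OF Cr Q(1) C(3)] by (auto simp: \<pi>_def)
  have "proj_dim \<Lambda> C \<le> gl_dim \<Lambda>" unfolding gl_dim_def using C(1) by (rule SUP_upper)
  then have "proj_dim \<Lambda> C \<le> enat 2" using gl order_trans by (metis numeral_eq_enat)
  then obtain P d \<epsilon> where res: "projective_resolution \<Lambda> C P d \<epsilon>"
    and z: "\<And>i. i > 2 \<Longrightarrow> carrier (P i) = {\<zero>\<^bsub>P i\<^esub>}" unfolding proj_dim_le_iff by blast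
  have pr: "projective \<Lambda> (P i)" and dr: "d i \<in> rhom \<Lambda> (P (Suc i)) (P i)" for i
    using res by (auto simp: projective_resolution_def)
  have Pm: "P i \<in> mods \<Lambda>" and Pr: "right_module \<Lambda> (P i)" for i using pr by (auto intro: modsD projective_mods)
  have e: "\<epsilon> \<in> rhom \<Lambda> (P 0) C" "\<epsilon> ` carrier (P 0) = carrier C"
    and k0: "d 0 ` carrier (P 1) = a_kernel (P 0) C \<epsilon>"
    and k: "\<And>i. d (Suc i) ` carrier (P (Suc (Suc i))) = a_kernel (P (Suc i)) (P i) (d i)"
    using res unfolding projective_resolution_def by auto
  have k1: "d 1 ` carrier (P 2) = a_kernel (P 1) (P 0) (d 0)"
    and k2: "d 2 ` carrier (P 3) = a_kernel (P 2) (P 1) (d 1)"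
    using k[of 0] k[of 1] by (simp_all add: eval_nat_numeral)
  have d0: "d 0 \<in> rhom \<Lambda> (P 1) (P 0)" and d1: "d 1 \<in> rhom \<Lambda> (P 2) (P 1)" and d2: "d 2 \<in> rhom \<Lambda> (P 3) (P 2)"
    using dr[of 0] dr[of 1] dr[of 2] by (simp_all add: eval_nat_numeral)
  have inj: "inj_on (d 1) (carrier (P 2))"
  proof (rule rhom_inj_onI[OF Pr Pr d1])
    fix x assume "x \<in> carrier (P 2)" "d 1 x = \<zero>\<^bsub>P 1\<^esub>"
    then have "x \<in> d 2 ` carrier (P 3)" unfolding k2 by (simp add: a_kernel_iff)
    then show "x = \<zero>\<^bsub>P 2\<^esub>" using z[of 3] rhom_zero[OF Pr Pr d2] by simp
  qed
  have ker0: "\<epsilon> x = \<zero>\<^bsub>C\<^esub> \<longleftrightarrow> x \<in> d 0 ` carrier (P 1)" if "x \<in> carrier (P 0)" for x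
    unfolding k0 using that by (simp add: a_kernel_iff)
  have ker1: "d 0 x = \<zero>\<^bsub>P 0\<^esub> \<longleftrightarrow> x \<in> d 1 ` carrier (P 2)" if "x \<in> carrier (P 1)" for x
    unfolding k1 using that by (simp add: a_kernel_iff)
  have dd0: "\<epsilon> (d 0 x) = \<zero>\<^bsub>C\<^esub>" if "x \<in> carrier (P 1)" for x
    using ker0[of "d 0 x"] that rhom_closed[OF d0] by blast
  have dd1: "d 0 (d 1 x) = \<zero>\<^bsub>P 0\<^esub>" if "x \<in> carrier (P 2)" for x
    using ker1[of "d 1 x"] that rhom_closed[OF d1] by blast
  obtain F :: "('k, 'a) umodule" and \<sigma> where F: "projective \<Lambda> F" "\<sigma> \<in> rhom \<Lambda> F (I\<lparr>carrier := S\<rparr>)"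
    and \<sigma>im': "\<sigma> ` carrier F = carrier (I\<lparr>carrier := S\<rparr>)"
    using exists_copresented_projective_onto[OF rsubmodule_mods[OF Im S] dom] by blast
  have \<sigma>im: "\<sigma> ` carrier F = S" using \<sigma>im' by simp
  have \<sigma>: "\<sigma> \<in> rhom \<Lambda> F I" using F(2) SI by (auto simp: rhom_def)
  have Fm: "F \<in> mods \<Lambda>" and Fr: "right_module \<Lambda> F" using F(1) by (auto intro: projective_mods modsD)
  interpret F: right_module \<Lambda> F by (rule Fr)
  define N where "N = {x \<in> carrier F. \<sigma> x = \<zero>\<^bsub>I\<^esub>}"
  have Ns: "rsubmodule \<Lambda> N F" unfolding N_def by (rule rhom_ker_rsubmodule[OF Fr Ir \<sigma>])
  define NM where "NM = F\<lparr>carrier := N\<rparr>"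
  have NMm: "NM \<in> mods \<Lambda>" unfolding NM_def by (rule rsubmodule_mods[OF Fm Ns])
  have NMr: "right_module \<Lambda> NM" by (rule modsD[OF NMm])
  have incl: "id \<in> rhom \<Lambda> NM F" unfolding NM_def by (rule rhom_restrict[OF rhom_id]) (simp add: N_def)
  have F_simps: "carrier NM = N" "\<And>x y. x \<oplus>\<^bsub>NM\<^esub> y = x \<oplus>\<^bsub>F\<^esub> y" by (simp_all add: NM_def)
  obtain \<alpha>0 where \<alpha>0: "\<alpha>0 \<in> rhom \<Lambda> I (P 0)" "\<And>x. x \<in> carrier I \<Longrightarrow> \<epsilon> (\<alpha>0 x) = \<pi> x"
    using projective_lift[OF fin_dim_algebra_axioms I Pm C(1) e \<pi>] by blast
  obtain \<beta>0 where \<beta>0: "\<beta>0 \<in> rhom \<Lambda> (P 0) I" "\<And>x. x \<in> carrier (P 0) \<Longrightarrow> \<pi> (\<beta>0 x) = \<epsilon> x"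
    using projective_lift[OF fin_dim_algebra_axioms pr Im C(1) \<pi> \<pi>im e(1)] by blast
  have "\<exists>h \<in> rhom \<Lambda> F (P 1). \<forall>x \<in> carrier F. d 0 (h x) = (\<alpha>0 \<circ> \<sigma>) x"
  proof (rule projective_lift_image[OF F(1) Pm Pr d0 rhom_comp[OF \<sigma> \<alpha>0(1)]])
    fix x assume x: "x \<in> carrier F"
    then have "\<sigma> x \<in> S" "\<sigma> x \<in> carrier I" using \<sigma>im SI by auto
    then show "(\<alpha>0 \<circ> \<sigma>) x \<in> d 0 ` carrier (P 1)"
      using ker0[of "\<alpha>0 (\<sigma> x)"] \<alpha>0 \<pi>ker by (simp add: rhom_closed)
  qed
  then obtain \<alpha>1 where \<alpha>1: "\<alpha>1 \<in> rhom \<Lambda> F (P 1)" "\<And>x. x \<in> carrier F \<Longrightarrow> d 0 (\<alpha>1 x) = \<alpha>0 (\<sigma> x)" by auto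
  have "\<exists>h \<in> rhom \<Lambda> (P 1) F. \<forall>x \<in> carrier (P 1). \<sigma> (h x) = (\<beta>0 \<circ> d 0) x"
  proof (rule projective_lift_image[OF pr Fm Ir \<sigma> rhom_comp[OF d0 \<beta>0(1)]])
    fix x assume x: "x \<in> carrier (P 1)"
    then have "d 0 x \<in> carrier (P 0)" using d0 by (simp add: rhom_closed)
    then have "\<pi> (\<beta>0 (d 0 x)) = \<zero>\<^bsub>C\<^esub>" "\<beta>0 (d 0 x) \<in> carrier I"
      using \<beta>0 dd0[OF x] by (simp_all add: rhom_closed)
    then show "(\<beta>0 \<circ> d 0) x \<in> \<sigma> ` carrier F" using \<pi>ker \<sigma>im by simp
  qed
  then obtain \<beta>1 where \<beta>1: "\<beta>1 \<in> rhom \<Lambda> (P 1) F" "\<And>x. x \<in> carrier (P 1) \<Longrightarrow> \<sigma> (\<beta>1 x) = \<beta>0 (d 0 x)" by auto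
  have dif0: "(\<lambda>x. id x \<ominus>\<^bsub>I\<^esub> (\<beta>0 \<circ> \<alpha>0) x) \<in> rhom \<Lambda> I I"
    by (rule rhom_diff[OF Ir rhom_id rhom_comp[OF \<alpha>0(1) \<beta>0(1)]])
  have "\<exists>h \<in> rhom \<Lambda> I F. \<forall>x \<in> carrier I. \<sigma> (h x) = id x \<ominus>\<^bsub>I\<^esub> (\<beta>0 \<circ> \<alpha>0) x"
  proof (rule projective_lift_image[OF I Fm Ir \<sigma> dif0])
    fix x assume x: "x \<in> carrier I"
    have a: "\<alpha>0 x \<in> carrier (P 0)" "\<beta>0 (\<alpha>0 x) \<in> carrier I" using x \<alpha>0 \<beta>0 by (simp_all add: rhom_closed)
    have "\<pi> (x \<ominus>\<^bsub>I\<^esub> \<beta>0 (\<alpha>0 x)) = \<pi> x \<ominus>\<^bsub>C\<^esub> \<pi> (\<beta>0 (\<alpha>0 x))" by (rule rhom_minus[OF Ir Cr \<pi> x a(2)])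
    also have "\<dots> = \<zero>\<^bsub>C\<^esub>"
      using x a \<alpha>0(2) \<beta>0(2) rhom_closed[OF \<pi>] C.minus_eq_zero_iff by simp
    finally show "id x \<ominus>\<^bsub>I\<^esub> (\<beta>0 \<circ> \<alpha>0) x \<in> \<sigma> ` carrier F"
      using \<pi>ker[of "x \<ominus>\<^bsub>I\<^esub> \<beta>0 (\<alpha>0 x)"] x a \<sigma>im by simp
  qed
  then obtain h0 where h0: "h0 \<in> rhom \<Lambda> I F" "\<And>x. x \<in> carrier I \<Longrightarrow> \<sigma> (h0 x) = x \<ominus>\<^bsub>I\<^esub> \<beta>0 (\<alpha>0 x)" by auto
  \<comment> \<open>\<open>N\<close> is not yet known to be projective; here \<open>d 1\<close> is injective, so no lifting is needed\<close>
  have "\<exists>h \<in> rhom \<Lambda> NM (P 2). \<forall>x \<in> carrier NM. d 1 (h x) = (\<alpha>1 \<circ> id) x"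
  proof (rule rhom_factor_inj[OF NMr Pr d1 inj rhom_comp[OF incl \<alpha>1(1)]])
    fix x assume "x \<in> carrier NM"
    then have x: "x \<in> carrier F" "\<sigma> x = \<zero>\<^bsub>I\<^esub>" by (simp_all add: F_simps N_def)
    then have "d 0 (\<alpha>1 x) = \<zero>\<^bsub>P 0\<^esub>" using \<alpha>1(2)[OF x(1)] rhom_zero[OF Ir Pr \<alpha>0(1)] by simp
    then show "(\<alpha>1 \<circ> id) x \<in> d 1 ` carrier (P 2)" using ker1 x \<alpha>1(1) by (simp add: rhom_closed)
  qed
  then obtain \<alpha>2 where \<alpha>2: "\<alpha>2 \<in> rhom \<Lambda> NM (P 2)" "\<And>x. x \<in> N \<Longrightarrow> d 1 (\<alpha>2 x) = \<alpha>1 x"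
    by (auto simp: F_simps)
  have \<beta>2: "\<beta>1 \<circ> d 1 \<in> rhom \<Lambda> (P 2) NM"
    unfolding NM_def
  proof (rule rhom_corestrict[OF rhom_comp[OF d1 \<beta>1(1)]], rule subsetI)
    fix y assume "y \<in> (\<beta>1 \<circ> d 1) ` carrier (P 2)"
    then obtain x where x: "x \<in> carrier (P 2)" "y = \<beta>1 (d 1 x)" by auto
    have dx: "d 1 x \<in> carrier (P 1)" using x d1 by (simp add: rhom_closed)
    then have "\<sigma> y = \<beta>0 \<zero>\<^bsub>P 0\<^esub>" using x \<beta>1(2) dd1 by simp
    then show "y \<in> N" using x dx rhom_zero[OF Pr Ir \<beta>0(1)] \<beta>1(1) by (simp add: N_def rhom_closed)
  qed
  \<comment> \<open>what the homotopy formula leaves over in degree one lies in the kernel of \<open>\<sigma>\<close>\<close>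
  define h1 where "h1 x = id x \<ominus>\<^bsub>F\<^esub> ((\<beta>1 \<circ> \<alpha>1) x \<oplus>\<^bsub>F\<^esub> (h0 \<circ> \<sigma>) x)" for x
  have h1F: "h1 \<in> rhom \<Lambda> F F" unfolding h1_def
    by (rule rhom_diff[OF Fr rhom_id rhom_plus[OF Fr rhom_comp[OF \<alpha>1(1) \<beta>1(1)] rhom_comp[OF \<sigma> h0(1)]]])
  have h1: "h1 \<in> rhom \<Lambda> F NM"
    unfolding NM_def
  proof (rule rhom_corestrict[OF h1F], rule subsetI)
    fix y assume "y \<in> h1 ` carrier F"
    then obtain x where x: "x \<in> carrier F" "y = h1 x" by auto
    have cl: "\<sigma> x \<in> carrier I" "\<alpha>1 x \<in> carrier (P 1)" "\<beta>1 (\<alpha>1 x) \<in> carrier F" "h0 (\<sigma> x) \<in> carrier F"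
      "\<beta>0 (\<alpha>0 (\<sigma> x)) \<in> carrier I"
      using x(1) \<sigma> \<alpha>1(1) \<beta>1(1) h0(1) \<alpha>0(1) \<beta>0(1) by (simp_all add: rhom_closed)
    have "\<sigma> (h1 x) = \<sigma> x \<ominus>\<^bsub>I\<^esub> (\<sigma> (\<beta>1 (\<alpha>1 x)) \<oplus>\<^bsub>I\<^esub> \<sigma> (h0 (\<sigma> x)))"
      unfolding h1_def using x(1) cl by (simp add: rhom_minus[OF Fr Ir \<sigma>] rhom_add[OF \<sigma>])
    also have "\<dots> = \<sigma> x \<ominus>\<^bsub>I\<^esub> (\<beta>0 (\<alpha>0 (\<sigma> x)) \<oplus>\<^bsub>I\<^esub> (\<sigma> x \<ominus>\<^bsub>I\<^esub> \<beta>0 (\<alpha>0 (\<sigma> x))))"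
      using cl x(1) \<beta>1(2) \<alpha>1(2) h0(2) by simp
    also have "\<beta>0 (\<alpha>0 (\<sigma> x)) \<oplus>\<^bsub>I\<^esub> (\<sigma> x \<ominus>\<^bsub>I\<^esub> \<beta>0 (\<alpha>0 (\<sigma> x))) = \<sigma> x"
      using cl by (simp add: a_minus_def I.a_lcomm I.r_neg)
    also have "\<sigma> x \<ominus>\<^bsub>I\<^esub> \<sigma> x = \<zero>\<^bsub>I\<^esub>" using cl I.minus_eq_zero_iff by blast
    finally show "y \<in> N" using x rhom_closed[OF h1F x(1)] by (simp add: N_def)
  qed
  have "projective \<Lambda> NM"
  proof (rule projective_of_two_projectives[OF pr F(1) NMm \<alpha>2(1) incl \<beta>2 h1])
    fix x assume "x \<in> carrier NM"
    then have x: "x \<in> N" "x \<in> carrier F" "\<sigma> x = \<zero>\<^bsub>I\<^esub>" by (simp_all add: F_simps N_def)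
    have b: "\<beta>1 (\<alpha>1 x) \<in> carrier F" using x \<alpha>1(1) \<beta>1(1) by (simp add: rhom_closed)
    have "h1 x = x \<ominus>\<^bsub>F\<^esub> \<beta>1 (\<alpha>1 x)" using x b rhom_zero[OF Ir Fr h0(1)] by (simp add: h1_def)
    then have "\<beta>1 (\<alpha>1 x) \<oplus>\<^bsub>F\<^esub> h1 x = x" using x(2) b by (simp add: a_minus_def F.a_lcomm F.r_neg)
    then show "(\<beta>1 \<circ> d 1) (\<alpha>2 x) \<oplus>\<^bsub>NM\<^esub> h1 (id x) = x" using \<alpha>2(2)[OF x(1)] by (simp add: F_simps)
  qed
  then show ?thesis
    using Ns unfolding NM_def N_def by (intro proj_dim_le_one_of_kernel[OF F(1,2) \<sigma>im' refl]) simp_all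
qed

section \<open>Modules of projective dimension at most one\<close>

text \<open>
  Extend the copresentation map \<open>a : P1 \<rightarrow> J0\<close> of \<open>P1\<close> along \<open>P1 \<rightarrow> P0\<close> to \<open>\<phi> : P0 \<rightarrow> J0\<close>.  Then
  \<open>b \<phi>\<close> vanishes on \<open>P1\<close> and induces \<open>s : M \<rightarrow> J\<close>.  By exactness at \<open>J0\<close>, each element of \<open>ker s\<close>
  has a preimage in \<open>ker \<phi>\<close>; and \<open>ker \<phi>\<close> meets \<open>P1\<close> trivially, so it maps injectively to \<open>M\<close>.  As
  a submodule of \<open>P0\<close> it also embeds in a projective-injective module \<open>E\<close>, and this embedding
  extends to \<open>t : M \<rightarrow> E\<close>.  Thus \<open>t\<close> detects what \<open>s\<close> kills, and \<open>(s, t)\<close> is injective.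
\<close>

lemma proj_inj_embedding:
  assumes dom: "proj_inj_copresented (reg_module \<Lambda>)" and M: "M \<in> mods \<Lambda>" and pd: "proj_dim \<Lambda> M \<le> 1"
  shows "\<exists>(J :: ('k, 'a) umodule) (E :: ('k, 'a) umodule). J \<in> proj_inj_modules \<Lambda> \<and> E \<in> proj_inj_modules \<Lambda> \<and>
    (\<exists>f \<in> rhom \<Lambda> M (prod_module J E). inj_on f (carrier M))"
proof -
  have Mr: "right_module \<Lambda> M" by (rule modsD[OF M])
  obtain P0 P1 :: "('k, 'a) umodule" and d e where P: "projective \<Lambda> P0" "projective \<Lambda> P1"
    and d: "d \<in> rhom \<Lambda> P1 P0" "inj_on d (carrier P1)"
    and e: "e \<in> rhom \<Lambda> P0 M" "e ` carrier P0 = carrier M"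
    and ex: "\<And>x. x \<in> carrier P0 \<Longrightarrow> e x = \<zero>\<^bsub>M\<^esub> \<longleftrightarrow> x \<in> d ` carrier P1"
    by (rule exact_of_proj_dim_le_one[OF pd]) (rule that)
  have Pm: "P0 \<in> mods \<Lambda>" "P1 \<in> mods \<Lambda>" and Pr: "right_module \<Lambda> P0" "right_module \<Lambda> P1"
    using P by (auto intro: projective_mods modsD)
  interpret M: right_module \<Lambda> M by (rule Mr)
  interpret P0: right_module \<Lambda> P0 by (rule Pr)
  obtain J0 J :: "('k, 'a) umodule" and a b where J0: "J0 \<in> proj_inj_modules \<Lambda>" and J: "J \<in> proj_inj_modules \<Lambda>"
    and a: "a \<in> rhom \<Lambda> P1 J0" "inj_on a (carrier P1)" and b: "b \<in> rhom \<Lambda> J0 J"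
    and ab: "\<And>y. y \<in> carrier J0 \<Longrightarrow> b y = \<zero>\<^bsub>J\<^esub> \<longleftrightarrow> y \<in> a ` carrier P1"
    by (rule proj_inj_copresentedE[OF proj_inj_copresented_projective[OF P(2) dom]]) (rule that)
  obtain E E' :: "('k, 'a) umodule" and a0 b0 where E: "E \<in> proj_inj_modules \<Lambda>" "E' \<in> proj_inj_modules \<Lambda>"
    and a0: "a0 \<in> rhom \<Lambda> P0 E" "inj_on a0 (carrier P0)" "b0 \<in> rhom \<Lambda> E E'"
    and "\<And>y. y \<in> carrier E \<Longrightarrow> b0 y = \<zero>\<^bsub>E'\<^esub> \<longleftrightarrow> y \<in> a0 ` carrier P0"
    by (rule proj_inj_copresentedE[OF proj_inj_copresented_projective[OF P(1) dom]]) (rule that)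
  have J0': "injective \<Lambda> J0" "J0 \<in> mods \<Lambda>" "right_module \<Lambda> J0" and J': "right_module \<Lambda> J"
    and E': "injective \<Lambda> E" "right_module \<Lambda> E"
    using J0 J E by (auto simp: proj_inj_iff intro: injective_mods modsD)
  interpret J0: right_module \<Lambda> J0 by (rule J0')
  obtain \<phi> where \<phi>: "\<phi> \<in> rhom \<Lambda> P0 J0" "\<And>x. x \<in> carrier P1 \<Longrightarrow> \<phi> (d x) = a x"
    using injective_extend[OF fin_dim_algebra_axioms J0'(1) Pm(2,1) d a(1)] by blast
  have "\<exists>s \<in> rhom \<Lambda> M J. \<forall>x \<in> carrier P0. s (e x) = (b \<circ> \<phi>) x"
  proof (rule rhom_factor_surj[OF Pr(1) Mr J' e rhom_comp[OF \<phi>(1) b]])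
    fix x assume "x \<in> carrier P0" "e x = \<zero>\<^bsub>M\<^esub>"
    then obtain y where y: "y \<in> carrier P1" "x = d y" using ex by blast
    then show "(b \<circ> \<phi>) x = \<zero>\<^bsub>J\<^esub>" using \<phi>(2)[OF y(1)] ab[of "a y"] rhom_closed[OF a(1) y(1)] by simp
  qed
  then obtain s where s: "s \<in> rhom \<Lambda> M J" "\<And>x. x \<in> carrier P0 \<Longrightarrow> s (e x) = b (\<phi> x)" by auto
  define L where "L = {x \<in> carrier P0. \<phi> x = \<zero>\<^bsub>J0\<^esub>}"
  have L: "rsubmodule \<Lambda> L P0" unfolding L_def by (rule rhom_ker_rsubmodule[OF Pr(1) J0'(3) \<phi>(1)])
  have LP: "L \<subseteq> carrier P0" by (auto simp: L_def)
  define LM where "LM = P0\<lparr>carrier := L\<rparr>"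
  have LM: "LM \<in> mods \<Lambda>" "right_module \<Lambda> LM" unfolding LM_def
    using rsubmodule_mods[OF Pm(1) L] rsubmodule_right_module[OF Pr(1) L] by auto
  have eL: "e \<in> rhom \<Lambda> LM M" unfolding LM_def by (rule rhom_restrict[OF e(1) LP])
  have einj: "inj_on e (carrier LM)"
  proof (rule rhom_inj_onI[OF LM(2) Mr eL])
    fix x assume "x \<in> carrier LM" "e x = \<zero>\<^bsub>M\<^esub>"
    then have x: "x \<in> carrier P0" "\<phi> x = \<zero>\<^bsub>J0\<^esub>" "x \<in> d ` carrier P1"
      using ex LP by (auto simp: LM_def L_def)
    then obtain y where y: "y \<in> carrier P1" "x = d y" by blast
    then have "a y = \<zero>\<^bsub>J0\<^esub>" using \<phi>(2) x(2) by simp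
    then have "y = \<zero>\<^bsub>P1\<^esub>" using rhom_inj_zero[OF Pr(2) J0'(3) a y(1)] by simp
    then show "x = \<zero>\<^bsub>LM\<^esub>" using y(2) rhom_zero[OF Pr(2,1) d(1)] by (simp add: LM_def)
  qed
  have "a0 \<in> rhom \<Lambda> LM E" unfolding LM_def by (rule rhom_restrict[OF a0(1) LP])
  from injective_extend[OF fin_dim_algebra_axioms E'(1) LM(1) M eL einj this]
  obtain t where t: "t \<in> rhom \<Lambda> M E" "\<And>x. x \<in> carrier LM \<Longrightarrow> t (e x) = a0 x" by blast
  have carLM: "carrier LM = L" by (simp add: LM_def)
  have st: "(\<lambda>m. (s m, t m)) \<in> rhom \<Lambda> M (prod_module J E)" by (rule rhom_pair[OF s(1) t(1)])
  have "inj_on (\<lambda>m. (s m, t m)) (carrier M)"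
  proof (rule rhom_inj_onI[OF Mr prod_right_module[OF J' E'(2)] st])
    fix m assume m: "m \<in> carrier M" "(s m, t m) = \<zero>\<^bsub>prod_module J E\<^esub>"
    then have sm: "s m = \<zero>\<^bsub>J\<^esub>" and tm: "t m = \<zero>\<^bsub>E\<^esub>" by auto
    obtain x where x: "x \<in> carrier P0" "m = e x" using m(1) e(2) by blast
    have "\<phi> x \<in> a ` carrier P1" using ab[of "\<phi> x"] s(2)[OF x(1)] sm x rhom_closed[OF \<phi>(1)] by simp
    then obtain y where y: "y \<in> carrier P1" "\<phi> x = a y" by blast
    have dy: "d y \<in> carrier P0" using d y by (simp add: rhom_closed)
    define x' where "x' = x \<ominus>\<^bsub>P0\<^esub> d y"
    have x': "x' \<in> carrier P0" using x dy by (simp add: x'_def)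
    have "\<phi> x' = \<phi> x \<ominus>\<^bsub>J0\<^esub> \<phi> (d y)"
      unfolding x'_def by (rule rhom_minus[OF Pr(1) J0'(3) \<phi>(1) x(1) dy])
    also have "\<dots> = \<zero>\<^bsub>J0\<^esub>"
      using y \<phi>(2)[OF y(1)] rhom_closed[OF a(1) y(1)] J0.minus_eq_zero_iff by simp
    finally have xL: "x' \<in> L" using x' by (simp add: L_def)
    have "e x' = e x \<ominus>\<^bsub>M\<^esub> e (d y)"
      unfolding x'_def by (rule rhom_minus[OF Pr(1) Mr e(1) x(1) dy])
    moreover have "e (d y) = \<zero>\<^bsub>M\<^esub>" using ex[OF dy] y by blast
    ultimately have em: "e x' = m" using x m(1) by (simp add: a_minus_def)
    then have "a0 x' = \<zero>\<^bsub>E\<^esub>" using t(2)[unfolded carLM, OF xL] tm by simp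
    then have "x' = \<zero>\<^bsub>P0\<^esub>" by (rule rhom_inj_zero[OF Pr(1) E'(2) a0(1,2) x'])
    then show "m = \<zero>\<^bsub>M\<^esub>" using em rhom_zero[OF Pr(1) Mr e(1)] by simp
  qed
  then show ?thesis using J E(1) st by blast
qed

text \<open>
  An embedding of the essential submodule \<open>soc \<Lambda> I\<close> into a projective-injective module extends to
  \<open>I\<close>.  Its kernel meets the socle trivially and therefore vanishes, and the embedding of \<open>I\<close>
  splits.
\<close>

lemma projective_of_soc:
  assumes dom: "proj_inj_copresented (reg_module \<Lambda>)" and I: "injective \<Lambda> I" and pd: "proj_dim \<Lambda> (soc \<Lambda> I) \<le> 1"
  shows "projective \<Lambda> I"
proof -
  have Im: "I \<in> mods \<Lambda>" and Ir: "right_module \<Lambda> I" using I by (auto intro: injective_mods modsD)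
  define S where "S = carrier (soc \<Lambda> I)"
  have soc: "soc \<Lambda> I = I\<lparr>carrier := S\<rparr>" unfolding S_def by (rule soc_eq)
  have S: "rsubmodule \<Lambda> S I" unfolding S_def by (rule soc_rsubmodule[OF Ir])
  have SI: "S \<subseteq> carrier I" using S by (simp add: rsubmodule_iff[OF Ir])
  have ess: "\<And>N. rsubmodule \<Lambda> N I \<Longrightarrow> N \<noteq> {\<zero>\<^bsub>I\<^esub>} \<Longrightarrow> S \<inter> N \<noteq> {\<zero>\<^bsub>I\<^esub>}"
    using soc_essential[OF Im] by (auto simp: essential_rsubmodule_def S_def)
  have Sm: "soc \<Lambda> I \<in> mods \<Lambda>" by (rule soc_mods[OF Im])
  obtain J E :: "('k, 'a) umodule" and f where JE: "J \<in> proj_inj_modules \<Lambda>" "E \<in> proj_inj_modules \<Lambda>"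
    and f: "f \<in> rhom \<Lambda> (soc \<Lambda> I) (prod_module J E)" "inj_on f (carrier (soc \<Lambda> I))"
    using proj_inj_embedding[OF dom Sm pd] by blast
  define T where "T = prod_module J E"
  have T: "projective \<Lambda> T" "injective \<Lambda> T"
    using proj_inj_prod[OF JE] by (simp_all add: T_def proj_inj_iff)
  have Tm: "T \<in> mods \<Lambda>" and Tr: "right_module \<Lambda> T" using T by (auto intro: injective_mods modsD)
  have f': "f \<in> rhom \<Lambda> (soc \<Lambda> I) T" using f by (simp add: T_def)
  have incl: "id \<in> rhom \<Lambda> (soc \<Lambda> I) I" unfolding soc by (rule rhom_restrict[OF rhom_id SI])
  obtain h where h: "h \<in> rhom \<Lambda> I T" "\<And>x. x \<in> S \<Longrightarrow> h x = f x"
    using injective_extend[OF fin_dim_algebra_axioms T(2) Sm Im incl _ f'] by (auto simp: S_def)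
  define N where "N = {x \<in> carrier I. h x = \<zero>\<^bsub>T\<^esub>}"
  have N: "rsubmodule \<Lambda> N I" unfolding N_def by (rule rhom_ker_rsubmodule[OF Ir Tr h(1)])
  have "x = \<zero>\<^bsub>I\<^esub>" if "x \<in> S \<inter> N" for x
    using rhom_inj_zero[OF modsD[OF Sm] Tr f' f(2), of x] that h(2)[of x]
    by (simp add: N_def S_def) (simp add: soc_def)
  moreover have "\<zero>\<^bsub>I\<^esub> \<in> S \<inter> N" using S N by (auto simp: rsubmodule_iff[OF Ir])
  ultimately have "S \<inter> N = {\<zero>\<^bsub>I\<^esub>}" by blast
  then have "N = {\<zero>\<^bsub>I\<^esub>}" using ess[OF N] by blast
  then have "inj_on h (carrier I)" by (intro rhom_inj_onI[OF Ir Tr h(1)]) (auto simp: N_def)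
  then obtain r where r: "r \<in> rhom \<Lambda> T I" "\<And>x. x \<in> carrier I \<Longrightarrow> r (h x) = x"
    using injective_extend[OF fin_dim_algebra_axioms I Im Tm h(1) _ rhom_id] by auto
  show ?thesis by (rule projective_retract[OF T(1) Im h(1) r(1)]) (rule r(2))
qed

end

section \<open>Socles of projective-injective modules\<close>

theorem theoremA:
  fixes K :: "'k ring" and \<Lambda> :: "('k, 'a) module"
  assumes "algebraically_closed K"
    and "fin_dim_algebra K \<Lambda>"
    and "basic_algebra \<Lambda>"
    and "auslander_algebra \<Lambda>"
  shows "(\<forall>I \<in> (mods \<Lambda> :: ('a, 'm) rmodule set). indecomposable \<Lambda> I \<and> injective \<Lambda> I \<longrightarrow>
            (projective \<Lambda> I \<longleftrightarrow> proj_dim \<Lambda> (soc \<Lambda> I) \<le> 1)) \<and>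
         (proj_inj_modules \<Lambda> :: ('a, 'm) rmodule set) =
            {I \<in> mods \<Lambda>. injective \<Lambda> I \<and> proj_dim \<Lambda> (soc \<Lambda> I) \<le> 1}"
proof -
  interpret fin_dim_algebra K \<Lambda> by fact
  have gl: "gl_dim \<Lambda> \<le> 2" and dom: "proj_inj_copresented (reg_module \<Lambda>)"
    using assms(4) proj_inj_copresented_reg_module by (auto simp: auslander_algebra_def)
  have "projective \<Lambda> I \<longleftrightarrow> proj_dim \<Lambda> (soc \<Lambda> I) \<le> 1" if I: "injective \<Lambda> I" for I :: "('a, 'm) rmodule"
  proof
    assume P: "projective \<Lambda> I"
    show "proj_dim \<Lambda> (soc \<Lambda> I) \<le> 1"
      by (subst soc_eq) (intro proj_dim_submodule_le_one gl dom P soc_rsubmodule modsD injective_mods[OF I])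
  next
    assume "proj_dim \<Lambda> (soc \<Lambda> I) \<le> 1"
    then show "projective \<Lambda> I" by (rule projective_of_soc[OF dom I])
  qed
  then show ?thesis by (auto simp: proj_inj_modules_def)
qed

end
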